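(* Let $G=(V,E)$ be a graph with $|V|=n$ and maximum degree $\Delta$, and consider the heat bath Glauber dynamics for proper $q$-colorings of $G$, with random update mixing time $\tau_{\mathrm r}(\varepsilon)$ and systematic scan mixing time $\tau_{\mathrm s}(\varepsilon)$. (i) If $G$ is a nonregular connected graph and $q=2\Delta$, then $$\tau_{\mathrm r}(\varepsilon)\le\tfrac12\Delta^2n^3\ln(n/\varepsilon),\qquad\hat\tau_{\mathrm s}(\varepsilon)\sim\tfrac34\Delta^2n^2\ln(n/\varepsilon).$$ (ii) If $G$ is a graph with tree-width $t$ and $\Delta\ge2t$, let $\psi=2\sqrt{t(\Delta-t)}$. Then $$\tau_{\mathrm r}(\varepsilon)\le\begin{cases}(q-\Delta)(q-\Delta-\psi)^{-1}n\ln(n/\varepsilon),&q>\Delta+\psi;\\ \psi^2\big(t(t+1)(\Delta-2t)\big)^{-1}n^2\ln(n/\varepsilon),&q=\Delta+\psi,\ \Delta>2t;\\ 8(t+1)^{-2}n^3\ln(n/\varepsilon),&q=\Delta+\psi,\ \Delta=2t;\end{cases}$$ $$\hat\tau_{\mathrm s}(\varepsilon)\sim\begin{cases}(q-\Delta-\tfrac12\psi)(q-\Delta-\psi)^{-1}\ln(n/\varepsilon),&q>\Delta+\psi;\\ \psi^2\big(t(t+1)(\Delta-2t)\big)^{-1}n\ln(n/\varepsilon),&q=\Delta+\psi,\ \Delta>2t;\\ 12(t+1)^{-2}n^2\ln(n/\varepsilon),&q=\Delta+\psi,\ \Delta=2t.\end{cases}$$ (iii) If $G$ is a planar graph and $\Delta\ge6$,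 let $\psi=2\sqrt{3(\Delta-3)}$. Then $$\tau_{\mathrm r}(\varepsilon)\le\begin{cases}(q-\Delta)(q-\Delta-\psi)^{-1}n\ln(n/\varepsilon),&q>\Delta+\psi;\\ \psi^2\big(12(\Delta-6)\big)^{-1}n^2\ln(n/\varepsilon),&q=\Delta+\psi,\ \Delta>6;\\ \tfrac12n^3\ln(n/\varepsilon),&q=\Delta+\psi,\ \Delta=6;\end{cases}$$ $$\hat\tau_{\mathrm s}(\varepsilon)\sim\begin{cases}(q-\Delta-\tfrac12\psi)(q-\Delta-\psi)^{-1}\ln(n/\varepsilon),&q>\Delta+\psi;\\ \psi^2\big(12(\Delta-6)\big)^{-1}n\ln(n/\varepsilon),&q=\Delta+\psi,\ \Delta>6;\\ \tfrac34n^2\ln(n/\varepsilon),&q=\Delta+\psi,\ \Delta=6.\end{cases}$$ (iv) If $G$ is a graph of genus $g>0$, let $k_g=\frac72+\sqrt{12g+\frac14}$, $\kappa_g=\max\{(\lfloor k_g\rfloor-1)/2,\ 3+6(g-1)/\lceil k_g\rceil\}$ and $\psi=2\sqrt{\kappa_g(\Delta-\kappa_g)}$. If $\Delta>2\kappa_g$ and $q>\Delta+\psi$, then $$\tau_{\mathrm r}(\varepsilon)\le(q-\Delta)(q-\Delta-\psi)^{-1}n\ln(n/\varepsilon),\qquad\hat\tau_{\mathrm s}(\varepsilon)\sim(q-\Delta-\tfrac12\psi)(q-\Delta-\psi)^{-1}\ln(n/\varepsilon).$$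
   Context: Graphs are finite, simple and undirected. A graph has genus $g$ if it can be embedded in an (orientable) surface of genus $g$ (not necessarily the smallest such $g$). Heat bath Glauber dynamics for colorings: $V=[n]$, the state space is $\Omega^+=[q]^n$ (all colorings, $q>\Delta$), and $\pi$ is the uniform distribution on proper $q$-colorings of $G$. For each vertex $j$, $P^{[j]}$ recolors $j$ with a color chosen uniformly from those not currently used on the neighbors of $j$, leaving other vertices unchanged. Random update dynamics has transition matrix $\frac1n\sum_jP^{[j]}$; systematic scan has transition matrix $P^{[1]}P^{[2]}\cdots P^{[n]}$ (one transition is a complete scan). $\tau_{\mathrm r}(\varepsilon)$ and $\tau_{\mathrm s}(\varepsilon)$ are the respective mixing times: the least $t$ such that, from every initial configuration, the total variation distance between the law of the state after $t$ transitions and $\pi$ is at most $\varepsilon$ ($0<\varepsilon<1$). A bound $\tau(\varepsilon)\le X$ is understood up to rounding: the distance is at most $\varepsilon$ for every integer number of transitions $\ge X$. A statement $\hat\tau_{\mathrm s}(\varepsilon)\sim X$ means that $X$ is an asymptotic upper bound, $\limsup_{n\to\infty}\tau_{\mathrm s}(\varepsilon)/X\le1$, where $n\to\infty$ with the other parameters ($\Delta,q,t,g,\varepsilon$) fixed. *)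

theory Defs
  imports "HOL-Probability.Probability"
begin

section \<open>Finite simple graphs\<close>

definition sgraph :: "'a set \<Rightarrow> 'a set set \<Rightarrow> bool" where
  "sgraph V E \<longleftrightarrow> finite V \<and> (\<forall>e\<in>E. e \<subseteq> V \<and> card e = 2)"

definition neighbours :: "'a set set \<Rightarrow> 'a \<Rightarrow> 'a set" where
  "neighbours E v = {u. {u, v} \<in> E}"

definition degree :: "'a set set \<Rightarrow> 'a \<Rightarrow> nat" where
  "degree E v = card (neighbours E v)"

definition max_degree :: "'a set \<Rightarrow> 'a set set \<Rightarrow> nat" where
  "max_degree V E = Max (degree E ` V)"

definition regular_graph :: "'a set \<Rightarrow> 'a set set \<Rightarrow> bool" where
  "regular_graph V E \<longleftrightarrow> (\<exists>d. \<forall>v\<in>V. degree E v = d)"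

definition connected_graph :: "'a set \<Rightarrow> 'a set set \<Rightarrow> bool" where
  "connected_graph V E \<longleftrightarrow>
     V \<noteq> {} \<and> (\<forall>u\<in>V. \<forall>v\<in>V. (u, v) \<in> {(a, b). {a, b} \<in> E}\<^sup>*)"

definition graph_cycle :: "'a set set \<Rightarrow> 'a list \<Rightarrow> bool" where
  "graph_cycle E cs \<longleftrightarrow> 3 \<le> length cs \<and> distinct cs \<and>
     (\<forall>i<length cs. {cs ! i, cs ! (Suc i mod length cs)} \<in> E)"

definition graph_tree :: "'a set \<Rightarrow> 'a set set \<Rightarrow> bool" where
  "graph_tree V E \<longleftrightarrow> sgraph V E \<and> connected_graph V E \<and> (\<nexists>cs. graph_cycle E cs)"


section \<open>Tree-width\<close>

text \<open>Since \<open>connected_graph\<close> excludes the empty vertex set, the last condition also says that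
  every vertex lies in some bag.\<close>

definition tree_decomposition ::
    "'a set \<Rightarrow> 'a set set \<Rightarrow> 'i set \<Rightarrow> 'i set set \<Rightarrow> ('i \<Rightarrow> 'a set) \<Rightarrow> bool" where
  "tree_decomposition V E I F B \<longleftrightarrow> graph_tree I F \<and>
     (\<forall>i\<in>I. B i \<subseteq> V) \<and>
     (\<forall>e\<in>E. \<exists>i\<in>I. e \<subseteq> B i) \<and>
     (\<forall>v\<in>V. connected_graph {i \<in> I. v \<in> B i} {f \<in> F. f \<subseteq> {i \<in> I. v \<in> B i}})"

text \<open>The width of a decomposition is the largest bag size minus one. Decomposition trees are
  finite, so taking their nodes to be natural numbers is no restriction.\<close>

definition treewidth :: "'a set \<Rightarrow> 'a set set \<Rightarrow> nat" where
  "treewidth V E = (LEAST w. \<exists>(I :: nat set) F B.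
     tree_decomposition V E I F B \<and> (\<forall>i\<in>I. card (B i) \<le> w + 1))"


section \<open>Embeddings in the plane and in orientable surfaces\<close>

definition graph_embedding ::
    "'a set \<Rightarrow> 'a set set \<Rightarrow> 'b::topological_space set \<Rightarrow> ('a \<Rightarrow> 'b) \<Rightarrow> ('a set \<Rightarrow> real \<Rightarrow> 'b) \<Rightarrow> bool" where
  "graph_embedding V E S p \<gamma> \<longleftrightarrow> inj_on p V \<and> p ` V \<subseteq> S \<and>
     (\<forall>e\<in>E. arc (\<gamma> e) \<and> path_image (\<gamma> e) \<subseteq> S \<and>
        {pathstart (\<gamma> e), pathfinish (\<gamma> e)} = p ` e \<and>
        path_image (\<gamma> e) \<inter> p ` V = p ` e) \<and>
     (\<forall>e\<in>E. \<forall>e'\<in>E. e \<noteq> e' \<longrightarrow> path_image (\<gamma> e) \<inter> path_image (\<gamma> e') = p ` (e \<inter> e'))"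

definition embeddable_in :: "'a set \<Rightarrow> 'a set set \<Rightarrow> 'b::topological_space set \<Rightarrow> bool" where
  "embeddable_in V E S \<longleftrightarrow> (\<exists>p \<gamma>. graph_embedding V E S p \<gamma>)"

definition planar_graph :: "'a set \<Rightarrow> 'a set set \<Rightarrow> bool" where
  "planar_graph V E \<longleftrightarrow> embeddable_in V E (UNIV :: complex set)"

text \<open>A model in three-dimensional space (\<open>complex \<times> real\<close>) of the closed orientable surface of
  genus \<open>g\<close>, which is unique up to homeomorphism. The right-hand side of the equation is
  nonnegative exactly on the closed disc of radius \<open>4g + 1\<close> around the origin with the \<open>g\<close> disjoint
  open unit discs around \<open>0, 4, \<dots>, 4(g - 1)\<close> removed, and it vanishes exactly on the boundary
  circles, to first order. So the surface consists of two copies of this disc with \<open>g\<close> holes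
  (the sheets \<open>z \<ge> 0\<close> and \<open>z \<le> 0\<close>) glued along their boundaries: a sphere with \<open>g\<close> handles.\<close>

definition genus_surface :: "nat \<Rightarrow> (complex \<times> real) set" where
  "genus_surface g = {(w, z).
     z\<^sup>2 = ((4 * real g + 1)\<^sup>2 - (cmod w)\<^sup>2) * (\<Prod>i<g. (cmod (w - of_nat (4 * i)))\<^sup>2 - 1)}"

lemma genus_surface_0: "genus_surface 0 = sphere 0 1"
  by (auto simp: genus_surface_def norm_Pair)

definition has_genus :: "nat \<Rightarrow> 'a set \<Rightarrow> 'a set set \<Rightarrow> bool" where
  "has_genus g V E \<longleftrightarrow> embeddable_in V E (genus_surface g)"

definition k_genus :: "nat \<Rightarrow> real" where
  "k_genus g = 7/2 + sqrt (12 * real g + 1/4)"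

definition kappa_genus :: "nat \<Rightarrow> real" where
  "kappa_genus g = max ((of_int \<lfloor>k_genus g\<rfloor> - 1) / 2)
     (3 + 6 * (real g - 1) / of_int \<lceil>k_genus g\<rceil>)"


section \<open>Mixing of Markov chains\<close>

definition tv_dist :: "'s pmf \<Rightarrow> 's pmf \<Rightarrow> real" where
  "tv_dist \<mu> \<nu> = (SUP A. \<bar>measure_pmf.prob \<mu> A - measure_pmf.prob \<nu> A\<bar>)"

text \<open>A transition matrix is given by its rows, as a kernel \<open>K\<close>.\<close>

definition law_after :: "('s \<Rightarrow> 's pmf) \<Rightarrow> 's \<Rightarrow> nat \<Rightarrow> 's pmf" where
  "law_after K x T = ((\<lambda>\<mu>. bind_pmf \<mu> K) ^^ T) (return_pmf x)"

definition mixed_at :: "('s \<Rightarrow> 's pmf) \<Rightarrow> 's set \<Rightarrow> 's pmf \<Rightarrow> real \<Rightarrow> nat \<Rightarrow> bool" where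
  "mixed_at K S \<pi> \<epsilon> T \<longleftrightarrow> (\<forall>x\<in>S. tv_dist (law_after K x T) \<pi> \<le> \<epsilon>)"

text \<open>The value is \<open>\<infinity>\<close> if the chain never gets within \<open>\<epsilon>\<close> of \<open>\<pi>\<close>.\<close>

definition mixing_time :: "('s \<Rightarrow> 's pmf) \<Rightarrow> 's set \<Rightarrow> 's pmf \<Rightarrow> real \<Rightarrow> enat" where
  "mixing_time K S \<pi> \<epsilon> = (INF T\<in>{T. mixed_at K S \<pi> \<epsilon> T}. enat T)"

text \<open>The bound \<open>\<tau>(\<epsilon>) \<le> X\<close> for real \<open>X\<close>, up to rounding: the chain is within \<open>\<epsilon>\<close> of \<open>\<pi>\<close> after every
  integer number of transitions that is at least \<open>X\<close>.\<close>

definition mixing_time_le ::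
    "('s \<Rightarrow> 's pmf) \<Rightarrow> 's set \<Rightarrow> 's pmf \<Rightarrow> real \<Rightarrow> real \<Rightarrow> bool" where
  "mixing_time_le K S \<pi> \<epsilon> X \<longleftrightarrow> (\<forall>T::nat. X \<le> real T \<longrightarrow> mixed_at K S \<pi> \<epsilon> T)"


section \<open>Heat bath Glauber dynamics for proper colourings\<close>

definition colourings :: "nat \<Rightarrow> nat \<Rightarrow> (nat \<Rightarrow> nat) set" where
  "colourings n q = {1..n} \<rightarrow>\<^sub>E {1..q}"

definition proper_colourings :: "nat \<Rightarrow> nat set set \<Rightarrow> nat \<Rightarrow> (nat \<Rightarrow> nat) set" where
  "proper_colourings n E q = {x \<in> colourings n q. \<forall>u v. {u, v} \<in> E \<longrightarrow> x u \<noteq> x v}"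

definition uniform_colouring :: "nat \<Rightarrow> nat set set \<Rightarrow> nat \<Rightarrow> (nat \<Rightarrow> nat) pmf" where
  "uniform_colouring n E q = pmf_of_set (proper_colourings n E q)"

definition heat_bath :: "nat set set \<Rightarrow> nat \<Rightarrow> nat \<Rightarrow> (nat \<Rightarrow> nat) \<Rightarrow> (nat \<Rightarrow> nat) pmf" where
  "heat_bath E q j x = map_pmf (\<lambda>c. x(j := c)) (pmf_of_set ({1..q} - x ` neighbours E j))"

definition random_update ::
    "nat \<Rightarrow> nat set set \<Rightarrow> nat \<Rightarrow> (nat \<Rightarrow> nat) \<Rightarrow> (nat \<Rightarrow> nat) pmf" where
  "random_update n E q x = bind_pmf (pmf_of_set {1..n}) (\<lambda>j. heat_bath E q j x)"

text \<open>Distributions are row vectors, so in the product of the single-site matrices for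
  \<open>1, 2, \<dots>, n\<close> the vertex \<open>1\<close> is updated first.\<close>

definition systematic_scan ::
    "nat \<Rightarrow> nat set set \<Rightarrow> nat \<Rightarrow> (nat \<Rightarrow> nat) \<Rightarrow> (nat \<Rightarrow> nat) pmf" where
  "systematic_scan n E q x =
     foldl (\<lambda>\<mu> j. bind_pmf \<mu> (heat_bath E q j)) (return_pmf x) [1..<n + 1]"

definition scan_time :: "nat \<Rightarrow> nat set set \<Rightarrow> nat \<Rightarrow> real \<Rightarrow> enat" where
  "scan_time n E q \<epsilon> =
     mixing_time (systematic_scan n E q) (colourings n q) (uniform_colouring n E q) \<epsilon>"

definition graphs :: "nat \<Rightarrow> nat \<Rightarrow> nat set set set" where
  "graphs \<Delta> n = {E. 1 \<le> n \<and> sgraph {1..n} E \<and> max_degree {1..n} E = \<Delta>}"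

text \<open>In the next two definitions, \<open>C n\<close> is a set of (edge sets of) graphs on the vertices
  \<open>{1..n}\<close>, and \<open>X\<close> is a bound depending on the number \<open>n\<close> of vertices.\<close>

definition random_mixing_bound ::
    "(nat \<Rightarrow> nat set set set) \<Rightarrow> nat \<Rightarrow> real \<Rightarrow> (nat \<Rightarrow> real) \<Rightarrow> bool" where
  "random_mixing_bound C q \<epsilon> X \<longleftrightarrow>
     (\<forall>n. \<forall>E\<in>C n.
        mixing_time_le (random_update n E q) (colourings n q) (uniform_colouring n E q) \<epsilon> (X n))"

text \<open>The supremum over \<open>C n\<close> makes the limit superior one along all sequences of graphs from the
  class whose number of vertices tends to infinity.\<close>

definition scan_mixing_asymp_bound ::
    "(nat \<Rightarrow> nat set set set) \<Rightarrow> nat \<Rightarrow> real \<Rightarrow> (nat \<Rightarrow> real) \<Rightarrow> bool" where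
  "scan_mixing_asymp_bound C q \<epsilon> X \<longleftrightarrow>
     limsup (\<lambda>n. SUP E\<in>C n. ereal_of_enat (scan_time n E q \<epsilon>) / ereal (X n)) \<le> 1"

end

theory Submission
  imports Defs
begin

text \<open>
  Recolouring a vertex moves the oscillation of an observable to the neighbours with weight
  \<open>1/(q - \<Delta>)\<close> (Dobrushin). So if \<open>l\<close> bounds the largest eigenvalue of the adjacency matrix and
  \<open>\<mu> = l/(q - \<Delta>) < 1\<close>, then random updates contract the Euclidean norm of the oscillation vector
  by \<open>1 - (1 - \<mu>)/n\<close>. For a scan one needs a positive vector that is contracted; it is obtained
  from the resolvent of the influence matrix with its lower triangle multiplied by \<open>1/r\<close>, which
  works for every rate \<open>r > \<mu>/(2 - \<mu>)\<close>.

  If every vertex set \<open>U\<close> spans at most \<open>\<kappa> |U|\<close> edges, then \<open>l = 2 sqrt (\<kappa> (\<Delta> - \<kappa>))\<close> works. Tree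
  decompositions give the density by degeneracy. For graphs on a surface the density is Euler's
  inequality: the surface is cut into tiles so fine that the stars of the vertices and the middle
  parts of the edges meet disjoint sets of tiles, and the inequality becomes a count of components
  in the resulting combinatorial cell complex.
\<close>

section \<open>Oscillation vectors\<close>

text \<open>The distance to equilibrium is at most the sum of the oscillations, hence
  \<open>sqrt n\<close> times their Euclidean norm, and the initial vector of ones has norm
  \<open>sqrt n\<close>; the product is the \<open>n\<close> in \<open>ln (n / \<epsilon>)\<close>.
  A scan yields no symmetric matrix, so its rate cannot be read off from a norm in this way. The
  limiting rate \<mu>/(2 - \<mu>) makes the resolvent singular, and approaching it costs the
  reciprocal of the gap 1 - \<mu>. If the gap has order 1/n^k, this cost and the factor n multiply
  the logarithm by k + 1; that is the origin of the scan constants, and the remaining constant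
  factors are absorbed only for large n. At q = \<Delta> + \<psi> the gap comes from the
  second-order terms of the edge counts, t(t + 1)/2 for tree-width and 6 for planar graphs, spread
  over at most n vertices. For surfaces only an upper bound on the number of edges is wanted, so
  boundaries modulo 2 and an inequality for the Euler characteristic replace face walks,
  orientations and the Jordan curve theorem.\<close>

text \<open>Inserting one element into a set moves the mean by the distance of its value from the
  old mean, divided by the new size; exchanging one element for another changes one summand. The
  case of interest is the set of available colours of a vertex before and after one neighbour is
  recoloured, with m = q - \<Delta>.\<close>

lemma abs_average_diff_le:
  fixes g :: "'c \<Rightarrow> real"
  assumes fin: "finite A" "finite B" and m: "0 < m" "m \<le> card A" "m \<le> card B"
    and AB: "A - B \<subseteq> {a}" "B - A \<subseteq> {b}"
    and osc: "\<And>c c'. c \<in> A \<union> B \<Longrightarrow> c' \<in> A \<union> B \<Longrightarrow> \<bar>g c - g c'\<bar> \<le> \<delta>"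
  shows "\<bar>sum g A / card A - sum g B / card B\<bar> \<le> \<delta> / m"
proof -
  have ne: "A \<noteq> {}" "B \<noteq> {}" using m by auto
  have \<delta>0: "0 \<le> \<delta>" using osc[of "SOME c. c \<in> A" "SOME c. c \<in> A"] ne by (simp add: some_in_eq)
  have step: "\<bar>sum g (insert a C) / card (insert a C) - sum g C / card C\<bar> \<le> \<delta> / card (insert a C)"
    if C: "finite C" "C \<noteq> {}" "a \<notin> C"
      and osc: "\<And>c c'. c \<in> insert a C \<Longrightarrow> c' \<in> insert a C \<Longrightarrow> \<bar>g c - g c'\<bar> \<le> \<delta>" for C a
  proof -
    have k: "0 < real (card C)" using C by (simp add: card_gt_0_iff)
    have "sum g (insert a C) / card (insert a C) - sum g C / card C
        = (\<Sum>c\<in>C. g a - g c) / (card C * card (insert a C))"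
      using C k by (simp add: sum_subtractf field_simps)
    moreover have "\<bar>\<Sum>c\<in>C. g a - g c\<bar> \<le> card C * \<delta>"
      using sum_norm_bound[of C "\<lambda>c. g a - g c" \<delta>] osc by auto
    ultimately have "\<bar>sum g (insert a C) / card (insert a C) - sum g C / card C\<bar>
        \<le> (card C * \<delta>) / (card C * card (insert a C))"
      by (simp only: abs_divide) (simp add: divide_right_mono del: of_nat_mult)
    then show ?thesis using k by simp
  qed
  have mono: "\<delta> / k \<le> \<delta> / m" if "m \<le> k" for k
    using that m \<delta>0 by (intro divide_left_mono) auto
  consider "A = B" | "B \<subset> A" | "A \<subset> B" | "A - B \<noteq> {}" "B - A \<noteq> {}" by blast
  then show ?thesis
  proof cases
    case 1
    then show ?thesis using \<delta>0 by simp
  next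
    case 2
    then have A: "A = insert a B" "a \<notin> B" using AB by auto
    have "\<bar>sum g A / card A - sum g B / card B\<bar> \<le> \<delta> / card A"
      unfolding A(1) by (rule step) (use osc A fin ne in auto)
    then show ?thesis using mono[of "card A"] m by linarith
  next
    case 3
    then have A: "B = insert b A" "b \<notin> A" using AB by auto
    have "\<bar>sum g B / card B - sum g A / card A\<bar> \<le> \<delta> / card B"
      unfolding A(1) by (rule step) (use osc A fin ne in auto)
    then show ?thesis using mono[of "card B"] m by linarith
  next
    case 4
    then have ab: "a \<in> A" "a \<notin> B" "b \<in> B" "b \<notin> A" using AB by auto
    define C where "C = A \<inter> B"
    have A: "A = insert a C" "a \<notin> C" and B: "B = insert b C" "b \<notin> C"
      using ab AB unfolding C_def by auto
    have fC: "finite C" using fin C_def by auto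
    have "sum g A / card A - sum g B / card B = (g a - g b) / card A"
      unfolding A(1) B(1) using A(2) B(2) fC by (simp add: diff_divide_distrib[symmetric])
    moreover have "\<bar>g a - g b\<bar> \<le> \<delta>" using osc ab by auto
    ultimately have "\<bar>sum g A / card A - sum g B / card B\<bar> \<le> \<delta> / card A"
      by (simp add: divide_right_mono)
    then show ?thesis using mono[of "card A"] m by linarith
  qed
qed

locale colouring_graph =
  fixes n q D :: nat and E :: "nat set set"
  assumes sgraph: "sgraph {1..n} E"
    and degree_le: "v \<in> {1..n} \<Longrightarrow> degree E v \<le> D"
    and D_less_q: "D < q"
    and n_pos: "1 \<le> n"
begin

definition avail :: "(nat \<Rightarrow> nat) \<Rightarrow> nat \<Rightarrow> nat set" where
  "avail x j = {1..q} - x ` neighbours E j"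

text \<open>The heat bath matrix at \<open>j\<close> acting on observables, the dual of its action
  on laws.\<close>

definition update_mean :: "nat \<Rightarrow> ((nat \<Rightarrow> nat) \<Rightarrow> real) \<Rightarrow> (nat \<Rightarrow> nat) \<Rightarrow> real" where
  "update_mean j f x = (\<Sum>c\<in>avail x j. f (x(j := c))) / card (avail x j)"

text \<open>An upper bound for Dobrushin's interdependence matrix. The uniform bound
  \<open>D\<close> stands in place of the individual degrees to make it symmetric: it is the
  adjacency matrix divided by q - D.\<close>

definition influence :: "nat \<Rightarrow> nat \<Rightarrow> real" where
  "influence i j = (if {i, j} \<in> E then 1 / (real q - real D) else 0)"

text \<open>Dobrushin's oscillation vector. Improper colourings are included, since they occur as
  initial states and on the paths of single-site changes in \<open>osc_le_total\<close>.\<close>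

definition osc_le :: "((nat \<Rightarrow> nat) \<Rightarrow> real) \<Rightarrow> (nat \<Rightarrow> real) \<Rightarrow> bool" where
  "osc_le f d \<longleftrightarrow>
     (\<forall>x\<in>colourings n q. \<forall>i\<in>{1..n}. \<forall>c\<in>{1..q}. \<bar>f (x(i := c)) - f x\<bar> \<le> d i)"

lemma edgeD: "{u, v} \<in> E \<Longrightarrow> u \<in> {1..n} \<and> v \<in> {1..n} \<and> u \<noteq> v"
  using sgraph unfolding sgraph_def by (cases "u = v") (auto simp: card_insert_if)

lemma neighbours_subset: "neighbours E j \<subseteq> {1..n} - {j}"
  unfolding neighbours_def using edgeD by blast

lemma finite_neighbours: "finite (neighbours E j)"
  using neighbours_subset finite_subset by blast

lemma finite_avail: "finite (avail x j)"
  unfolding avail_def by simp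

lemma card_avail_ge:
  assumes "j \<in> {1..n}"
  shows "q - D \<le> card (avail x j)"
proof -
  have "card (x ` neighbours E j) \<le> D"
    using card_image_le[OF finite_neighbours, of x j] degree_le[OF assms] unfolding degree_def by simp
  then show ?thesis
    unfolding avail_def
    using diff_card_le_card_Diff[of "x ` neighbours E j" "{1..q}"] finite_neighbours by simp
qed

lemma avail_nonempty: "j \<in> {1..n} \<Longrightarrow> avail x j \<noteq> {}"
  using card_avail_ge[of j x] D_less_q by auto

lemma avail_subset: "avail x j \<subseteq> {1..q}"
  unfolding avail_def by auto

lemma avail_upd_same: "avail (x(j := c)) j = avail x j"
proof -
  have "(x(j := c)) ` neighbours E j = x ` neighbours E j"
    using neighbours_subset by (intro image_cong) auto
  then show ?thesis unfolding avail_def by simp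
qed

lemma finite_colourings: "finite (colourings n q)"
  unfolding colourings_def by (simp add: finite_PiE)

lemma colourings_upd: "x \<in> colourings n q \<Longrightarrow> i \<in> {1..n} \<Longrightarrow> c \<in> {1..q} \<Longrightarrow> x(i := c) \<in> colourings n q"
  unfolding colourings_def by (auto simp: PiE_iff extensional_def)

lemma colourings_range: "x \<in> colourings n q \<Longrightarrow> i \<in> {1..n} \<Longrightarrow> x i \<in> {1..q}"
  unfolding colourings_def by (auto simp: PiE_iff)

lemma osc_le_nonneg:
  assumes "osc_le f d" "i \<in> {1..n}"
  shows "0 \<le> d i"
proof -
  have x: "(\<lambda>i\<in>{1..n}. 1) \<in> colourings n q" (is "?x \<in> _")
    using D_less_q unfolding colourings_def by auto
  have "\<bar>f (?x(i := 1)) - f ?x\<bar> \<le> d i"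
    using assms x D_less_q unfolding osc_le_def by (metis Suc_leI atLeastAtMost_iff le_refl not_less_zero
        One_nat_def zero_less_iff_neq_zero)
  then show ?thesis by linarith
qed

lemma osc_le_total:
  assumes f: "osc_le f d" and x: "x \<in> colourings n q" and y: "y \<in> colourings n q"
  shows "\<bar>f y - f x\<bar> \<le> (\<Sum>i=1..n. d i)"
proof -
  \<comment> \<open>\<open>z k\<close> has passed from \<open>x\<close> to \<open>y\<close> at the
    first \<open>k\<close> sites, so consecutive colourings differ at one site only; they need not
    be proper even if \<open>x\<close> and \<open>y\<close> are.\<close>
  define z where "z k i = (if i \<le> k then y i else x i)" for k i :: nat
  have z: "z k \<in> colourings n q" for k
    using x y unfolding z_def colourings_def by (auto simp: PiE_iff extensional_def)
  have "\<bar>f (z k) - f x\<bar> \<le> (\<Sum>i=1..k. d i)" if "k \<le> n" for k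
    using that
  proof (induction k)
    case 0
    have "z 0 = x"
      using x y unfolding z_def colourings_def by (auto simp: fun_eq_iff PiE_iff extensional_def)
    then show ?case by simp
  next
    case (Suc k)
    have "z (Suc k) = (z k)(Suc k := y (Suc k))"
      unfolding z_def by (auto simp: fun_eq_iff)
    moreover have "y (Suc k) \<in> {1..q}" using colourings_range[OF y] Suc by auto
    ultimately have "\<bar>f (z (Suc k)) - f (z k)\<bar> \<le> d (Suc k)"
      using f z[of k] Suc unfolding osc_le_def by auto
    then show ?case using Suc by auto
  qed
  from this[of n] have "\<bar>f (z n) - f x\<bar> \<le> (\<Sum>i=1..n. d i)" by simp
  moreover have "z n = y"
    using x y unfolding z_def colourings_def by (auto simp: fun_eq_iff PiE_iff extensional_def)
  ultimately show ?thesis by simp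
qed

text \<open>The mean does not depend on the colour of \<open>j\<close> itself, as \<open>j\<close>
  is not its own neighbour. A change at another site \<open>i\<close> acts twice: on the argument of
  \<open>f\<close> for each fixed new colour of \<open>j\<close>, which costs \<open>d i\<close>,
  and on the set of available colours, which costs \<open>d j\<close> times the influence.\<close>

lemma osc_le_update_mean:
  assumes f: "osc_le f d" and j: "j \<in> {1..n}"
  shows "osc_le (update_mean j f) (\<lambda>i. if i = j then 0 else d i + influence i j * d j)"
  unfolding osc_le_def
proof (intro ballI)
  fix x i c assume x: "x \<in> colourings n q" and i: "i \<in> {1..n}" and c: "c \<in> {1..q}"
  define y where "y = x(i := c)"
  have y: "y \<in> colourings n q" using colourings_upd x i c y_def by simp
  note nn = osc_le_nonneg[OF f]
  have qD: "0 < real q - real D" using D_less_q by simp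
  show "\<bar>update_mean j f (x(i := c)) - update_mean j f x\<bar>
      \<le> (if i = j then 0 else d i + influence i j * d j)"
  proof (cases "i = j")
    case True
    have "update_mean j f (x(j := c)) = update_mean j f x"
      unfolding update_mean_def by (simp add: avail_upd_same)
    then show ?thesis using True by simp
  next
    case False
    let ?A = "avail x j" and ?B = "avail y j"
    have kB: "0 < real (card ?B)"
      using avail_nonempty[OF j, of y] finite_avail[of y j] by (simp add: card_gt_0_iff)
    have 1: "\<bar>(\<Sum>c'\<in>?B. f (y(j := c'))) / card ?B - (\<Sum>c'\<in>?B. f (x(j := c'))) / card ?B\<bar> \<le> d i"
    proof -
      have "\<bar>f (y(j := c')) - f (x(j := c'))\<bar> \<le> d i" if "c' \<in> ?B" for c'
      proof -
        have "y(j := c') = (x(j := c'))(i := c)" using False unfolding y_def by (simp add: fun_upd_twist)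
        moreover have "x(j := c') \<in> colourings n q"
          using colourings_upd[OF x j] that avail_subset by blast
        ultimately show ?thesis using f i c unfolding osc_le_def by auto
      qed
      then have "norm (\<Sum>c'\<in>?B. f (y(j := c')) - f (x(j := c'))) \<le> card ?B * d i"
        using sum_norm_bound[of ?B "\<lambda>c'. f (y(j := c')) - f (x(j := c'))" "d i"] by simp
      then show ?thesis
        using kB by (simp add: diff_divide_distrib[symmetric] sum_subtractf divide_le_eq mult.commute)
    qed
    have 2: "\<bar>(\<Sum>c'\<in>?B. f (x(j := c'))) / card ?B - (\<Sum>c'\<in>?A. f (x(j := c'))) / card ?A\<bar>
        \<le> influence i j * d j"
    proof (cases "i \<in> neighbours E j")
      case True
      have inf: "influence i j = 1 / real (q - D)"
        using True D_less_q unfolding influence_def neighbours_def by (auto simp: of_nat_diff)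
      have osc: "\<bar>f (x(j := c1)) - f (x(j := c2))\<bar> \<le> d j" if "c1 \<in> {1..q}" "c2 \<in> {1..q}" for c1 c2
      proof -
        have "x(j := c1) = (x(j := c2))(j := c1)" by simp
        then show ?thesis
          using f colourings_upd[OF x j that(2)] that j unfolding osc_le_def by metis
      qed
      have "\<bar>(\<Sum>c'\<in>?B. f (x(j := c'))) / card ?B - (\<Sum>c'\<in>?A. f (x(j := c'))) / card ?A\<bar>
          \<le> d j / real (q - D)"
      proof (rule abs_average_diff_le[where a = "x i" and b = c])
        \<comment> \<open>Recolouring \<open>i\<close> can release only its old colour and block
          only its new one.\<close>
        show "?B - ?A \<subseteq> {x i}" "?A - ?B \<subseteq> {c}"
          unfolding avail_def y_def using True by (auto split: if_splits)
      qed (use D_less_q card_avail_ge[OF j] finite_avail osc avail_subset in \<open>auto simp: subset_iff\<close>)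
      then show ?thesis unfolding inf by simp
    next
      case False
      then have "y ` neighbours E j = x ` neighbours E j"
        unfolding y_def by (intro image_cong) auto
      then have "?A = ?B" unfolding avail_def by simp
      then show ?thesis using nn[OF j] qD unfolding influence_def by simp
    qed
    show ?thesis
      using 1 2 False unfolding y_def[symmetric] update_mean_def by auto
  qed
qed

lemma osc_le_mono: "osc_le f d \<Longrightarrow> (\<And>i. i \<in> {1..n} \<Longrightarrow> d i \<le> d' i) \<Longrightarrow> osc_le f d'"
  unfolding osc_le_def by (meson order_trans)

lemma osc_le_indicator: "osc_le (indicator A) (\<lambda>_. 1)"
  unfolding osc_le_def by (auto simp: indicator_def)

end

section \<open>Kernels acting on observables, and stationarity of the uniform distribution\<close>

definition mean_op :: "('s \<Rightarrow> 's pmf) \<Rightarrow> ('s \<Rightarrow> real) \<Rightarrow> 's \<Rightarrow> real" where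
  "mean_op K f x = measure_pmf.expectation (K x) f"

lemma expectation_bind_finite:
  fixes h :: "'b \<Rightarrow> real"
  assumes "finite A" "\<And>x. x \<in> A \<Longrightarrow> finite (set_pmf (K x))" "set_pmf p \<subseteq> A"
  shows "measure_pmf.expectation (bind_pmf p K) h
       = measure_pmf.expectation p (\<lambda>x. measure_pmf.expectation (K x) h)"
  proof -
  have "measure_pmf.expectation (bind_pmf p K) h
      = (\<Sum>a\<in>A. pmf p a *\<^sub>R measure_pmf.expectation (K a) h)"
    by (rule pmf_expectation_bind[OF assms])
  also have "\<dots> = measure_pmf.expectation p (\<lambda>x. measure_pmf.expectation (K x) h)"
    using assms(1,3) by (subst integral_measure_pmf[of A]) auto
  finally show ?thesis .
qed

text \<open>Duality between laws and observables; it reduces mixing to estimates for iterated means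
  of indicator functions.\<close>

lemma law_after_expectation:
  assumes fin: "finite S" and K: "\<And>x. x \<in> S \<Longrightarrow> set_pmf (K x) \<subseteq> S" and x: "x \<in> S"
  shows "set_pmf (law_after K x T) \<subseteq> S"
    and "measure_pmf.expectation (law_after K x T) f = (mean_op K ^^ T) f x"
proof -
  have "set_pmf (law_after K x T) \<subseteq> S \<and>
      (\<forall>f. measure_pmf.expectation (law_after K x T) f = (mean_op K ^^ T) f x)"
  proof (induction T)
    case 0
    then show ?case using x by (simp add: law_after_def)
  next
    case (Suc T)
    have eq: "law_after K x (Suc T) = bind_pmf (law_after K x T) K"
      by (simp add: law_after_def)
    have "measure_pmf.expectation (law_after K x (Suc T)) f = (mean_op K ^^ Suc T) f x" for f
      unfolding eq
      using expectation_bind_finite[OF fin, of K "law_after K x T" f] Suc K finite_subset[OF _ fin]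
      by (auto simp: funpow_Suc_right mean_op_def[symmetric] simp del: funpow.simps)
    then show ?case using Suc K unfolding eq by auto
  qed
  then show "set_pmf (law_after K x T) \<subseteq> S"
    "measure_pmf.expectation (law_after K x T) f = (mean_op K ^^ T) f x" by auto
qed

context colouring_graph
begin

lemma heat_bath_avail: "heat_bath E q j x = map_pmf (\<lambda>c. x(j := c)) (pmf_of_set (avail x j))"
  by (simp only: heat_bath_def avail_def)

lemma set_one_to_n: "set [1..<n + 1] = {1..n}"
  by auto

lemma expectation_heat_bath:
  "j \<in> {1..n} \<Longrightarrow> measure_pmf.expectation (heat_bath E q j x) f = update_mean j f x"
  using avail_nonempty[of j x] finite_avail[of x j]
  unfolding heat_bath_avail update_mean_def by (simp add: integral_pmf_of_set)

lemma set_heat_bath: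
  assumes "j \<in> {1..n}" "x \<in> colourings n q"
  shows "set_pmf (heat_bath E q j x) \<subseteq> colourings n q"
  using avail_nonempty[OF assms(1), of x] finite_avail[of x j] colourings_upd[OF assms(2,1)]
    avail_subset[of x j]
  unfolding heat_bath_avail by auto

lemma finite_set_heat_bath: "j \<in> {1..n} \<Longrightarrow> finite (set_pmf (heat_bath E q j x))"
  using avail_nonempty[of j x] finite_avail[of x j]
  unfolding heat_bath_avail by simp

lemma mean_op_random_update:
  "mean_op (random_update n E q) f x = (\<Sum>j=1..n. update_mean j f x) / n"
proof -
  have "mean_op (random_update n E q) f x
      = measure_pmf.expectation (pmf_of_set {1..n}) (\<lambda>j. measure_pmf.expectation (heat_bath E q j x) f)"
    unfolding mean_op_def random_update_def
    by (rule expectation_bind_finite[of "{1..n}"]) (use n_pos finite_set_heat_bath in auto)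
  also have "\<dots> = (\<Sum>j=1..n. update_mean j f x) / n"
    using n_pos by (subst integral_pmf_of_set) (auto simp: expectation_heat_bath)
  finally show ?thesis .
qed

lemma set_random_update:
  "x \<in> colourings n q \<Longrightarrow> set_pmf (random_update n E q x) \<subseteq> colourings n q"
  using set_heat_bath n_pos unfolding random_update_def by (auto simp: subset_iff)

text \<open>Passing to the dual reverses the order: the vertex updated last averages the observable
  first, so the \<open>foldl\<close> over laws becomes a \<open>foldr\<close> over means.\<close>

lemma foldl_heat_bath:
  assumes "set js \<subseteq> {1..n}" "x \<in> colourings n q"
  shows "set_pmf (foldl (\<lambda>\<mu> j. bind_pmf \<mu> (heat_bath E q j)) (return_pmf x) js) \<subseteq> colourings n q
    \<and> (\<forall>f. measure_pmf.expectation (foldl (\<lambda>\<mu> j. bind_pmf \<mu> (heat_bath E q j)) (return_pmf x) js) f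
      = foldr update_mean js f x)"
  using assms(1)
proof (induction js rule: rev_induct)
  case Nil
  then show ?case using assms(2) by simp
next
  case (snoc j js)
  let ?\<mu> = "foldl (\<lambda>\<mu> j. bind_pmf \<mu> (heat_bath E q j)) (return_pmf x) js"
  have j: "j \<in> {1..n}" and \<mu>: "set_pmf ?\<mu> \<subseteq> colourings n q" using snoc by auto
  have "measure_pmf.expectation (bind_pmf ?\<mu> (heat_bath E q j)) f = foldr update_mean js (update_mean j f) x" for f
    using expectation_bind_finite[OF finite_colourings finite_set_heat_bath[OF j] \<mu>, where h = f] snoc
    by (simp add: expectation_heat_bath[OF j])
  then show ?case using \<mu> set_heat_bath[OF j] by auto
qed

lemma mean_op_systematic_scan:
  "x \<in> colourings n q \<Longrightarrow> mean_op (systematic_scan n E q) f x = foldr update_mean [1..<n + 1] f x"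
  using foldl_heat_bath[of "[1..<n + 1]" x] unfolding mean_op_def systematic_scan_def set_one_to_n by blast

lemma set_systematic_scan:
  "x \<in> colourings n q \<Longrightarrow> set_pmf (systematic_scan n E q x) \<subseteq> colourings n q"
  using foldl_heat_bath[of "[1..<n + 1]" x] unfolding systematic_scan_def set_one_to_n by blast

text \<open>Greedy colouring in the order 1, ..., n: at least q - D colours are available at every
  step, and the invariant concerns only the edges among the first \<open>k\<close> vertices.\<close>

lemma proper_colourings_nonempty: "proper_colourings n E q \<noteq> {}"
proof -
  have "\<exists>x\<in>colourings n q. \<forall>u v. {u, v} \<in> E \<longrightarrow> u \<le> k \<longrightarrow> v \<le> k \<longrightarrow> x u \<noteq> x v" if "k \<le> n" for k
    using that
  proof (induction k)
    case 0
    have "(\<lambda>i\<in>{1..n}. 1) \<in> colourings n q"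
      using D_less_q unfolding colourings_def by auto
    then show ?case using edgeD by force
  next
    case (Suc k)
    then obtain x where x: "x \<in> colourings n q"
      "\<And>u v. {u, v} \<in> E \<Longrightarrow> u \<le> k \<Longrightarrow> v \<le> k \<Longrightarrow> x u \<noteq> x v" by auto
    obtain c where c: "c \<in> avail x (Suc k)" using avail_nonempty[of "Suc k" x] Suc by auto
    let ?y = "x(Suc k := c)"
    have y: "?y \<in> colourings n q" using colourings_upd[OF x(1), of "Suc k" c] c avail_subset[of x "Suc k"] Suc by auto
    have ne: "x u \<noteq> c" if "{u, Suc k} \<in> E" for u
      using c that unfolding avail_def neighbours_def by auto
    have "?y u \<noteq> ?y v" if e: "{u, v} \<in> E" "u \<le> Suc k" "v \<le> Suc k" for u v
    proof -
      consider "u = Suc k" "v \<noteq> Suc k" | "v = Suc k" "u \<noteq> Suc k" | "u \<le> k" "v \<le> k"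
        using edgeD[OF e(1)] e by linarith
      then show ?thesis
      proof cases
        case 1
        then show ?thesis using ne[of v] e(1) by (metis fun_upd_other fun_upd_same insert_commute)
      next
        case 2
        then show ?thesis using ne[of u] e(1) by auto
      next
        case 3
        then show ?thesis using x(2)[OF e(1)] by auto
      qed
    qed
    then show ?case using y by blast
  qed
  from this[of n] obtain x where x: "x \<in> colourings n q"
      "\<And>u v. {u, v} \<in> E \<Longrightarrow> u \<le> n \<Longrightarrow> v \<le> n \<Longrightarrow> x u \<noteq> x v" by auto
  have "x u \<noteq> x v" if "{u, v} \<in> E" for u v
    using x(2)[OF that] edgeD[OF that] by simp
  then have "x \<in> proper_colourings n E q" using x(1) unfolding proper_colourings_def by simp
  then show ?thesis by blast
qed

lemma finite_proper_colourings: "finite (proper_colourings n E q)"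
  using finite_colourings unfolding proper_colourings_def by simp

lemma expectation_uniform:
  "measure_pmf.expectation (uniform_colouring n E q) f
     = (\<Sum>x\<in>proper_colourings n E q. f x) / card (proper_colourings n E q)"
  unfolding uniform_colouring_def
  by (rule integral_pmf_of_set[OF proper_colourings_nonempty finite_proper_colourings])

lemma proper_upd:
  assumes x: "x \<in> proper_colourings n E q" and j: "j \<in> {1..n}" and c: "c \<in> avail x j"
  shows "x(j := c) \<in> proper_colourings n E q"
proof -
  have ne: "x u \<noteq> c" if "{u, j} \<in> E" for u
    using c that unfolding avail_def neighbours_def by auto
  have "(x(j := c)) u \<noteq> (x(j := c)) v" if e: "{u, v} \<in> E" for u v
    using ne[of u] ne[of v] e x edgeD[OF e] unfolding proper_colourings_def
    by (auto simp: insert_commute)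
  then show ?thesis
    using colourings_upd[of x j c] avail_subset[of x j] x j c unfolding proper_colourings_def by auto
qed

lemma proper_avail:
  "x \<in> proper_colourings n E q \<Longrightarrow> j \<in> {1..n} \<Longrightarrow> x j \<in> avail x j"
  using colourings_range[of x j] unfolding proper_colourings_def avail_def neighbours_def
  by (smt (verit, best) Diff_iff imageE mem_Collect_eq)

text \<open>Detailed balance: exchanging the old and the new colour of \<open>j\<close> is an involution on the
  pairs of a proper colouring and an available colour.\<close>

lemma stationary_update_mean:
  assumes j: "j \<in> {1..n}"
  shows "(\<Sum>x\<in>proper_colourings n E q. update_mean j f x) = (\<Sum>x\<in>proper_colourings n E q. f x)"
proof -
  let ?P = "proper_colourings n E q"
  let ?S = "Sigma ?P (\<lambda>x. avail x j)"
  let ?h = "\<lambda>(x, c). (x(j := c), x j)"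
  have "(\<Sum>x\<in>?P. update_mean j f x) = (\<Sum>x\<in>?P. \<Sum>c\<in>avail x j. f (x(j := c)) / card (avail x j))"
    unfolding update_mean_def by (simp add: sum_divide_distrib)
  also have "\<dots> = (\<Sum>(x, c)\<in>?S. f (x(j := c)) / card (avail x j))"
    using finite_proper_colourings finite_avail by (subst sum.Sigma) auto
  also have "\<dots> = (\<Sum>(x, c)\<in>?S. f x / card (avail x j))"
    by (rule sum.reindex_bij_witness[of _ ?h ?h])
      (use proper_upd[OF _ j] proper_avail[OF _ j] in \<open>auto simp: avail_upd_same\<close>)
  also have "\<dots> = (\<Sum>x\<in>?P. \<Sum>c\<in>avail x j. f x / card (avail x j))"
    using finite_proper_colourings finite_avail by (subst sum.Sigma) auto
  also have "\<dots> = (\<Sum>x\<in>?P. f x)"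
    using avail_nonempty[OF j] finite_avail by (intro sum.cong) (auto simp: card_gt_0_iff)
  finally show ?thesis .
qed

lemma stationary_random_update:
  "(\<Sum>x\<in>proper_colourings n E q. mean_op (random_update n E q) f x) = (\<Sum>x\<in>proper_colourings n E q. f x)"
proof -
  have "(\<Sum>x\<in>proper_colourings n E q. mean_op (random_update n E q) f x)
      = (\<Sum>j=1..n. \<Sum>x\<in>proper_colourings n E q. update_mean j f x) / n"
    unfolding mean_op_random_update by (subst sum.swap) (simp add: sum_divide_distrib)
  also have "\<dots> = (\<Sum>x\<in>proper_colourings n E q. f x)"
    using n_pos by (simp add: stationary_update_mean)
  finally show ?thesis .
qed

lemma stationary_systematic_scan:
  "(\<Sum>x\<in>proper_colourings n E q. mean_op (systematic_scan n E q) f x) = (\<Sum>x\<in>proper_colourings n E q. f x)"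
proof -
  have "set js \<subseteq> {1..n} \<Longrightarrow>
      (\<Sum>x\<in>proper_colourings n E q. foldr update_mean js f x) = (\<Sum>x\<in>proper_colourings n E q. f x)" for js
    by (induction js) (auto simp: stationary_update_mean)
  moreover have "(\<Sum>x\<in>proper_colourings n E q. mean_op (systematic_scan n E q) f x)
      = (\<Sum>x\<in>proper_colourings n E q. foldr update_mean [1..<n + 1] f x)"
    by (intro sum.cong refl mean_op_systematic_scan) (simp add: proper_colourings_def)
  ultimately show ?thesis by (simp only: set_one_to_n order_refl)
qed

text \<open>By stationarity the limiting probability of \<open>A\<close> is the average over the
  proper colourings of the iterated mean of the indicator. Its difference from the value at
  \<open>x\<close> is thus an average of differences of one observable, each at most the total
  oscillation.\<close>

lemma mixed_at_if_osc_le: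
  assumes K: "\<And>x. x \<in> colourings n q \<Longrightarrow> set_pmf (K x) \<subseteq> colourings n q"
    and stat: "\<And>f. (\<Sum>x\<in>proper_colourings n E q. mean_op K f x) = (\<Sum>x\<in>proper_colourings n E q. f x)"
    and osc: "\<And>A. osc_le ((mean_op K ^^ T) (indicator A)) d"
    and d: "(\<Sum>i=1..n. d i) \<le> \<epsilon>"
  shows "mixed_at K (colourings n q) (uniform_colouring n E q) \<epsilon> T"
  unfolding mixed_at_def
proof
  fix x assume x: "x \<in> colourings n q"
  let ?P = "proper_colourings n E q"
  have c: "0 < real (card ?P)"
    using proper_colourings_nonempty finite_proper_colourings by (simp add: card_gt_0_iff)
  have "\<bar>measure_pmf.prob (law_after K x T) A - measure_pmf.prob (uniform_colouring n E q) A\<bar> \<le> \<epsilon>" for A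
  proof -
    define g where "g = (mean_op K ^^ T) (indicator A)"
    have 1: "measure_pmf.prob (law_after K x T) A = g x"
      using law_after_expectation(2)[OF finite_colourings K x, where f = "indicator A"]
      unfolding g_def by simp
    have st: "(\<Sum>x\<in>?P. (mean_op K ^^ T) f x) = (\<Sum>x\<in>?P. f x)" for f
      by (induction T) (auto simp: stat)
    have 2: "measure_pmf.prob (uniform_colouring n E q) A = (\<Sum>y\<in>?P. g y) / card ?P"
      using expectation_uniform[of "indicator A"] st unfolding g_def by simp
    have "\<bar>g x - g y\<bar> \<le> \<epsilon>" if "y \<in> ?P" for y
    proof -
      have "osc_le g d" unfolding g_def by (rule osc)
      moreover have "y \<in> colourings n q" using that unfolding proper_colourings_def by simp
      ultimately show ?thesis using osc_le_total[of g d y x] x d by linarith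
    qed
    then have "norm (\<Sum>y\<in>?P. g x - g y) \<le> card ?P * \<epsilon>"
      using sum_norm_bound[of ?P "\<lambda>y. g x - g y" \<epsilon>] by simp
    moreover have "g x - (\<Sum>y\<in>?P. g y) / card ?P = (\<Sum>y\<in>?P. g x - g y) / card ?P"
      using c by (simp add: sum_subtractf diff_divide_distrib)
    ultimately show ?thesis
      unfolding 1 2 using c by (simp add: divide_le_eq mult.commute)
  qed
  then show "tv_dist (law_after K x T) (uniform_colouring n E q) \<le> \<epsilon>"
    unfolding tv_dist_def by (intro cSUP_least) auto
qed

lemma osc_le_random_update:
  assumes f: "osc_le f d"
  shows "osc_le (mean_op (random_update n E q) f)
           (\<lambda>i. ((real n - 1) * d i + (\<Sum>j=1..n. influence i j * d j)) / n)"
  unfolding osc_le_def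
proof (intro ballI)
  fix x i c assume x: "x \<in> colourings n q" and i: "i \<in> {1..n}" and c: "c \<in> {1..q}"
  have inf0: "influence i i = 0" unfolding influence_def using edgeD[of i i] by auto
  have "\<bar>(\<Sum>j=1..n. update_mean j f (x(i := c))) - (\<Sum>j=1..n. update_mean j f x)\<bar>
      \<le> (\<Sum>j=1..n. \<bar>update_mean j f (x(i := c)) - update_mean j f x\<bar>)"
    by (simp add: sum_subtractf[symmetric] sum_abs)
  also have "\<dots> \<le> (\<Sum>j=1..n. if i = j then 0 else d i + influence i j * d j)"
    using osc_le_update_mean[OF f] x i c unfolding osc_le_def by (intro sum_mono) auto
  \<comment> \<open>An update at \<open>i\<close> erases the dependence on \<open>i\<close>. Since
    \<open>influence i i = 0\<close>, subtracting \<open>d i\<close> once produces this zero summand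
    and leaves n - 1 copies of \<open>d i\<close>.\<close>
  also have "\<dots> = (\<Sum>j=1..n. (d i + influence i j * d j) - (if i = j then d i else 0))"
    using inf0 by (intro sum.cong) auto
  also have "\<dots> = (real n - 1) * d i + (\<Sum>j=1..n. influence i j * d j)"
    using i by (simp add: sum_subtractf sum.distrib algebra_simps)
  finally show "\<bar>mean_op (random_update n E q) f (x(i := c)) - mean_op (random_update n E q) f x\<bar>
      \<le> ((real n - 1) * d i + (\<Sum>j=1..n. influence i j * d j)) / n"
    unfolding mean_op_random_update diff_divide_distrib[symmetric] abs_divide
    using n_pos by (simp add: divide_right_mono)
qed

end

section \<open>Quadratic forms of nonnegative matrices\<close>

text \<open>The form bounds the largest eigenvalue only. As the entries are nonnegative, replacing a
  vector by its absolute values shows that negative eigenvalues are no larger in modulus.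
  Polarization passes to the bilinear form, which is then tested at a multiple of the image of
  \<open>v\<close> against \<open>v\<close>.\<close>

lemma symmetric_nonneg_operator_bound:
  fixes b :: "'i \<Rightarrow> 'i \<Rightarrow> real"
  assumes I: "finite I" and b0: "\<And>i j. 0 \<le> b i j" and sym: "\<And>i j. b i j = b j i" and \<beta>: "0 \<le> \<beta>"
    and form: "\<And>x. (\<Sum>i\<in>I. \<Sum>j\<in>I. b i j * x i * x j) \<le> \<beta> * (\<Sum>i\<in>I. (x i)\<^sup>2)"
  shows "(\<Sum>i\<in>I. (\<Sum>j\<in>I. b i j * v j)\<^sup>2) \<le> \<beta>\<^sup>2 * (\<Sum>i\<in>I. (v i)\<^sup>2)"
proof -
  define Q where "Q u v = (\<Sum>i\<in>I. \<Sum>j\<in>I. b i j * u i * v j)" for u v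
  define N where "N v = (\<Sum>i\<in>I. (v i)\<^sup>2)" for v :: "'i \<Rightarrow> real"
  have Qsym: "Q u v = Q v u" for u v
    unfolding Q_def by (subst sum.swap) (intro sum.cong refl, simp add: sym mult.commute mult.left_commute)
  have Qabs: "\<bar>Q v v\<bar> \<le> \<beta> * N v" for v
  proof -
    have "\<bar>Q v v\<bar> \<le> (\<Sum>i\<in>I. \<Sum>j\<in>I. \<bar>b i j * v i * v j\<bar>)"
      unfolding Q_def by (rule order_trans[OF sum_abs]) (intro sum_mono sum_abs)
    also have "\<dots> = (\<Sum>i\<in>I. \<Sum>j\<in>I. b i j * \<bar>v i\<bar> * \<bar>v j\<bar>)"
      using b0 by (simp add: abs_mult)
    also have "\<dots> \<le> \<beta> * N v" using form[of "\<lambda>i. \<bar>v i\<bar>"] unfolding N_def by simp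
    finally show ?thesis .
  qed
  have add: "Q (\<lambda>i. u i + v i) (\<lambda>i. u i + v i) = Q u u + 2 * Q u v + Q v v" for u v
    using Qsym[of u v] unfolding Q_def by (simp add: algebra_simps sum.distrib)
  have sub: "Q (\<lambda>i. u i - v i) (\<lambda>i. u i - v i) = Q u u - 2 * Q u v + Q v v" for u v
    using Qsym[of u v] unfolding Q_def by (simp add: algebra_simps sum.distrib sum_subtractf)
  have polar: "4 * Q u v \<le> 2 * \<beta> * (N u + N v)" for u v
  proof -
    have "4 * Q u v = Q (\<lambda>i. u i + v i) (\<lambda>i. u i + v i) - Q (\<lambda>i. u i - v i) (\<lambda>i. u i - v i)"
      unfolding add sub by simp
    also have "\<dots> \<le> \<beta> * N (\<lambda>i. u i + v i) + \<beta> * N (\<lambda>i. u i - v i)"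
      using Qabs[of "\<lambda>i. u i + v i"] Qabs[of "\<lambda>i. u i - v i"] by linarith
    also have "\<dots> = 2 * \<beta> * (N u + N v)"
      unfolding N_def
      by (simp add: power2_eq_square algebra_simps sum.distrib sum_subtractf sum_distrib_left)
    finally show ?thesis .
  qed
  define w where "w i = (\<Sum>j\<in>I. b i j * v j)" for i
  have Qw: "Q (\<lambda>i. s * w i) v = s * N w" for s
    unfolding Q_def N_def w_def
    by (simp add: sum_distrib_left sum_distrib_right power2_eq_square mult_ac)
  have Nw: "N (\<lambda>i. s * w i) = s\<^sup>2 * N w" for s
    unfolding N_def by (simp add: sum_distrib_left power_mult_distrib)
  have key: "4 * (s * N w) \<le> 2 * \<beta> * (s\<^sup>2 * N w + N v)" for s
    using polar[of "\<lambda>i. s * w i" v] unfolding Qw Nw .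
  have "N w \<le> \<beta>\<^sup>2 * N v"
  proof (cases "\<beta> = 0")
    case True
    then show ?thesis using key[of 1] by simp
  next
    case False
    then have "0 < \<beta>" using \<beta> by simp
    \<comment> \<open>s = 1/\<beta> maximizes 4 s - 2 \<beta> s^2, the net coefficient of
      \<open>N w\<close> in \<open>key\<close>.\<close>
    then have "4 * (N w / \<beta>) \<le> 2 * (N w / \<beta> + \<beta> * N v)"
      using key[of "1 / \<beta>"] by (simp add: power2_eq_square field_simps)
    then have "N w / \<beta> \<le> \<beta> * N v" by simp
    then show ?thesis using \<open>0 < \<beta>\<close> by (simp add: divide_le_eq power2_eq_square mult_ac)
  qed
  then show ?thesis unfolding N_def w_def .
qed

text \<open>The solution is the limit of the monotone iteration \<open>e \<mapsto> 1 + K e\<close>.\<close>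

lemma resolvent_fixpoint:
  fixes K :: "'i \<Rightarrow> 'i \<Rightarrow> real"
  assumes I: "finite I" and K0: "\<And>i j. 0 \<le> K i j" and c: "0 < c"
    and form: "\<And>x. (\<Sum>i\<in>I. \<Sum>j\<in>I. K i j * x i * x j) \<le> (1 - c) * (\<Sum>i\<in>I. (x i)\<^sup>2)"
  obtains e where "\<And>i. i \<in> I \<Longrightarrow> e i = 1 + (\<Sum>j\<in>I. K i j * e j)" "\<And>i. i \<in> I \<Longrightarrow> 0 \<le> e i"
    "(\<Sum>i\<in>I. e i) \<le> card I / c"
proof -
  define s where "s = rec_nat (\<lambda>_. 0) (\<lambda>_ v i. 1 + (\<Sum>j\<in>I. K i j * v j))"
  have s_0: "s 0 i = 0" and s_Suc: "s (Suc k) i = 1 + (\<Sum>j\<in>I. K i j * s k j)" for k i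
    unfolding s_def by simp_all
  have s0: "0 \<le> s k i" for k i
    by (induction k arbitrary: i) (auto simp: s_0 s_Suc intro!: add_nonneg_nonneg sum_nonneg mult_nonneg_nonneg K0)
  have mono: "s k i \<le> s (Suc k) i" for k i
  proof (induction k arbitrary: i)
    case 0
    then show ?case using s0 by (simp add: s_0)
  next
    case (Suc k)
    show ?case unfolding s_Suc[of "Suc k"] s_Suc[of k i]
      using Suc K0 by (intro add_mono sum_mono mult_left_mono order_refl)
  qed
  have tot: "(\<Sum>i\<in>I. s k i) \<le> card I / c" for k
  proof -
    define S where "S = (\<Sum>i\<in>I. s k i)"
    have S0: "0 \<le> S" unfolding S_def using s0 by (intro sum_nonneg)
    \<comment> \<open>The form is tested at the iterate itself. By monotonicity \<open>s k\<close>
      minus its image under \<open>K\<close> is at most 1, so c times the square sum is at most the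
      sum, and Cauchy--Schwarz turns this into a bound independent of \<open>k\<close>.\<close>
    have "c * (\<Sum>i\<in>I. (s k i)\<^sup>2) \<le> (\<Sum>i\<in>I. (s k i)\<^sup>2) - (\<Sum>i\<in>I. \<Sum>j\<in>I. K i j * s k i * s k j)"
      using form[of "s k"] by (simp add: algebra_simps)
    also have "\<dots> = (\<Sum>i\<in>I. s k i * (s k i - (\<Sum>j\<in>I. K i j * s k j)))"
      by (simp add: power2_eq_square sum_subtractf[symmetric] algebra_simps sum_distrib_left)
    also have "\<dots> \<le> (\<Sum>i\<in>I. s k i * 1)"
      using mono[of k] s0 unfolding s_Suc by (intro sum_mono mult_left_mono) (auto simp: algebra_simps)
    finally have 1: "c * (\<Sum>i\<in>I. (s k i)\<^sup>2) \<le> S" unfolding S_def by simp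
    have "c * S\<^sup>2 \<le> c * ((\<Sum>i\<in>I. (s k i)\<^sup>2) * card I)"
      unfolding S_def using c sum_squared_le_sum_of_squares[of "s k" I]
      by (intro mult_left_mono) auto
    also have "\<dots> \<le> S * card I" using 1 by (simp add: mult_right_mono mult.assoc[symmetric])
    finally have "S * (c * S) \<le> S * card I" by (simp add: power2_eq_square mult_ac)
    then have "S = 0 \<or> c * S \<le> card I" using S0 by (auto simp: mult_le_cancel_left)
    then have "c * S \<le> card I" using c by auto
    then show ?thesis unfolding S_def[symmetric] using c by (simp add: field_simps)
  qed
  have "\<exists>l. (\<lambda>k. s k i) \<longlonglongrightarrow> l" if i: "i \<in> I" for i
  proof (rule incseq_convergent[of "\<lambda>k. s k i" "card I / c"])
    show "incseq (\<lambda>k. s k i)" using mono by (rule incseq_SucI)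
    show "\<forall>k. s k i \<le> card I / c"
      using tot order_trans[OF member_le_sum[OF i]] s0 I by metis
  qed blast
  then obtain e where e: "\<And>i. i \<in> I \<Longrightarrow> (\<lambda>k. s k i) \<longlonglongrightarrow> e i" by metis
  show ?thesis
  proof (rule that[of e])
    fix i assume i: "i \<in> I"
    have "(\<lambda>k. s (Suc k) i) \<longlonglongrightarrow> 1 + (\<Sum>j\<in>I. K i j * e j)"
      unfolding s_Suc by (intro tendsto_intros e)
    then show "e i = 1 + (\<Sum>j\<in>I. K i j * e j)"
      using LIMSEQ_Suc[OF e[OF i]] LIMSEQ_unique by blast
    show "0 \<le> e i" using e[OF i] s0 by (intro LIMSEQ_le_const) auto
  next
    have "(\<lambda>k. \<Sum>i\<in>I. s k i) \<longlonglongrightarrow> (\<Sum>i\<in>I. e i)" by (intro tendsto_intros e)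
    then show "(\<Sum>i\<in>I. e i) \<le> card I / c" using tot by (intro LIMSEQ_le_const2) auto
  qed
qed

section \<open>Contraction of oscillation vectors by random updates and by scans\<close>

context colouring_graph
begin

lemma influence_nonneg: "0 \<le> influence i j"
  unfolding influence_def using D_less_q by simp

lemma influence_sym: "influence i j = influence j i"
  unfolding influence_def by (simp add: insert_commute)

text \<open>At the unit vector of site 1 the square sum is 1 and the form is nonnegative.\<close>

lemma influence_form_nonneg:
  assumes "\<And>x. (\<Sum>i=1..n. \<Sum>j=1..n. influence i j * x i * x j) \<le> \<mu> * (\<Sum>i=1..n. (x i)\<^sup>2)"
  shows "0 \<le> \<mu>"
proof -
  let ?x = "\<lambda>i::nat. if i = 1 then 1 else 0 :: real"
  have "0 \<le> (\<Sum>i=1..n. \<Sum>j=1..n. influence i j * ?x i * ?x j)"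
    using influence_nonneg by (intro sum_nonneg) auto
  also have "\<dots> \<le> \<mu> * (\<Sum>i=1..n. (?x i)\<^sup>2)" by (rule assms)
  also have "(\<Sum>i=1..n. (?x i)\<^sup>2) = (\<Sum>i=1..n. ?x i)" by (intro sum.cong) auto
  also have "\<dots> = 1" using n_pos by simp
  finally show ?thesis by simp
qed

text \<open>Oscillations are multiplied by ((n - 1) I + R)/n with R the influence matrix; its norm
  is at most \<beta> = 1 - (1 - \<mu>)/n. The norm of the vector of ones and the passage from the
  norm to the sum each cost sqrt n, which gives n \<beta>^T.\<close>

lemma mixed_at_random_update:
  assumes form: "\<And>x. (\<Sum>i=1..n. \<Sum>j=1..n. influence i j * x i * x j) \<le> \<mu> * (\<Sum>i=1..n. (x i)\<^sup>2)"
    and \<mu>: "\<mu> < 1" and \<epsilon>: "0 < \<epsilon>" and T: "real n * ln (real n / \<epsilon>) / (1 - \<mu>) \<le> real T"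
  shows "mixed_at (random_update n E q) (colourings n q) (uniform_colouring n E q) \<epsilon> T"
proof -
  define \<beta> where "\<beta> = (real n - 1 + \<mu>) / n"
  define b where "b i j = ((if i = j then real n - 1 else 0) + influence i j) / n" for i j
  define B where "B d i = (\<Sum>j=1..n. b i j * d j)" for d :: "nat \<Rightarrow> real" and i
  have \<mu>0: "0 \<le> \<mu>" by (rule influence_form_nonneg[OF form])
  have n: "0 < real n" "0 \<le> real n - 1" using n_pos by auto
  have \<beta>0: "0 \<le> \<beta>" unfolding \<beta>_def using n \<mu>0 by simp
  have B_eq: "B d i = ((real n - 1) * d i + (\<Sum>j=1..n. influence i j * d j)) / n" if "i \<in> {1..n}" for d i
  proof -
    have "B d i = (\<Sum>j=1..n. ((if i = j then (real n - 1) * d j else 0) + influence i j * d j) / n)"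
      unfolding B_def b_def by (intro sum.cong) (auto simp: field_simps)
    then show ?thesis using that by (simp add: sum_divide_distrib[symmetric] sum.distrib)
  qed
  have form_b: "(\<Sum>i=1..n. \<Sum>j=1..n. b i j * x i * x j) \<le> \<beta> * (\<Sum>i=1..n. (x i)\<^sup>2)" for x
  proof -
    have "(\<Sum>i=1..n. \<Sum>j=1..n. b i j * x i * x j) = (\<Sum>i=1..n. x i * B x i)"
      unfolding B_def by (simp add: sum_distrib_left mult_ac)
    also have "\<dots> = (\<Sum>i=1..n. ((real n - 1) * (x i)\<^sup>2 + (\<Sum>j=1..n. influence i j * x i * x j)) / n)"
      by (intro sum.cong) (auto simp: B_eq power2_eq_square sum_distrib_left algebra_simps)
    also have "\<dots> = ((real n - 1) * (\<Sum>i=1..n. (x i)\<^sup>2) + (\<Sum>i=1..n. \<Sum>j=1..n. influence i j * x i * x j)) / n"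
      by (simp add: sum_divide_distrib[symmetric] sum.distrib sum_distrib_left)
    also have "\<dots> \<le> ((real n - 1) * (\<Sum>i=1..n. (x i)\<^sup>2) + \<mu> * (\<Sum>i=1..n. (x i)\<^sup>2)) / n"
      using form[of x] by (intro divide_right_mono add_left_mono) auto
    also have "\<dots> = \<beta> * (\<Sum>i=1..n. (x i)\<^sup>2)" unfolding \<beta>_def by (simp add: field_simps)
    finally show ?thesis .
  qed
  have contr: "(\<Sum>i=1..n. (B d i)\<^sup>2) \<le> \<beta>\<^sup>2 * (\<Sum>i=1..n. (d i)\<^sup>2)" for d
    unfolding B_def
    by (rule symmetric_nonneg_operator_bound[OF _ _ _ \<beta>0 form_b])
      (use n influence_nonneg influence_sym in \<open>auto simp: b_def\<close>)
  have l2: "(\<Sum>i=1..n. ((B ^^ T) (\<lambda>_. 1) i)\<^sup>2) \<le> \<beta> ^ (2 * T) * n" for T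
  proof (induction T)
    case (Suc T)
    have "(\<Sum>i=1..n. ((B ^^ Suc T) (\<lambda>_. 1) i)\<^sup>2) \<le> \<beta>\<^sup>2 * (\<Sum>i=1..n. ((B ^^ T) (\<lambda>_. 1) i)\<^sup>2)"
      using contr by simp
    also have "\<dots> \<le> \<beta>\<^sup>2 * (\<beta> ^ (2 * T) * n)" using Suc by (intro mult_left_mono) auto
    finally show ?case by (simp add: power2_eq_square mult_ac)
  qed simp
  have sum_le: "(\<Sum>i=1..n. (B ^^ T) (\<lambda>_. 1) i) \<le> n * \<beta> ^ T"
  proof (rule power2_le_imp_le)
    have "(\<Sum>i=1..n. (B ^^ T) (\<lambda>_. 1) i)\<^sup>2 \<le> (\<Sum>i=1..n. ((B ^^ T) (\<lambda>_. 1) i)\<^sup>2) * card {1..n}"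
      by (rule sum_squared_le_sum_of_squares)
    also have "\<dots> \<le> (\<beta> ^ (2 * T) * n) * n" using l2 by (simp add: mult_right_mono)
    finally show "(\<Sum>i=1..n. (B ^^ T) (\<lambda>_. 1) i)\<^sup>2 \<le> (n * \<beta> ^ T)\<^sup>2"
      by (simp add: power2_eq_square power_mult mult_ac power_mult_distrib)
  qed (use \<beta>0 in simp)
  have "\<beta> = 1 - (1 - \<mu>) / n" unfolding \<beta>_def using n by (simp add: field_simps)
  then have "\<beta> \<le> exp (- (1 - \<mu>) / n)" using exp_ge_add_one_self[of "- (1 - \<mu>) / n"] by argo
  then have "\<beta> ^ T \<le> exp (- (1 - \<mu>) / n) ^ T" using \<beta>0 by (rule power_mono)
  also have "\<dots> = exp (- ((1 - \<mu>) / n * T))" unfolding exp_of_nat_mult[symmetric] minus_divide_left[symmetric] by (simp add: mult.commute)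
  also have "\<dots> \<le> exp (- ln (n / \<epsilon>))"
    using T n \<mu> by (simp add: divide_le_eq field_simps)
  also have "\<dots> = \<epsilon> / n" using n \<epsilon> by (simp add: exp_minus)
  finally have \<epsilon>': "n * \<beta> ^ T \<le> \<epsilon>" using n by (simp add: field_simps)
  have "osc_le ((mean_op (random_update n E q) ^^ T) (indicator A)) ((B ^^ T) (\<lambda>_. 1))" for A T
  proof (induction T)
    case 0
    then show ?case using osc_le_indicator by simp
  next
    case (Suc T)
    show ?case
      using osc_le_mono[OF osc_le_random_update[OF Suc]] by (simp add: B_eq)
  qed
  then show ?thesis
    using set_random_update stationary_random_update order_trans[OF sum_le \<epsilon>']
    by (intro mixed_at_if_osc_le) auto
qed

text \<open>\<open>e i\<close> bounds the oscillation at site \<open>i\<close> at the moment when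
  \<open>i\<close> is averaged out: the original \<open>w i\<close> plus what the sites after
  \<open>i\<close>, averaged earlier, have passed on. Averaging resets the site to 0, and from then
  on it collects only from the sites before it.\<close>

lemma osc_le_scan:
  assumes f: "osc_le f w"
    and e: "\<And>i. i \<in> {1..n} \<Longrightarrow> w i + (\<Sum>j\<in>{i<..n}. influence i j * e j) \<le> e i"
  shows "osc_le (foldr update_mean [1..<n + 1] f) (\<lambda>i. \<Sum>j\<in>{1..<i}. influence i j * e j)"
proof -
  \<comment> \<open>The oscillations once the sites k + 1, ..., n have been averaged: an untouched
    site has received from all of them, a site i > k only from k + 1, ..., i - 1, which were
    averaged after it.\<close>
  let ?d = "\<lambda>k i. if i \<le> k then w i + (\<Sum>j\<in>{k<..n}. influence i j * e j)
                 else (\<Sum>j\<in>{k<..<i}. influence i j * e j)"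
  have "osc_le (foldr update_mean [Suc k..<n + 1] f) (?d k)" if "k \<le> n" for k
    using that
  proof (induction rule: inc_induct)
    case base
    then show ?case using osc_le_mono[OF f] by auto
  next
    case (step k)
    have inf0: "influence (Suc k) (Suc k) = 0"
      unfolding influence_def using edgeD[of "Suc k" "Suc k"] by auto
    have split1: "(\<Sum>j\<in>{k<..n}. influence i j * e j)
        = influence i (Suc k) * e (Suc k) + (\<Sum>j\<in>{Suc k<..n}. influence i j * e j)" for i
    proof -
      have "{k<..n} = insert (Suc k) {Suc k<..n}" using step by auto
      then show ?thesis by simp
    qed
    have split2: "(\<Sum>j\<in>{k<..<i}. influence i j * e j)
        = influence i (Suc k) * e (Suc k) + (\<Sum>j\<in>{Suc k<..<i}. influence i j * e j)" if "Suc k < i" for i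
    proof -
      have "{k<..<i} = insert (Suc k) {Suc k<..<i}" using that by auto
      then show ?thesis by simp
    qed
    have ek: "?d (Suc k) (Suc k) \<le> e (Suc k)" using e[of "Suc k"] step by simp
    have eq: "foldr update_mean [Suc k..<n + 1] f = update_mean (Suc k) (foldr update_mean [Suc (Suc k)..<n + 1] f)"
      using step by (simp add: upt_conv_Cons del: upt_Suc)
    have "Suc k \<in> {1..n}" using step by auto
    note upd = osc_le_update_mean[OF step.IH this]
    show ?case
      unfolding eq
    proof (rule osc_le_mono[OF upd])
      fix i assume i: "i \<in> {1..n}"
      have m: "influence i (Suc k) * ?d (Suc k) (Suc k) \<le> influence i (Suc k) * e (Suc k)"
        by (rule mult_left_mono[OF ek influence_nonneg])
      consider "i \<le> k" | "i = Suc k" | "Suc k < i" by linarith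
      then show "(if i = Suc k then 0 else ?d (Suc k) i + influence i (Suc k) * ?d (Suc k) (Suc k)) \<le> ?d k i"
      proof cases
        case 1
        then show ?thesis using m split1[of i] by simp
      next
        case 2
        have "{k<..<Suc k} = {}" by auto
        then show ?thesis using 2 by simp
      next
        case 3
        then show ?thesis using m split2[of i] by simp
      qed
    qed
  qed
  from this[of 0] have "osc_le (foldr update_mean [1..<n + 1] f) (?d 0)" by simp
  then show ?thesis
    by (rule osc_le_mono) (auto simp: atLeastSucLessThan_greaterThanLessThan[symmetric])
qed

text \<open>With U and L the strict upper and lower triangles of the influence matrix, the resolvent
  gives e = 1 + U e + L e / r. For w = e - U e this says L e = r (w - 1), and by
  \<open>osc_le_scan\<close> one scan carries w to L e, which is at most r w. As w is at least 1, it
  dominates the oscillations of an indicator.\<close>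

lemma mixed_at_systematic_scan:
  assumes form: "\<And>x. (\<Sum>i=1..n. \<Sum>j=1..n. influence i j * x i * x j) \<le> \<mu> * (\<Sum>i=1..n. (x i)\<^sup>2)"
    and r: "0 < r" and c: "0 < 1 - (1 + 1 / r) * \<mu> / 2"
    and \<epsilon>: "r ^ T * (n / (1 - (1 + 1 / r) * \<mu> / 2)) \<le> \<epsilon>"
  shows "mixed_at (systematic_scan n E q) (colourings n q) (uniform_colouring n E q) \<epsilon> T"
proof -
  define K where "K i j = (if i < j then influence i j else influence i j / r)" for i j :: nat
  have inf0: "influence i i = 0" for i unfolding influence_def using edgeD[of i i] by auto
  have formK: "(\<Sum>i=1..n. \<Sum>j=1..n. K i j * x i * x j) \<le> (1 - (1 - (1 + 1 / r) * \<mu> / 2)) * (\<Sum>i=1..n. (x i)\<^sup>2)" for x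
  proof -
    \<comment> \<open>Symmetrization: of the entries (i, j) and (j, i) one carries the weight 1 and
      the other 1/r, so twice the form of \<open>K\<close> is 1 + 1/r times the influence
      form.\<close>
    have "2 * (\<Sum>i=1..n. \<Sum>j=1..n. K i j * x i * x j)
        = (\<Sum>i=1..n. \<Sum>j=1..n. K i j * x i * x j) + (\<Sum>i=1..n. \<Sum>j=1..n. K j i * x j * x i)"
      by (subst (3) sum.swap) simp
    also have "\<dots> = (\<Sum>i=1..n. \<Sum>j=1..n. (1 + 1 / r) * (influence i j * x i * x j))"
      unfolding sum.distrib[symmetric]
    proof (intro sum.cong refl)
      fix i j
      show "K i j * x i * x j + K j i * x j * x i = (1 + 1 / r) * (influence i j * x i * x j)"
        using influence_sym[of i j] inf0[of i] unfolding K_def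
        by (cases i j rule: linorder_cases) (auto simp: algebra_simps)
    qed
    also have "\<dots> = (1 + 1 / r) * (\<Sum>i=1..n. \<Sum>j=1..n. influence i j * x i * x j)"
      by (simp add: sum_distrib_left)
    also have "\<dots> \<le> (1 + 1 / r) * (\<mu> * (\<Sum>i=1..n. (x i)\<^sup>2))"
      using r by (intro mult_left_mono form) auto
    finally show ?thesis by (simp add: algebra_simps)
  qed
  have K0: "0 \<le> K i j" for i j unfolding K_def using influence_nonneg r by simp
  obtain e where e: "\<And>i. i \<in> {1..n} \<Longrightarrow> e i = 1 + (\<Sum>j=1..n. K i j * e j)"
    and e0: "\<And>i. i \<in> {1..n} \<Longrightarrow> 0 \<le> e i"
    and esum: "(\<Sum>i=1..n. e i) \<le> card {1..n} / (1 - (1 + 1 / r) * \<mu> / 2)"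
    using resolvent_fixpoint[OF _ K0 c formK] by (metis finite_atLeastAtMost)
  define w where "w i = e i - (\<Sum>j\<in>{i<..n}. influence i j * e j)" for i
  have lower: "(\<Sum>j\<in>{1..<i}. influence i j * e j) = r * (w i - 1)" if i: "i \<in> {1..n}" for i
  proof -
    have "{1..n} = {1..<i} \<union> ({i} \<union> {i<..n})" using i by auto
    moreover have "{1..<i} \<inter> ({i} \<union> {i<..n}) = {}" "{i} \<inter> {i<..n} = {}" by auto
    ultimately have "(\<Sum>j=1..n. K i j * e j)
        = (\<Sum>j\<in>{1..<i}. K i j * e j) + (K i i * e i + (\<Sum>j\<in>{i<..n}. K i j * e j))"
      by (simp add: sum.union_disjoint)
    also have "(\<Sum>j\<in>{1..<i}. K i j * e j) = (\<Sum>j\<in>{1..<i}. influence i j * e j) / r"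
      unfolding sum_divide_distrib by (intro sum.cong) (auto simp: K_def)
    also have "K i i * e i = 0" by (simp add: K_def inf0)
    also have "(\<Sum>j\<in>{i<..n}. K i j * e j) = (\<Sum>j\<in>{i<..n}. influence i j * e j)"
      by (intro sum.cong) (auto simp: K_def)
    finally show ?thesis using e[OF i] r unfolding w_def by (simp add: field_simps)
  qed
  have w1: "1 \<le> w i" if i: "i \<in> {1..n}" for i
  proof -
    have "0 \<le> (\<Sum>j\<in>{1..<i}. influence i j * e j)"
      using i e0 influence_nonneg by (intro sum_nonneg mult_nonneg_nonneg) auto
    then show ?thesis unfolding lower[OF i] using r by (simp add: zero_le_mult_iff)
  qed
  have osc: "osc_le ((mean_op (systematic_scan n E q) ^^ T) (indicator A)) (\<lambda>i. r ^ T * w i)" for A T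
  proof (induction T)
    case 0
    then show ?case using osc_le_mono[OF osc_le_indicator] w1 by simp
  next
    case (Suc T)
    let ?f = "(mean_op (systematic_scan n E q) ^^ T) (indicator A)"
    have "osc_le (foldr update_mean [1..<n + 1] ?f) (\<lambda>i. \<Sum>j\<in>{1..<i}. influence i j * (r ^ T * e j))"
    proof (rule osc_le_scan[OF Suc])
      fix i
      have "(\<Sum>j\<in>{i<..n}. influence i j * (r ^ T * e j)) = r ^ T * (\<Sum>j\<in>{i<..n}. influence i j * e j)"
        by (simp add: sum_distrib_left mult_ac)
      then show "r ^ T * w i + (\<Sum>j\<in>{i<..n}. influence i j * (r ^ T * e j)) \<le> r ^ T * e i"
        unfolding w_def by (simp add: algebra_simps)
    qed
    then have "osc_le (foldr update_mean [1..<n + 1] ?f) (\<lambda>i. r ^ Suc T * w i)"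
    proof (rule osc_le_mono)
      fix i assume i: "i \<in> {1..n}"
      have "(\<Sum>j\<in>{1..<i}. influence i j * (r ^ T * e j)) = r ^ T * (r * (w i - 1))"
        unfolding lower[OF i, symmetric] by (simp add: sum_distrib_left mult_ac)
      also have "\<dots> \<le> r ^ Suc T * w i" using r by (simp add: algebra_simps)
      finally show "(\<Sum>j\<in>{1..<i}. influence i j * (r ^ T * e j)) \<le> r ^ Suc T * w i" .
    qed
    then show ?case
      unfolding osc_le_def using mean_op_systematic_scan colourings_upd by simp
  qed
  have "(\<Sum>i=1..n. r ^ T * w i) \<le> (\<Sum>i=1..n. r ^ T * e i)"
  proof (intro sum_mono mult_left_mono)
    fix i assume "i \<in> {1..n}"
    have "0 \<le> (\<Sum>j\<in>{i<..n}. influence i j * e j)"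
      using e0 influence_nonneg by (intro sum_nonneg mult_nonneg_nonneg) auto
    then show "w i \<le> e i" unfolding w_def by simp
  qed (use r in simp)
  also have "\<dots> = r ^ T * (\<Sum>i=1..n. e i)" by (simp add: sum_distrib_left)
  also have "\<dots> \<le> r ^ T * (n / (1 - (1 + 1 / r) * \<mu> / 2))"
    using r esum by (intro mult_left_mono) auto
  also note \<epsilon>
  finally have "(\<Sum>i=1..n. r ^ T * w i) \<le> \<epsilon>" .
  then show ?thesis
    using set_systematic_scan stationary_systematic_scan osc
    by (intro mixed_at_if_osc_le) auto
qed

end

section \<open>Mixing times from spectral bounds\<close>

definition adjacency_form :: "nat \<Rightarrow> nat set set \<Rightarrow> (nat \<Rightarrow> real) \<Rightarrow> real" where
  "adjacency_form n E x = (\<Sum>i=1..n. \<Sum>j=1..n. if {i, j} \<in> E then x i * x j else 0)"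

text \<open>In terms of Rayleigh quotients: no eigenvalue of the adjacency matrix exceeds
  \<open>l\<close>.\<close>

definition spectral_bound :: "nat \<Rightarrow> nat set set \<Rightarrow> real \<Rightarrow> bool" where
  "spectral_bound n E l \<longleftrightarrow> (\<forall>x. adjacency_form n E x \<le> l * (\<Sum>i=1..n. (x i)\<^sup>2))"

lemma spectral_bound_mono:
  assumes "spectral_bound n E l" "l \<le> l'"
  shows "spectral_bound n E l'"
  unfolding spectral_bound_def
proof
  fix x :: "nat \<Rightarrow> real"
  have "adjacency_form n E x \<le> l * (\<Sum>i=1..n. (x i)\<^sup>2)" using assms(1) unfolding spectral_bound_def by simp
  also have "\<dots> \<le> l' * (\<Sum>i=1..n. (x i)\<^sup>2)"
    using assms(2) by (intro mult_right_mono sum_nonneg) auto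
  finally show "adjacency_form n E x \<le> l' * (\<Sum>i=1..n. (x i)\<^sup>2)" .
qed

lemma graphs_degree_le:
  assumes "E \<in> graphs \<Delta> n" "v \<in> {1..n}"
  shows "degree E v \<le> \<Delta>"
proof -
  have "degree E v \<le> max_degree {1..n} E"
    unfolding max_degree_def using assms(2) by (intro Max_ge) auto
  then show ?thesis using assms(1) unfolding graphs_def by simp
qed

lemma graphs_colouring_graph: "E \<in> graphs \<Delta> n \<Longrightarrow> \<Delta> < q \<Longrightarrow> colouring_graph n q \<Delta> E"
  using graphs_degree_le unfolding graphs_def colouring_graph_def by auto

lemma influence_form:
  assumes E: "E \<in> graphs \<Delta> n" and q: "\<Delta> < q"
    and sb: "spectral_bound n E ((real q - real \<Delta>) * \<mu>)"
  shows "(\<Sum>i=1..n. \<Sum>j=1..n. colouring_graph.influence q \<Delta> E i j * x i * x j) \<le> \<mu> * (\<Sum>i=1..n. (x i)\<^sup>2)"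
proof -
  interpret colouring_graph n q \<Delta> E by (rule graphs_colouring_graph[OF E q])
  have qD: "0 < real q - real \<Delta>" using q by simp
  have "(\<Sum>i=1..n. \<Sum>j=1..n. influence i j * x i * x j) = adjacency_form n E x / (real q - real \<Delta>)"
    unfolding adjacency_form_def sum_divide_distrib influence_def
    by (intro sum.cong refl) auto
  also have "\<dots> \<le> ((real q - real \<Delta>) * \<mu> * (\<Sum>i=1..n. (x i)\<^sup>2)) / (real q - real \<Delta>)"
    using sb qD unfolding spectral_bound_def by (intro divide_right_mono) auto
  also have "\<dots> = \<mu> * (\<Sum>i=1..n. (x i)\<^sup>2)" using qD by simp
  finally show ?thesis .
qed

text \<open>The rate \<mu> may vary with n, to cover the critical values of q, where the gap shrinks
  as n grows.\<close>

lemma random_mixing_boundI: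
  assumes C: "\<And>n E. E \<in> C n \<Longrightarrow> E \<in> graphs \<Delta> n" and q: "\<Delta> < q" and \<epsilon>: "0 < \<epsilon>"
    and sb: "\<And>n E. E \<in> C n \<Longrightarrow> spectral_bound n E ((real q - real \<Delta>) * \<mu> n)"
    and \<mu>: "\<And>n E. E \<in> C n \<Longrightarrow> \<mu> n < 1"
    and X: "\<And>n E. E \<in> C n \<Longrightarrow> real n * ln (real n / \<epsilon>) / (1 - \<mu> n) \<le> X n"
  shows "random_mixing_bound C q \<epsilon> X"
  unfolding random_mixing_bound_def mixing_time_le_def
proof (intro allI ballI impI)
  fix n E T assume E: "E \<in> C n" and T: "X n \<le> real T"
  interpret colouring_graph n q \<Delta> E by (rule graphs_colouring_graph[OF C[OF E] q])
  show "mixed_at (random_update n E q) (colourings n q) (uniform_colouring n E q) \<epsilon> T"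
    using mixed_at_random_update[OF influence_form[OF C[OF E] q sb[OF E]] \<mu>[OF E] \<epsilon>, of T] X[OF E] T
    by linarith
qed

lemma filterlim_ln_over: "0 < \<epsilon> \<Longrightarrow> filterlim (\<lambda>n::nat. ln (real n / \<epsilon>)) at_top sequentially"
  by (intro filterlim_compose[OF ln_at_top] filterlim_at_top_mult_tendsto_pos[OF tendsto_const, of "1 / \<epsilon>", simplified] filterlim_real_sequentially) auto

text \<open>The rate r = 1 - (1 - \<eta>)\<gamma> lies slightly above the singular value 1 -
  \<gamma> = \<mu>/(2 - \<mu>). The resolvent constant is then \<eta>(1 - \<mu>)/r, and the
  prefactor is at most n^(k + 1) divided by \<eta>c. The factor k + 1 in the lower bound for
  \<open>T\<close> compensates this power, and the surplus \<delta> brings the product below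
  \<epsilon>.\<close>

lemma mixed_at_scan_if_exponent:
  assumes E: "E \<in> graphs \<Delta> n" and q: "\<Delta> < q" and \<epsilon>: "0 < \<epsilon>" "\<epsilon> < 1"
    and sb: "spectral_bound n E ((real q - real \<Delta>) * \<mu>)"
    and \<mu>: "0 < c" "c / real n ^ k \<le> 1 - \<mu>"
    and \<eta>: "0 < \<eta>" "\<eta> < 1" and \<delta>: "0 \<le> \<delta>"
    and T: "(1 + \<delta>) * (real k + 1) * ln (real n / \<epsilon>) \<le> (1 - \<eta>) * ((1 - \<mu>) / (1 - \<mu> / 2)) * T"
    and small: "exp (- (\<delta> * (real k + 1) * ln (real n / \<epsilon>))) / (\<eta> * c) \<le> \<epsilon>"
  shows "mixed_at (systematic_scan n E q) (colourings n q) (uniform_colouring n E q) \<epsilon> T"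
proof -
  interpret colouring_graph n q \<Delta> E by (rule graphs_colouring_graph[OF E q])
  define \<gamma> where "\<gamma> = (1 - \<mu>) / (1 - \<mu> / 2)"
  define r where "r = 1 - (1 - \<eta>) * \<gamma>"
  define L where "L = ln (real n / \<epsilon>)"
  note form = influence_form[OF E q sb]
  have n: "0 < real n" using n_pos by simp
  have \<mu>0: "0 \<le> \<mu>" by (rule influence_form_nonneg[OF form])
  have \<mu>1: "0 < 1 - \<mu>" using \<mu> n by (smt (verit, best) divide_pos_pos zero_less_power)
  have \<mu>2: "0 < 1 - \<mu> / 2" using \<mu>1 by simp
  have \<gamma>: "0 < \<gamma>" "\<gamma> \<le> 1" "(1 - \<mu> / 2) * \<gamma> = 1 - \<mu>"
    unfolding \<gamma>_def using \<mu>0 \<mu>1 \<mu>2 by (auto simp: divide_le_eq)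
  have "r = (1 - \<gamma>) + \<eta> * \<gamma>" unfolding r_def by (simp add: algebra_simps)
  then have r0: "0 < r" using \<gamma> \<eta> by (simp add: add_nonneg_pos)
  have r1: "r \<le> 1" unfolding r_def using \<eta> \<gamma> by simp
  have "r * (1 - (1 + 1 / r) * \<mu> / 2) = r * (1 - \<mu> / 2) - \<mu> / 2"
    using r0 by (simp add: field_simps)
  also have "\<dots> = (1 - \<mu> / 2) - (1 - \<eta>) * ((1 - \<mu> / 2) * \<gamma>) - \<mu> / 2"
    unfolding r_def by (simp add: algebra_simps add_divide_distrib diff_divide_distrib)
  also have "\<dots> = \<eta> * (1 - \<mu>)" unfolding \<gamma>(3) by (simp add: algebra_simps)
  finally have rc: "1 - (1 + 1 / r) * \<mu> / 2 = \<eta> * (1 - \<mu>) / r" using r0 by (simp add: field_simps)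
  have c0: "0 < \<eta> * (1 - \<mu>) / r" using \<eta> \<mu>1 r0 by simp
  have L: "exp L = n / \<epsilon>" unfolding L_def using n \<epsilon> by simp
  have "n / (\<eta> * (1 - \<mu>) / r) \<le> n / (\<eta> * (c / real n ^ k))"
  proof -
    have "n / (\<eta> * (1 - \<mu>) / r) = n * r / (\<eta> * (1 - \<mu>))" using r0 by simp
    also have "\<dots> \<le> n * 1 / (\<eta> * (1 - \<mu>))"
      using r1 n \<eta> \<mu>1 by (intro divide_right_mono mult_left_mono) auto
    also have "\<dots> \<le> n * 1 / (\<eta> * (c / real n ^ k))"
      using \<mu> \<eta> n \<mu>1 by (intro divide_left_mono mult_left_mono) auto
    finally show ?thesis by simp
  qed
  also have "\<dots> = real n ^ (k + 1) / (\<eta> * c)" using \<eta> \<mu> n by (simp add: field_simps)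
  \<comment> \<open>n is replaced by the larger n/\<epsilon>, so that the prefactor and
    \<open>r ^ T\<close> are powers of the same exponential.\<close>
  also have "\<dots> \<le> exp L ^ (k + 1) / (\<eta> * c)"
    unfolding L using \<epsilon> n \<eta> \<mu> by (intro divide_right_mono power_mono) (auto simp: le_divide_eq)
  also have "exp L ^ (k + 1) = exp ((real k + 1) * L)"
    unfolding exp_of_nat_mult[symmetric] by simp
  finally have nc: "n / (\<eta> * (1 - \<mu>) / r) \<le> exp ((real k + 1) * L) / (\<eta> * c)" .
  have "r \<le> exp (- ((1 - \<eta>) * \<gamma>))"
    using exp_ge_add_one_self[of "- ((1 - \<eta>) * \<gamma>)"] unfolding r_def by simp
  then have "r ^ T \<le> exp (- ((1 - \<eta>) * \<gamma>)) ^ T" using r0 by (intro power_mono) auto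
  also have "\<dots> = exp (- ((1 - \<eta>) * \<gamma> * T))" unfolding exp_of_nat_mult[symmetric] by (simp add: mult.commute)
  also have "\<dots> \<le> exp (- ((1 + \<delta>) * (real k + 1) * L))" using T unfolding \<gamma>_def L_def by simp
  finally have rT: "r ^ T \<le> exp (- ((1 + \<delta>) * (real k + 1) * L))" .
  have "r ^ T * (n / (\<eta> * (1 - \<mu>) / r))
      \<le> exp (- ((1 + \<delta>) * (real k + 1) * L)) * (exp ((real k + 1) * L) / (\<eta> * c))"
    using rT nc c0 n r0 \<eta> \<mu>1 by (intro mult_mono) auto
  also have "\<dots> = exp (- ((1 + \<delta>) * (real k + 1) * L) + (real k + 1) * L) / (\<eta> * c)"
    by (simp only: exp_add times_divide_eq_right)
  also have "- ((1 + \<delta>) * (real k + 1) * L) + (real k + 1) * L = - (\<delta> * (real k + 1) * L)"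
    by (simp add: algebra_simps)
  finally have "r ^ T * (n / (\<eta> * (1 - \<mu>) / r)) \<le> \<epsilon>" using small unfolding L_def by simp
  then show ?thesis
    using mixed_at_systematic_scan[OF form r0, of T \<epsilon>] c0 unfolding rc by simp
qed

text \<open>Up to factors 1 + \<delta>, \<open>X n\<close> has to reach (k + 1)
  ln(n/\<epsilon>)/\<gamma>. For a given \<open>d\<close> the chain is run for (1 + \<delta>) X n
  transitions, rounded up, and the estimate holds for all graphs of \<open>C n\<close> at
  once.\<close>

lemma scan_mixing_asymp_boundI:
  assumes C: "\<And>n E. E \<in> C n \<Longrightarrow> E \<in> graphs \<Delta> n" and q: "\<Delta> < q" and \<epsilon>: "0 < \<epsilon>" "\<epsilon> < 1"
    and sb: "\<And>n E. E \<in> C n \<Longrightarrow> spectral_bound n E ((real q - real \<Delta>) * \<mu> n)"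
    and c: "0 < c" and \<mu>: "\<And>n. 0 < n \<Longrightarrow> c / real n ^ k \<le> 1 - \<mu> n"
    and X: "\<And>\<delta>. 0 < \<delta> \<Longrightarrow> eventually (\<lambda>n. (real k + 1) * ln (real n / \<epsilon>)
              \<le> (1 + \<delta>) * ((1 - \<mu> n) / (1 - \<mu> n / 2)) * X n) sequentially"
    and X_top: "filterlim X at_top sequentially"
  shows "scan_mixing_asymp_bound C q \<epsilon> X"
  unfolding scan_mixing_asymp_bound_def
proof (rule ereal_le_epsilon2)
  fix d :: real assume "0 < d"
  \<comment> \<open>1 + 2 \<delta> is at most 1 + d: one \<delta> is spent on the running time, the
    other on rounding up, which costs at most \<delta> X n once X n is at least 1/\<delta>.\<close>
  define \<delta> where "\<delta> = min 1 (d / 2)"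
  have \<delta>: "0 < \<delta>" "\<delta> \<le> 1" "2 * \<delta> \<le> d" unfolding \<delta>_def using \<open>0 < d\<close> by auto
  \<comment> \<open>\<delta>/4 is reserved for the resolvent prefactor, \<delta>/2 for the
    hypothesis on \<open>X\<close>, and \<eta> for the distance from the singular rate. The product
    inequality below is tight at \<delta> = 1, which fixes the 16.\<close>
  define \<eta> where "\<eta> = \<delta> / 16"
  have \<eta>: "0 < \<eta>" "\<eta> < 1" unfolding \<eta>_def using \<delta> by auto
  have "\<delta> * \<delta> \<le> \<delta>" using \<delta> by (simp add: mult_left_le)
  then have prod: "(1 + \<delta> / 4) * (1 + \<delta> / 2) \<le> (1 - \<eta>) * (1 + \<delta>)"
    unfolding \<eta>_def by (simp add: field_simps)
  have "((\<lambda>L. exp (- (\<delta> / 4 * (real k + 1) * L)) / (\<eta> * c)) \<longlongrightarrow> 0 / (\<eta> * c)) at_top"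
  proof (intro tendsto_intros filterlim_compose[OF exp_at_bot])
    show "filterlim (\<lambda>L. - (\<delta> / 4 * (real k + 1) * L)) at_bot at_top"
      unfolding filterlim_uminus_at_bot minus_minus
      by (rule filterlim_tendsto_pos_mult_at_top[OF tendsto_const _ filterlim_ident]) (use \<delta> in simp)
  qed (use \<eta> c in simp)
  then have "eventually (\<lambda>L. exp (- (\<delta> / 4 * (real k + 1) * L)) / (\<eta> * c) < \<epsilon>) at_top"
    using \<epsilon>(1) by (intro order_tendstoD(2)) auto
  then have ev1: "eventually (\<lambda>n. exp (- (\<delta> / 4 * (real k + 1) * ln (real n / \<epsilon>))) / (\<eta> * c) < \<epsilon>) sequentially"
    using filterlim_ln_over[OF \<epsilon>(1)] by (rule eventually_compose_filterlim)
  have ev2: "eventually (\<lambda>n. (real k + 1) * ln (real n / \<epsilon>)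
      \<le> (1 + \<delta> / 2) * ((1 - \<mu> n) / (1 - \<mu> n / 2)) * X n) sequentially"
    using \<delta> by (intro X) auto
  have ev3: "eventually (\<lambda>n. 1 / \<delta> \<le> X n) sequentially"
    using X_top unfolding filterlim_at_top by blast
  have "eventually (\<lambda>n. (SUP E\<in>C n. ereal_of_enat (scan_time n E q \<epsilon>) / ereal (X n)) \<le> 1 + ereal d) sequentially"
    using ev1 ev2 ev3 eventually_gt_at_top[of 0]
  proof eventually_elim
    case (elim n)
    define T where "T = nat \<lceil>(1 + \<delta>) * X n\<rceil>"
    have X0: "0 < X n" using elim(3) \<delta> by (smt (verit) divide_pos_pos)
    have X1: "1 \<le> \<delta> * X n" using elim(3) \<delta> by (simp add: divide_le_eq mult.commute)
    have T1: "(1 + \<delta>) * X n \<le> T" unfolding T_def by linarith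
    have T2: "T \<le> (1 + \<delta>) * X n + 1" 
    using mult_nonneg_nonneg[of "1 + \<delta>" "X n"] unfolding T_def using X0 \<delta> by linarith
    define \<gamma> where "\<gamma> = (1 - \<mu> n) / (1 - \<mu> n / 2)"
    have "0 < 1 - \<mu> n" using \<mu>[OF elim(4)] c elim(4)
      by (smt (verit, best) divide_pos_pos zero_less_power of_nat_0_less_iff)
    then have \<gamma>0: "0 < \<gamma>" unfolding \<gamma>_def by simp
    have *: "(1 + \<delta> / 4) * (real k + 1) * ln (real n / \<epsilon>) \<le> (1 - \<eta>) * \<gamma> * T"
    proof -
      have "(1 + \<delta> / 4) * ((real k + 1) * ln (real n / \<epsilon>)) \<le> (1 + \<delta> / 4) * ((1 + \<delta> / 2) * \<gamma> * X n)"
        using elim(2) \<delta> unfolding \<gamma>_def by (intro mult_left_mono) auto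
      also have "\<dots> = ((1 + \<delta> / 4) * (1 + \<delta> / 2)) * (\<gamma> * X n)" by simp
      also have "\<dots> \<le> ((1 - \<eta>) * (1 + \<delta>)) * (\<gamma> * X n)"
        using prod \<gamma>0 X0 by (intro mult_right_mono) auto
      also have "\<dots> = (1 - \<eta>) * \<gamma> * ((1 + \<delta>) * X n)" by simp
      also have "\<dots> \<le> (1 - \<eta>) * \<gamma> * T" using T1 \<eta> \<gamma>0 by (intro mult_left_mono) auto
      finally show ?thesis by (simp add: mult.assoc)
    qed
    show ?case
    proof (rule SUP_least)
      fix E assume E: "E \<in> C n"
      have "mixed_at (systematic_scan n E q) (colourings n q) (uniform_colouring n E q) \<epsilon> T"
        by (rule mixed_at_scan_if_exponent[OF C[OF E] q \<epsilon> sb[OF E] c \<mu>[OF elim(4)] \<eta> _ *[unfolded \<gamma>_def]])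
          (use \<delta> elim(1) in auto)
      then have "scan_time n E q \<epsilon> \<le> enat T"
        unfolding scan_time_def mixing_time_def by (intro INF_lower) auto
      then have "ereal_of_enat (scan_time n E q \<epsilon>) \<le> ereal_of_enat (enat T)"
        by (simp only: ereal_of_enat_le_iff)
      then have "ereal_of_enat (scan_time n E q \<epsilon>) / ereal (X n) \<le> ereal_of_enat (enat T) / ereal (X n)"
        using X0 by (intro ereal_divide_right_mono) auto
      also have "\<dots> = ereal (T / X n)" using X0 by simp
      also have "\<dots> \<le> ereal (1 + d)"
      proof -
        have "T \<le> (1 + 2 * \<delta>) * X n" using T2 X1 by (simp add: algebra_simps)
        also have "\<dots> \<le> (1 + d) * X n" using \<delta> X0 by (intro mult_right_mono) auto
        finally show ?thesis using X0 by (simp add: divide_le_eq)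
      qed
      finally show "ereal_of_enat (scan_time n E q \<epsilon>) / ereal (X n) \<le> 1 + ereal d"
        by (simp add: one_ereal_def)
    qed
  qed
  then show "limsup (\<lambda>n. SUP E\<in>C n. ereal_of_enat (scan_time n E q \<epsilon>) / ereal (X n)) \<le> 1 + ereal d"
    by (rule Limsup_bounded)
qed

section \<open>Spectral bounds for sparse and for nonregular graphs\<close>

text \<open>Lowering \<open>y\<close> by its least positive value m on its support S takes m times
  the sum of \<open>A\<close> over S from the left-hand side and k m |S| from the right-hand side,
  where the density hypothesis for S compares them. At least one vertex leaves the support.\<close>

lemma layer_cake_min:
  fixes A :: "'i \<Rightarrow> 'i \<Rightarrow> real" and y :: "'i \<Rightarrow> real" and k :: real
  assumes V: "finite V" and dens: "\<And>U. U \<subseteq> V \<Longrightarrow> (\<Sum>i\<in>U. \<Sum>j\<in>U. A i j) \<le> k * card U"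
    and y: "\<And>i. i \<in> V \<Longrightarrow> 0 \<le> y i"
  shows "(\<Sum>i\<in>V. \<Sum>j\<in>V. A i j * min (y i) (y j)) \<le> k * (\<Sum>i\<in>V. y i)"
  using y
proof (induction "card {i\<in>V. 0 < y i}" arbitrary: y rule: less_induct)
  case less
  define S where "S = {i\<in>V. 0 < y i}"
  have fS: "finite S" "S \<subseteq> V" unfolding S_def using V by auto
  have zero: "y i = 0" if "i \<in> V" "i \<notin> S" for i
    using less.prems[OF that(1)] that unfolding S_def by auto
  show ?case
  proof (cases "S = {}")
    case True
    then show ?thesis using zero by simp
  next
    case False
    define m where "m = Min (y ` S)"
    have m: "m \<in> y ` S" "\<And>i. i \<in> S \<Longrightarrow> m \<le> y i"
      unfolding m_def using False fS by auto
    have m0: "0 < m" using m(1) unfolding S_def by auto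
    define y' where "y' i = (if i \<in> S then y i - m else y i)" for i
    obtain i0 where i0: "i0 \<in> S" "y i0 = m" using m(1) by auto
    have y'0: "0 \<le> y' i" if "i \<in> V" for i
      using m(2)[of i] less.prems[OF that] unfolding y'_def by auto
    have "{i\<in>V. 0 < y' i} \<subset> {i\<in>V. 0 < y i}"
    proof
      show "{i\<in>V. 0 < y' i} \<subseteq> {i\<in>V. 0 < y i}" using m0 unfolding y'_def by (auto split: if_splits)
      have "i0 \<in> {i\<in>V. 0 < y i}" "i0 \<notin> {i\<in>V. 0 < y' i}"
        using i0 unfolding y'_def S_def by auto
      then show "{i\<in>V. 0 < y' i} \<noteq> {i\<in>V. 0 < y i}" by metis
    qed
    then have "card {i\<in>V. 0 < y' i} < card {i\<in>V. 0 < y i}"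
      using V by (intro psubset_card_mono) auto
    then have IH: "(\<Sum>i\<in>V. \<Sum>j\<in>V. A i j * min (y' i) (y' j)) \<le> k * (\<Sum>i\<in>V. y' i)"
      using less.hyps y'0 by blast
    have min_eq: "min (y i) (y j) = min (y' i) (y' j) + (if i \<in> S \<and> j \<in> S then m else 0)"
      if "i \<in> V" "j \<in> V" for i j
      using zero[of i] zero[of j] that m(2)[of i] m(2)[of j] m0 unfolding y'_def by (auto simp: min_def)
    have restr: "(\<Sum>j\<in>V. if P j then f j else 0) = (\<Sum>j\<in>{j\<in>V. P j}. f j)" for f :: "'i \<Rightarrow> real" and P
      using V by (simp add: sum.inter_filter)
    have SS: "{j\<in>V. j \<in> S} = S" using fS by auto
    have "(\<Sum>i\<in>V. \<Sum>j\<in>V. A i j * min (y i) (y j))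
        = (\<Sum>i\<in>V. \<Sum>j\<in>V. A i j * min (y' i) (y' j))
          + (\<Sum>i\<in>V. \<Sum>j\<in>V. if i \<in> S \<and> j \<in> S then m * A i j else 0)"
      unfolding sum.distrib[symmetric] by (intro sum.cong refl) (auto simp: min_eq algebra_simps)
    also have "(\<Sum>i\<in>V. \<Sum>j\<in>V. if i \<in> S \<and> j \<in> S then m * A i j else 0)
        = (\<Sum>i\<in>V. if i \<in> S then (\<Sum>j\<in>V. if j \<in> S then m * A i j else 0) else 0)"
      by (intro sum.cong) auto
    also have "\<dots> = m * (\<Sum>i\<in>S. \<Sum>j\<in>S. A i j)"
      unfolding restr SS by (simp add: sum_distrib_left)
    also have "\<dots> \<le> m * (k * card S)" using dens[OF fS(2)] m0 by (intro mult_left_mono) auto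
    finally have "(\<Sum>i\<in>V. \<Sum>j\<in>V. A i j * min (y i) (y j)) \<le> k * ((\<Sum>i\<in>V. y' i) + m * card S)"
      using IH by (simp add: algebra_simps)
    also have "(\<Sum>i\<in>V. y' i) + m * card S = (\<Sum>i\<in>V. y i)"
    proof -
      have "(\<Sum>i\<in>V. y i) = (\<Sum>i\<in>V. y' i) + (\<Sum>i\<in>V. if i \<in> S then m else 0)"
        unfolding sum.distrib[symmetric] by (intro sum.cong) (auto simp: y'_def)
      then show ?thesis unfolding restr SS by (simp add: mult.commute)
    qed
    finally show ?thesis .
  qed
qed

lemma card_edge_eq_2: "sgraph V E \<Longrightarrow> e \<in> E \<Longrightarrow> card e = 2"
  unfolding sgraph_def by auto

lemma finite_edges: "sgraph V E \<Longrightarrow> finite E"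
  unfolding sgraph_def by (meson PowI finite_Pow_iff rev_finite_subset subsetI)

lemma sum_ordered_edges:
  assumes sg: "sgraph V E" and U: "finite U"
  shows "(\<Sum>i\<in>U. \<Sum>j\<in>U. if {i, j} \<in> E then 1 else 0 :: real) = 2 * real (card {e\<in>E. e \<subseteq> U})"
proof -
  let ?I = "{e\<in>E. e \<subseteq> U}"
  let ?P = "\<lambda>e. {(i, j). {i, j} = e}"
  have P: "finite (?P e) \<and> card (?P e) = 2" if "e \<in> ?I" for e
  proof -
    have "card e = 2" using that card_edge_eq_2[OF sg] by simp
    then obtain u v where uv: "e = {u, v}" "u \<noteq> v" by (auto simp: card_2_iff)
    then have "?P e = {(u, v), (v, u)}" by (auto simp: doubleton_eq_iff)
    then show ?thesis using uv by simp
  qed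
  have "(\<Sum>i\<in>U. \<Sum>j\<in>U. if {i, j} \<in> E then 1 else 0 :: real)
      = (\<Sum>(i, j)\<in>U \<times> U. if {i, j} \<in> E then 1 else 0)"
    using U by (simp add: sum.cartesian_product)
  also have "\<dots> = real (card {p\<in>U \<times> U. {fst p, snd p} \<in> E})"
    using U by (simp add: case_prod_beta sum.inter_filter[symmetric])
  also have "{p\<in>U \<times> U. {fst p, snd p} \<in> E} = (\<Union>e\<in>?I. ?P e)" by auto
  also have "card \<dots> = (\<Sum>e\<in>?I. card (?P e))"
    by (rule card_UN_disjoint) (use P finite_edges[OF sg] in auto)
  also have "\<dots> = (\<Sum>e\<in>?I. 2)" using P by (intro sum.cong) auto
  finally show ?thesis by simp
qed

lemma sum_edge_degree:
  fixes n :: nat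
  assumes sg: "sgraph {1..n} E" and i: "i \<in> {1..n}"
  shows "(\<Sum>j=1..n. if {i, j} \<in> E then c else 0 :: real) = c * degree E i"
proof -
  have "{j\<in>{1..n}. {i, j} \<in> E} = neighbours E i"
    using sg unfolding sgraph_def neighbours_def by (auto simp: insert_commute)
  moreover have "(\<Sum>j=1..n. if {i, j} \<in> E then c else 0) = (\<Sum>j\<in>{j\<in>{1..n}. {i, j} \<in> E}. c)"
    by (rule sum.inter_filter[symmetric]) (rule finite_atLeastAtMost)
  ultimately show ?thesis unfolding degree_def by simp
qed

text \<open>On every edge the larger weight goes to the endpoint with the smaller entry:
  \<open>2ab \<le> (a\<^sup>2 + b\<^sup>2)/c + (c - 1/c) min(a\<^sup>2, b\<^sup>2)\<close> for \<open>c \<ge> 1\<close>. The minima are controlled by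
  the density of the superlevel sets, and \<open>c = sqrt((\<Delta> - \<kappa>)/\<kappa>)\<close> balances the two terms.\<close>

lemma spectral_bound_density:
  assumes E: "E \<in> graphs \<Delta> n" and \<kappa>: "0 \<le> \<kappa>" "2 * \<kappa> \<le> real \<Delta>"
    and dens: "\<And>U. U \<subseteq> {1..n} \<Longrightarrow> real (card {e\<in>E. e \<subseteq> U}) \<le> \<kappa> * card U"
  shows "spectral_bound n E (2 * sqrt (\<kappa> * (real \<Delta> - \<kappa>)))"
proof -
  have sg: "sgraph {1..n} E" using E unfolding graphs_def by simp
  show ?thesis
  proof (cases "\<kappa> = 0")
    \<comment> \<open>\<kappa> = 0 leaves no edges, and the balancing constant would divide by
      0.\<close>
    case True
    have "{e\<in>E. e \<subseteq> {1..n}} = E" using sg unfolding sgraph_def by auto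
    then have "E = {}" using dens[of "{1..n}"] True finite_edges[OF sg] by auto
    then show ?thesis using True unfolding spectral_bound_def adjacency_form_def by simp
  next
    case False
    then have \<kappa>0: "0 < \<kappa>" using \<kappa> by simp
    define c where "c = sqrt ((real \<Delta> - \<kappa>) / \<kappa>)"
    have c1: "1 \<le> c" unfolding c_def using \<kappa> \<kappa>0 by (simp add: le_divide_eq)
    have c2: "c\<^sup>2 = (real \<Delta> - \<kappa>) / \<kappa>" unfolding c_def using \<kappa> \<kappa>0 by simp
    have "sqrt (\<kappa> * (real \<Delta> - \<kappa>)) = sqrt (\<kappa>\<^sup>2 * ((real \<Delta> - \<kappa>) / \<kappa>))"
      using \<kappa>0 by (simp add: power2_eq_square)
    also have "\<dots> = \<kappa> * c" unfolding c_def real_sqrt_mult using \<kappa>0 by simp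
    \<comment> \<open>By the choice of c, (\<Delta> - \<kappa>)/c = c \<kappa>, so both sides equal
      2 c \<kappa>.\<close>
    finally have bal: "2 * sqrt (\<kappa> * (real \<Delta> - \<kappa>)) = real \<Delta> / c + (c - 1 / c) * \<kappa>"
      using c1 c2 \<kappa>0 by (simp add: field_simps power2_eq_square)
    define A where "A i j = (if {i, j} \<in> E then 1 else 0 :: real)" for i j
    have A0: "0 \<le> A i j" for i j unfolding A_def by simp
    have Asym: "A i j = A j i" for i j unfolding A_def by (simp add: insert_commute)
    show ?thesis
      unfolding spectral_bound_def
    proof
      fix x :: "nat \<Rightarrow> real"
      let ?N = "\<Sum>i=1..n. (x i)\<^sup>2"
      have edge: "2 * (a * b) \<le> (a\<^sup>2 + b\<^sup>2) / c + (c - 1 / c) * min (a\<^sup>2) (b\<^sup>2)" for a b :: real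
      proof -
        have *: "2 * (a * b) \<le> c * a\<^sup>2 + b\<^sup>2 / c" for a b :: real
        proof -
          have "0 \<le> (c * a - b)\<^sup>2 / c" using c1 by simp
          also have "\<dots> = c * a\<^sup>2 + b\<^sup>2 / c - 2 * (a * b)"
            using c1 by (simp add: power2_eq_square field_simps)
          finally show ?thesis by simp
        qed
        show ?thesis
        proof (cases "a\<^sup>2 \<le> b\<^sup>2")
          case True
          then show ?thesis using *[of a b] by (simp add: min_def field_simps add_divide_distrib)
        next
          case False
          then show ?thesis using *[of b a] by (simp add: min_def field_simps add_divide_distrib)
        qed
      qed
      have deg: "(\<Sum>i=1..n. \<Sum>j=1..n. A i j * (x i)\<^sup>2) \<le> \<Delta> * ?N"
      proof -
        have "(\<Sum>i=1..n. \<Sum>j=1..n. A i j * (x i)\<^sup>2) = (\<Sum>i=1..n. (x i)\<^sup>2 * degree E i)"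
        proof (rule sum.cong[OF refl])
          fix i assume "i \<in> {1..n}"
          then have "(\<Sum>j=1..n. if {i, j} \<in> E then (x i)\<^sup>2 else 0) = (x i)\<^sup>2 * degree E i"
            by (rule sum_edge_degree[OF sg])
          moreover have "(\<Sum>j=1..n. A i j * (x i)\<^sup>2) = (\<Sum>j=1..n. if {i, j} \<in> E then (x i)\<^sup>2 else 0)"
            by (intro sum.cong) (auto simp: A_def)
          ultimately show "(\<Sum>j=1..n. A i j * (x i)\<^sup>2) = (x i)\<^sup>2 * degree E i" by simp
        qed
        also have "\<dots> \<le> (\<Sum>i=1..n. (x i)\<^sup>2 * \<Delta>)"
          using graphs_degree_le[OF E] by (intro sum_mono mult_left_mono) auto
        finally show ?thesis by (simp add: sum_distrib_left mult.commute)
      qed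
      have cake: "(\<Sum>i=1..n. \<Sum>j=1..n. A i j * min ((x i)\<^sup>2) ((x j)\<^sup>2)) \<le> (2 * \<kappa>) * ?N"
      proof (rule layer_cake_min[where y = "\<lambda>i. (x i)\<^sup>2"])
        fix U :: "nat set" assume U: "U \<subseteq> {1..n}"
        show "(\<Sum>i\<in>U. \<Sum>j\<in>U. A i j) \<le> 2 * \<kappa> * card U"
          unfolding A_def using sum_ordered_edges[OF sg finite_subset[OF U]] dens[OF U] by simp
      qed auto
      have "2 * adjacency_form n E x = (\<Sum>i=1..n. \<Sum>j=1..n. A i j * (2 * (x i * x j)))"
        unfolding adjacency_form_def sum_distrib_left by (intro sum.cong) (auto simp: A_def)
      also have "\<dots> \<le> (\<Sum>i=1..n. \<Sum>j=1..n. A i j *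
          (((x i)\<^sup>2 + (x j)\<^sup>2) / c + (c - 1 / c) * min ((x i)\<^sup>2) ((x j)\<^sup>2)))"
        by (intro sum_mono mult_left_mono edge A0)
      also have "\<dots> = ((\<Sum>i=1..n. \<Sum>j=1..n. A i j * (x i)\<^sup>2) + (\<Sum>i=1..n. \<Sum>j=1..n. A i j * (x j)\<^sup>2)) / c
          + (c - 1 / c) * (\<Sum>i=1..n. \<Sum>j=1..n. A i j * min ((x i)\<^sup>2) ((x j)\<^sup>2))"
        unfolding sum_divide_distrib sum_distrib_left sum.distrib[symmetric]
        by (intro sum.cong refl) (simp add: algebra_simps add_divide_distrib)
      also have "(\<Sum>i=1..n. \<Sum>j=1..n. A i j * (x j)\<^sup>2) = (\<Sum>i=1..n. \<Sum>j=1..n. A i j * (x i)\<^sup>2)"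
        by (subst sum.swap) (simp add: Asym)
      also have "((\<Sum>i=1..n. \<Sum>j=1..n. A i j * (x i)\<^sup>2) + (\<Sum>i=1..n. \<Sum>j=1..n. A i j * (x i)\<^sup>2)) / c
          + (c - 1 / c) * (\<Sum>i=1..n. \<Sum>j=1..n. A i j * min ((x i)\<^sup>2) ((x j)\<^sup>2))
          \<le> (\<Delta> * ?N + \<Delta> * ?N) / c + (c - 1 / c) * (2 * \<kappa> * ?N)"
        using deg cake c1
        by (intro add_mono divide_right_mono mult_left_mono) (auto simp: divide_le_eq intro: order_trans[of 1 c])
      also have "\<dots> = 2 * ((real \<Delta> / c + (c - 1 / c) * \<kappa>) * ?N)"
        by (simp add: algebra_simps add_divide_distrib)
      finally show "adjacency_form n E x \<le> 2 * sqrt (\<kappa> * (real \<Delta> - \<kappa>)) * ?N"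
        unfolding bal by simp
    qed
  qed
qed

text \<open>A walk is kept simple by cutting it back to the earlier visit whenever the next vertex
  repeats.\<close>

lemma reachable_distinct_path:
  assumes "(u, v) \<in> {(a, b). {a, b} \<in> E}\<^sup>*"
  shows "\<exists>ps. ps \<noteq> [] \<and> hd ps = u \<and> last ps = v \<and> distinct ps \<and> successively (\<lambda>a b. {a, b} \<in> E) ps"
  using assms
proof (induction rule: rtrancl_induct)
  case base
  show ?case by (rule exI[of _ "[u]"]) simp
next
  case (step y z)
  then obtain ps where ps: "ps \<noteq> []" "hd ps = u" "last ps = y" "distinct ps"
    "successively (\<lambda>a b. {a, b} \<in> E) ps" by auto
  show ?case
  proof (cases "z \<in> set ps")
    case True
    then obtain as bs where "ps = as @ z # bs" by (meson split_list)
    then show ?thesis using ps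
      by (intro exI[of _ "as @ [z]"]) (auto simp: successively_append_iff successively_Cons hd_append split: if_splits)
  next
    case False
    then show ?thesis using ps step.hyps
      by (intro exI[of _ "ps @ [z]"]) (auto simp: successively_append_iff)
  qed
qed

text \<open>A vertex of deficient degree anchors the Dirichlet form: Cauchy--Schwarz along a path from
  it bounds every entry.\<close>

lemma spectral_bound_nonregular:
  assumes E: "E \<in> graphs \<Delta> n" and conn: "connected_graph {1..n} E" and nreg: "\<not> regular_graph {1..n} E"
  shows "spectral_bound n E (real \<Delta> - 1 / (real n)\<^sup>2)"
proof -
  have sg: "sgraph {1..n} E" and n: "1 \<le> n" using E unfolding graphs_def by auto
  obtain v0 where v0: "v0 \<in> {1..n}" "degree E v0 \<noteq> \<Delta>"
    using nreg unfolding regular_graph_def by blast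
  then have dv0: "degree E v0 + 1 \<le> \<Delta>" using graphs_degree_le[OF E v0(1)] by simp
  show ?thesis
    unfolding spectral_bound_def
  proof
    fix x :: "nat \<Rightarrow> real"
    let ?N = "\<Sum>i=1..n. (x i)\<^sup>2"
    define D where "D i j = (if {i, j} \<in> E then (x j - x i)\<^sup>2 else 0)" for i j
    have D0: "0 \<le> D i j" for i j unfolding D_def by simp
    \<comment> \<open>Q will be \<Delta> times the square sum minus the adjacency form: the degree
      deficiencies plus the Dirichlet form. The double sum counts every edge in both directions,
      hence the division by 2.\<close>
    define Q where "Q = (\<Sum>i=1..n. (real \<Delta> - degree E i) * (x i)\<^sup>2) + (\<Sum>i=1..n. \<Sum>j=1..n. D i j) / 2"
    have degsum: "(\<Sum>i=1..n. \<Sum>j=1..n. if {i, j} \<in> E then (x i)\<^sup>2 else 0) = (\<Sum>i=1..n. degree E i * (x i)\<^sup>2)"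
      using sum_edge_degree[OF sg] by (intro sum.cong refl) (simp add: mult.commute)
    have degsum': "(\<Sum>i=1..n. \<Sum>j=1..n. if {i, j} \<in> E then (x j)\<^sup>2 else 0) = (\<Sum>i=1..n. degree E i * (x i)\<^sup>2)"
      using degsum by (subst sum.swap) (simp add: insert_commute)
    have "(\<Sum>i=1..n. \<Sum>j=1..n. D i j) = (\<Sum>i=1..n. \<Sum>j=1..n. if {i, j} \<in> E then (x i)\<^sup>2 else 0)
        + (\<Sum>i=1..n. \<Sum>j=1..n. if {i, j} \<in> E then (x j)\<^sup>2 else 0) - 2 * adjacency_form n E x"
      unfolding adjacency_form_def sum_distrib_left sum.distrib[symmetric] sum_subtractf[symmetric]
      by (intro sum.cong refl) (auto simp: D_def power2_eq_square algebra_simps)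
    moreover have "(\<Sum>i=1..n. (real \<Delta> - degree E i) * (x i)\<^sup>2) = \<Delta> * ?N - (\<Sum>i=1..n. degree E i * (x i)\<^sup>2)"
      by (simp add: algebra_simps sum_subtractf sum_distrib_left)
    ultimately have Q: "adjacency_form n E x = \<Delta> * ?N - Q"
      unfolding Q_def degsum degsum' by linarith
    have Q0: "0 \<le> Q"
      unfolding Q_def using D0 graphs_degree_le[OF E]
      by (intro add_nonneg_nonneg sum_nonneg divide_nonneg_nonneg mult_nonneg_nonneg) auto
    have "(x z)\<^sup>2 \<le> n * Q" if z: "z \<in> {1..n}" for z
    proof -
      obtain ps where ps: "ps \<noteq> []" "hd ps = v0" "last ps = z" "distinct ps"
        "successively (\<lambda>a b. {a, b} \<in> E) ps"
        using reachable_distinct_path conn v0(1) z unfolding connected_graph_def by metis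
      define l where "l = length ps - 1"
      have len: "length ps = Suc l" using ps(1) unfolding l_def by (cases ps) auto
      have adj: "{ps ! k, ps ! Suc k} \<in> E" if "k < l" for k
        using ps(5) that len by (auto simp: successively_conv_nth)
      have inV: "ps ! k \<in> {1..n}" if "k \<le> l" for k
      proof (cases "k = 0")
        case True
        then show ?thesis using v0 ps(1,2) by (simp add: hd_conv_nth)
      next
        case False
        then have "{ps ! (k - 1), ps ! k} \<in> E" using adj[of "k - 1"] that by simp
        then show ?thesis using sg unfolding sgraph_def by auto
      qed
      have "set ps \<subseteq> {1..n}" using inV len by (auto simp: in_set_conv_nth less_Suc_eq_le)
      then have ln: "Suc l \<le> n" using card_mono[of "{1..n}" "set ps"] distinct_card[OF ps(4)] len by simp
      \<comment> \<open>The steps of the path, taken in both directions, are distinct ordered pairs,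
        so twice the energy along the path is at most the double sum.\<close>
      let ?f = "\<lambda>k. (ps ! k, ps ! Suc k)" and ?g = "\<lambda>k. (ps ! Suc k, ps ! k)"
      have nth_eq: "ps ! a = ps ! b \<longleftrightarrow> a = b" if "a \<le> l" "b \<le> l" for a b
        using nth_eq_iff_index_eq[OF ps(4)] that len by simp
      have inj: "inj_on ?f {..<l}" "inj_on ?g {..<l}"
        using nth_eq by (auto simp: inj_on_def)
      have disj: "?f ` {..<l} \<inter> ?g ` {..<l} = {}"
      proof -
        have False if "a < l" "b < l" "ps ! a = ps ! Suc b" "ps ! Suc a = ps ! b" for a b
          using nth_eq[of a "Suc b"] nth_eq[of "Suc a" b] that by simp
        then show ?thesis by auto
      qed
      have "2 * (\<Sum>k<l. (x (ps ! Suc k) - x (ps ! k))\<^sup>2) = (\<Sum>p\<in>?f ` {..<l} \<union> ?g ` {..<l}. D (fst p) (snd p))"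
        using disj inj adj by (simp add: sum.union_disjoint sum.reindex D_def insert_commute power2_commute)
      also have "\<dots> \<le> (\<Sum>p\<in>{1..n} \<times> {1..n}. D (fst p) (snd p))"
        using inV D0 by (intro sum_mono2) auto
      also have "\<dots> = (\<Sum>i=1..n. \<Sum>j=1..n. D i j)" by (simp add: sum.cartesian_product case_prod_beta)
      finally have path: "(\<Sum>k<l. (x (ps ! Suc k) - x (ps ! k))\<^sup>2) \<le> (\<Sum>i=1..n. \<Sum>j=1..n. D i j) / 2" by simp
      have "(x v0)\<^sup>2 \<le> (real \<Delta> - degree E v0) * (x v0)\<^sup>2"
        using dv0 mult_right_mono[of 1 "real \<Delta> - degree E v0" "(x v0)\<^sup>2"] by simp
      also have "\<dots> \<le> (\<Sum>i=1..n. (real \<Delta> - degree E i) * (x i)\<^sup>2)"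
        using graphs_degree_le[OF E] v0 by (intro member_le_sum) auto
      finally have start: "(x v0)\<^sup>2 \<le> (\<Sum>i=1..n. (real \<Delta> - degree E i) * (x i)\<^sup>2)" .
      \<comment> \<open>The entry at \<open>z\<close> telescopes from the anchor. Its l + 1 \<le> n
        increments have square sum at most Q: the deficiency at \<open>v0\<close> pays for the first
        one, the Dirichlet form for the others.\<close>
      define h where "h k = (if k = 0 then x v0 else x (ps ! k) - x (ps ! (k - 1)))" for k
      have "(\<Sum>k<Suc m. h k) = x (ps ! m)" if "m \<le> l" for m
        using that by (induction m) (use ps(1,2) in \<open>auto simp: h_def hd_conv_nth\<close>)
      from this[of l] have "x z = (\<Sum>k<Suc l. h k)" using ps(1,3) len by (simp add: last_conv_nth)
      then have "(x z)\<^sup>2 \<le> (\<Sum>k<Suc l. (h k)\<^sup>2) * card {..<Suc l}"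
        using sum_squared_le_sum_of_squares[of h "{..<Suc l}"] by simp
      also have "(\<Sum>k<Suc l. (h k)\<^sup>2) = (x v0)\<^sup>2 + (\<Sum>k<l. (x (ps ! Suc k) - x (ps ! k))\<^sup>2)"
        unfolding sum.lessThan_Suc_shift by (simp add: h_def)
      also have "\<dots> * card {..<Suc l} \<le> Q * n"
        using start path ln Q0 unfolding Q_def by (intro mult_mono) auto
      finally show ?thesis by (simp add: mult.commute)
    qed
    then have "?N \<le> (\<Sum>i=1..n. n * Q)" by (intro sum_mono) auto
    then have "?N \<le> (real n)\<^sup>2 * Q" by (simp add: power2_eq_square mult_ac)
    then have "?N / (real n)\<^sup>2 \<le> Q" using n by (simp add: divide_le_eq mult.commute)
    then show "adjacency_form n E x \<le> (real \<Delta> - 1 / (real n)\<^sup>2) * ?N"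
      unfolding Q by (simp add: algebra_simps)
  qed
qed

section \<open>Tree-width\<close>

text \<open>The first vertex of a longest path has all its neighbours on the path; of two
  neighbours, one is at position 2 or later and closes a cycle. Isolated vertices count as
  leaves.\<close>

lemma forest_has_leaf:
  assumes I: "finite I" "I \<noteq> {}" and sg: "sgraph I F" and acyclic: "\<nexists>cs. graph_cycle F cs"
  shows "\<exists>i\<in>I. \<forall>j k. {i, j} \<in> F \<longrightarrow> {i, k} \<in> F \<longrightarrow> j = k"
proof (rule ccontr)
  assume "\<not> ?thesis"
  then have branch: "\<And>i. i \<in> I \<Longrightarrow> \<exists>j k. {i, j} \<in> F \<and> {i, k} \<in> F \<and> j \<noteq> k" by blast
  have edge: "i \<noteq> j \<and> j \<in> I" if "{i, j} \<in> F" for i j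
    using that sg unfolding sgraph_def by (cases "i = j") auto
  define P where "P = {xs. xs \<noteq> [] \<and> set xs \<subseteq> I \<and> distinct xs \<and> successively (\<lambda>a b. {a, b} \<in> F) xs}"
  have "length xs \<le> card I" if "xs \<in> P" for xs
    using that card_mono[OF I(1), of "set xs"] unfolding P_def by (auto simp: distinct_card)
  then have bound: "\<forall>xs. xs \<in> P \<longrightarrow> length xs < Suc (card I)" by (simp add: le_imp_less_Suc)
  obtain i where "i \<in> I" using I by auto
  then have "[i] \<in> P" unfolding P_def by simp
  from ex_has_greatest_nat[of "\<lambda>xs. xs \<in> P", OF this bound]
  obtain xs where xs: "xs \<in> P" and longest: "\<And>ys. ys \<in> P \<Longrightarrow> length ys \<le> length xs"
    by metis
  obtain x0 rest where x0: "xs = x0 # rest" using xs unfolding P_def by (cases xs) auto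
  have nbr: "y \<in> set rest" if "{x0, y} \<in> F" for y
  proof (rule ccontr)
    assume "y \<notin> set rest"
    then have "y # xs \<in> P"
      using xs edge[OF that] that unfolding P_def x0 by (auto simp: successively_Cons insert_commute)
    then show False using longest by fastforce
  qed
  have "x0 \<in> I" using xs unfolding P_def x0 by auto
  then obtain y z where yz: "{x0, y} \<in> F" "{x0, z} \<in> F" "y \<noteq> z" using branch by blast
  have "\<exists>m<length xs. 2 \<le> m \<and> {x0, xs ! m} \<in> F"
  proof -
    obtain a where a: "a < length rest" "rest ! a = y" using nbr[OF yz(1)] by (auto simp: in_set_conv_nth)
    obtain b where b: "b < length rest" "rest ! b = z" using nbr[OF yz(2)] by (auto simp: in_set_conv_nth)
    show ?thesis
    proof (cases "a = 0")
      case True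
      then have "b \<noteq> 0" using a(2) b(2) yz(3) by metis
      then show ?thesis using b yz x0 by (intro exI[of _ "Suc b"]) auto
    next
      case False
      then show ?thesis using a yz x0 by (intro exI[of _ "Suc a"]) auto
    qed
  qed
  then obtain m where m: "m < length xs" "2 \<le> m" "{x0, xs ! m} \<in> F" by blast
  have succ: "{xs ! i, xs ! Suc i} \<in> F" if "Suc i < length xs" for i
    using xs that unfolding P_def by (auto simp: successively_conv_nth)
  have "graph_cycle F (take (Suc m) xs)"
    unfolding graph_cycle_def
  proof (intro conjI allI impI)
    show "3 \<le> length (take (Suc m) xs)" "distinct (take (Suc m) xs)"
      using m xs unfolding P_def by auto
    fix i assume "i < length (take (Suc m) xs)"
    then have i: "i \<le> m" by simp
    have len: "length (take (Suc m) xs) = Suc m" using m by simp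
    have nth: "take (Suc m) xs ! k = xs ! k" if "k \<le> m" for k using that by simp
    have mod_le: "Suc i mod Suc m \<le> m" using mod_less_divisor[of "Suc m" "Suc i"] by linarith
    have "{xs ! i, xs ! (Suc i mod Suc m)} \<in> F"
    proof (cases "i = m")
      case True
      then show ?thesis using m(3) by (simp add: x0 insert_commute)
    next
      case False
      then show ?thesis using i m(1) succ[of i] by simp
    qed
    then show "{take (Suc m) xs ! i, take (Suc m) xs ! (Suc i mod length (take (Suc m) xs))} \<in> F"
      unfolding len nth[OF i] nth[OF mod_le] .
  qed
  then show False using acyclic by blast
qed

lemma connected_graphD:
  "connected_graph V E \<Longrightarrow> u \<in> V \<Longrightarrow> v \<in> V \<Longrightarrow> (u, v) \<in> {(a, b). {a, b} \<in> E}\<^sup>*"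
  unfolding connected_graph_def by blast

text \<open>Induction along leaves l of the decomposition forest. If a vertex of \<open>U\<close>
  lies in the bag of l but in no neighbouring bag, its subtree is l alone, and this bag covers all
  its edges inside \<open>U\<close>. Otherwise every vertex of \<open>U\<close> in
  \<open>B l\<close> is also in the neighbouring bag, and l can be deleted. Forests and a separate
  \<open>U\<close> make the statement stable under deletion and under passage to induced
  subgraphs.\<close>

lemma bag_decomposition_low_degree:
  assumes "finite I" "sgraph I F" "\<nexists>cs. graph_cycle F cs" "U \<noteq> {}"
    and two: "\<forall>e\<in>E. card e = 2"
    and "\<forall>e\<in>E. e \<subseteq> U \<longrightarrow> (\<exists>i\<in>I. e \<subseteq> B i)"
    and "\<forall>v\<in>U. connected_graph {i \<in> I. v \<in> B i} {f \<in> F. f \<subseteq> {i \<in> I. v \<in> B i}}"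
  shows "\<exists>v\<in>U. \<exists>i\<in>I. v \<in> B i \<and> (\<forall>u\<in>U. {u, v} \<in> E \<longrightarrow> u \<in> B i)"
  using assms(1-4,6-)
proof (induction "card I" arbitrary: I F rule: less_induct)
  case less
  note fin = less.prems(1) and sg = less.prems(2) and acyclic = less.prems(3)
    and cover = less.prems(5) and conn = less.prems(6)
  let ?J = "\<lambda>v. {i \<in> I. v \<in> B i}"
  have "?J v \<noteq> {}" if "v \<in> U" for v using conn that unfolding connected_graph_def by blast
  then have "I \<noteq> {}" using less.prems(4) by blast
  then have "\<exists>l\<in>I. \<forall>j k. {l, j} \<in> F \<longrightarrow> {l, k} \<in> F \<longrightarrow> j = k"
    by (rule forest_has_leaf[OF fin _ sg acyclic])
  then obtain l where l: "l \<in> I" "\<And>j k. {l, j} \<in> F \<Longrightarrow> {l, k} \<in> F \<Longrightarrow> j = k"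
    by blast
  have edge: "a \<noteq> b \<and> a \<in> I \<and> b \<in> I" if "{a, b} \<in> F" for a b
    using that sg unfolding sgraph_def by (cases "a = b") auto
  show ?case
  proof (cases "\<exists>v\<in>U. v \<in> B l \<and> (\<forall>j. {l, j} \<in> F \<longrightarrow> v \<notin> B j)")
    case True
    then obtain v where v: "v \<in> U" "v \<in> B l" "\<And>j. {l, j} \<in> F \<Longrightarrow> v \<notin> B j" by blast
    \<comment> \<open>A path inside the subtree of \<open>v\<close> that leaves l would enter a
      neighbour of l whose bag contains \<open>v\<close>.\<close>
    have only: "i = l" if "i \<in> ?J v" for i
    proof -
      have "l \<in> ?J v" using v l(1) by simp
      then have "(l, i) \<in> {(a, b). {a, b} \<in> {f \<in> F. f \<subseteq> ?J v}}\<^sup>*"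
        by (rule connected_graphD[OF bspec[OF conn v(1)] _ that])
      then show ?thesis
      proof (cases rule: converse_rtranclE)
        case (step y)
        then show ?thesis using v(3)[of y] by auto
      qed simp
    qed
    have "u \<in> B l" if u: "u \<in> U" "{u, v} \<in> E" for u
    proof -
      have "{u, v} \<subseteq> U" using u v(1) by simp
      then obtain i where "i \<in> I" "{u, v} \<subseteq> B i" using bspec[OF cover u(2)] by blast
      then show ?thesis using only[of i] by simp
    qed
    then show ?thesis using v l(1) by blast
  next
    case False
    then have push: "\<And>v. v \<in> U \<Longrightarrow> v \<in> B l \<Longrightarrow> \<exists>j. {l, j} \<in> F \<and> v \<in> B j" by blast
    define I' where "I' = I - {l}"
    define F' where "F' = {f \<in> F. l \<notin> f}"
    have card: "card I' < card I" unfolding I'_def using fin l(1) by (intro psubset_card_mono) auto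
    have sg': "sgraph I' F'" using sg unfolding sgraph_def I'_def F'_def by auto
    have acyclic': "\<nexists>cs. graph_cycle F' cs"
      using acyclic unfolding graph_cycle_def F'_def by blast
    have cover': "\<forall>e\<in>E. e \<subseteq> U \<longrightarrow> (\<exists>i\<in>I'. e \<subseteq> B i)"
    proof (intro ballI impI)
      fix e assume e: "e \<in> E" "e \<subseteq> U"
      obtain i where i: "i \<in> I" "e \<subseteq> B i" using cover e by blast
      show "\<exists>i\<in>I'. e \<subseteq> B i"
      proof (cases "i = l")
        case True
        obtain a where a: "a \<in> e" using two e(1) by (metis card.empty ex_in_conv zero_neq_numeral)
        then obtain j where j: "{l, j} \<in> F" using push i e True by blast
        have "e \<subseteq> B j"
        proof
          fix b assume "b \<in> e"
          then obtain j' where "{l, j'} \<in> F" "b \<in> B j'" using push i e True by blast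
          then show "b \<in> B j" using l(2)[OF j] by simp
        qed
        then show ?thesis using edge[OF j] unfolding I'_def by blast
      next
        case False
        then show ?thesis using i unfolding I'_def by blast
      qed
    qed
    have conn': "\<forall>v\<in>U. connected_graph {i \<in> I'. v \<in> B i} {f \<in> F'. f \<subseteq> {i \<in> I'. v \<in> B i}}"
    proof
      fix v assume v: "v \<in> U"
      let ?R = "{(a, b). {a, b} \<in> {f \<in> F. f \<subseteq> ?J v}}"
      let ?R' = "{(a, b). {a, b} \<in> {f \<in> F'. f \<subseteq> {i \<in> I'. v \<in> B i}}}"
      have ne: "?J v \<noteq> {}" using bspec[OF conn v] unfolding connected_graph_def by (rule conjunct1)
      note R = connected_graphD[OF bspec[OF conn v]]
      \<comment> \<open>If \<open>v\<close> is not in \<open>B l\<close>, then l does not belong to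
        its subtree; the default l makes the map \<open>c\<close> below the identity.\<close>
      define j where "j = (if v \<in> B l then (SOME j. {l, j} \<in> F \<and> v \<in> B j) else l)"
      have j: "{l, j} \<in> F \<and> v \<in> B j" if "v \<in> B l"
        using someI_ex[OF push[OF v that]] that unfolding j_def by simp
      \<comment> \<open>A retraction of the leaf onto its only neighbour: an edge at l collapses to
        a point, all other edges stay.\<close>
      define c where "c x = (if x = l then j else x)" for x
      have step_image: "(c a, c b) \<in> ?R'\<^sup>*" if ab: "(a, b) \<in> ?R" for a b
      proof -
        have abF: "{a, b} \<in> F" and abJ: "v \<in> B a" "v \<in> B b" "a \<in> I" "b \<in> I" using ab by auto
        consider "a = l" | "b = l" | "a \<noteq> l" "b \<noteq> l" by blast
        then show ?thesis
        proof cases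
          case 1
          then have "b = j" using l(2) abF j abJ by blast
          then show ?thesis unfolding c_def 1 by simp
        next
          case 2
          then have "{l, a} \<in> F" using abF by (simp add: insert_commute)
          then have "a = j" using l(2) j abJ 2 by blast
          then show ?thesis unfolding c_def 2 by simp
        next
          case 3
          then have "(a, b) \<in> ?R'" using abF abJ unfolding F'_def I'_def by auto
          then show ?thesis unfolding c_def using 3 by auto
        qed
      qed
      have map: "(c a, c b) \<in> ?R'\<^sup>*" if "(a, b) \<in> ?R\<^sup>*" for a b
        using that
      proof (induction rule: rtrancl_induct)
        case (step y z)
        show ?case by (rule rtrancl_trans[OF step.IH step_image[OF step.hyps(2)]])
      qed simp
      have "{i \<in> I'. v \<in> B i} \<noteq> {}"
      proof (cases "v \<in> B l")
        case True
        then have "j \<in> {i \<in> I'. v \<in> B i}"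
          using j[OF True] edge[of l j] unfolding I'_def by auto
        then show ?thesis by (metis empty_iff)
      next
        case False
        then show ?thesis using ne unfolding I'_def by blast
      qed
      moreover have "(a, b) \<in> ?R'\<^sup>*" if "a \<in> {i \<in> I'. v \<in> B i}" "b \<in> {i \<in> I'. v \<in> B i}" for a b
      proof -
        have ab: "a \<in> ?J v" "b \<in> ?J v" "a \<noteq> l" "b \<noteq> l" using that unfolding I'_def by auto
        then show ?thesis using map[OF R[OF ab(1,2)]] unfolding c_def by (simp only: if_False)
      qed
      ultimately show "connected_graph {i \<in> I'. v \<in> B i} {f \<in> F'. f \<subseteq> {i \<in> I'. v \<in> B i}}"
        unfolding connected_graph_def by blast
    qed
    have "finite I'" using fin unfolding I'_def by simp
    from less.hyps[OF card this sg' acyclic' less.prems(4) cover' conn']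
    obtain v i where vi: "v \<in> U" "i \<in> I'" "v \<in> B i" "\<forall>u\<in>U. {u, v} \<in> E \<longrightarrow> u \<in> B i"
      by (elim bexE conjE) (rule that)
    have "i \<in> I" using vi(2) unfolding I'_def by simp
    show ?thesis by (intro bexI[OF _ vi(1)] bexI[OF _ \<open>i \<in> I\<close>] conjI vi(3,4))
  qed
qed

text \<open>A single bag containing all of \<open>V\<close> is a decomposition, so the minimum is
  taken over a nonempty set.\<close>

lemma treewidth_attained:
  assumes sg: "sgraph V E"
  shows "\<exists>(I :: nat set) F B. tree_decomposition V E I F B \<and> (\<forall>i\<in>I. card (B i) \<le> treewidth V E + 1)"
proof -
  let ?P = "\<lambda>w. \<exists>(I :: nat set) F B. tree_decomposition V E I F B \<and> (\<forall>i\<in>I. card (B i) \<le> w + 1)"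
  have "tree_decomposition V E {0::nat} {} (\<lambda>_. V)"
    unfolding tree_decomposition_def
  proof (intro conjI ballI)
    show "graph_tree {0::nat} {}"
      unfolding graph_tree_def
    proof (intro conjI)
      show "\<nexists>cs. graph_cycle {} (cs :: nat list)"
      proof
        assume "\<exists>cs. graph_cycle {} (cs :: nat list)"
        then obtain cs :: "nat list" where "graph_cycle {} cs" by blast
        then have "3 \<le> length cs" "\<forall>i<length cs. False" unfolding graph_cycle_def by auto
        then show False by (metis less_le_trans zero_less_numeral)
      qed
    qed (auto simp: sgraph_def connected_graph_def)
    show "\<exists>i\<in>{0::nat}. e \<subseteq> V" if "e \<in> E" for e
      using that sg unfolding sgraph_def by blast
    show "connected_graph {i \<in> {0::nat}. v \<in> V} {f \<in> {}. f \<subseteq> {i \<in> {0}. v \<in> V}}" if "v \<in> V" for v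
      using that unfolding connected_graph_def by simp
  qed simp
  then have "?P (card V)"
    by (intro exI[of _ "{0}"] exI[of _ "{}"] exI[of _ "\<lambda>_. V"]) simp
  then have "?P (LEAST w. ?P w)" by (rule LeastI[of ?P])
  then show ?thesis unfolding treewidth_def .
qed

text \<open>Some bag contains a vertex of \<open>U\<close> together with all its neighbours in
  \<open>U\<close>. It has at most t + 1 elements, and the vertex itself is one of them.\<close>

lemma treewidth_low_degree:
  assumes sg: "sgraph V E" and U: "U \<subseteq> V" "U \<noteq> {}"
  shows "\<exists>v\<in>U. card {u\<in>U. {u, v} \<in> E} \<le> treewidth V E"
proof -
  obtain I :: "nat set" and F B where td: "tree_decomposition V E I F B"
    and width': "\<forall>i\<in>I. card (B i) \<le> treewidth V E + 1"
    using treewidth_attained[OF sg] by (elim exE conjE) (rule that)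
  have "graph_tree I F" using td unfolding tree_decomposition_def by blast
  then have IF: "sgraph I F" "finite I" "\<nexists>cs. graph_cycle F cs"
    unfolding graph_tree_def sgraph_def by blast+
  have "\<exists>v\<in>U. \<exists>i\<in>I. v \<in> B i \<and> (\<forall>u\<in>U. {u, v} \<in> E \<longrightarrow> u \<in> B i)"
  proof (rule bag_decomposition_low_degree[OF IF(2,1,3) U(2)])
    show "\<forall>e\<in>E. card e = 2" using sg unfolding sgraph_def by blast
    show "\<forall>e\<in>E. e \<subseteq> U \<longrightarrow> (\<exists>i\<in>I. e \<subseteq> B i)"
      "\<forall>v\<in>U. connected_graph {i \<in> I. v \<in> B i} {f \<in> F. f \<subseteq> {i \<in> I. v \<in> B i}}"
      using td U(1) unfolding tree_decomposition_def by blast+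
  qed
  then obtain v i where v: "v \<in> U" "i \<in> I" "v \<in> B i" "\<And>u. u \<in> U \<Longrightarrow> {u, v} \<in> E \<Longrightarrow> u \<in> B i" by blast
  have fin: "finite (B i)"
    using td v(2) sg unfolding tree_decomposition_def sgraph_def by (meson finite_subset)
  have "{v, v} \<notin> E" using card_edge_eq_2[OF sg, of "{v, v}"] by auto
  then have "{u\<in>U. {u, v} \<in> E} \<subseteq> B i - {v}" using v(4) by auto
  then have "card {u\<in>U. {u, v} \<in> E} \<le> card (B i - {v})" using fin by (intro card_mono) auto
  also have "\<dots> \<le> treewidth V E" using bspec[OF width' v(2)] v(3) fin by (simp add: le_diff_conv)
  finally show ?thesis using v(1) by blast
qed

lemma card_induced_edges_remove:
  assumes sg: "sgraph V E" and U: "finite U" "v \<in> U"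
  shows "card {e\<in>E. e \<subseteq> U} \<le> card {e\<in>E. e \<subseteq> U - {v}} + card {u\<in>U. {u, v} \<in> E}"
proof -
  have "{e\<in>E. e \<subseteq> U} \<subseteq> {e\<in>E. e \<subseteq> U - {v}} \<union> (\<lambda>u. {u, v}) ` {u\<in>U. {u, v} \<in> E}"
  proof
    fix e assume e: "e \<in> {e\<in>E. e \<subseteq> U}"
    show "e \<in> {e\<in>E. e \<subseteq> U - {v}} \<union> (\<lambda>u. {u, v}) ` {u\<in>U. {u, v} \<in> E}"
    proof (cases "v \<in> e")
      case True
      have "card e = 2" using e card_edge_eq_2[OF sg] by simp
      then obtain a b where "e = {a, b}" "a \<noteq> b" by (auto simp: card_2_iff)
      then have "\<exists>u. e = {u, v}" using True by auto
      then show ?thesis using e by auto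
    next
      case False
      then show ?thesis using e by auto
    qed
  qed
  then have "card {e\<in>E. e \<subseteq> U} \<le> card ({e\<in>E. e \<subseteq> U - {v}} \<union> (\<lambda>u. {u, v}) ` {u\<in>U. {u, v} \<in> E})"
    using finite_edges[OF sg] U by (intro card_mono) auto
  also have "\<dots> \<le> card {e\<in>E. e \<subseteq> U - {v}} + card ((\<lambda>u. {u, v}) ` {u\<in>U. {u, v} \<in> E})"
    by (rule card_Un_le)
  also have "card ((\<lambda>u. {u, v}) ` {u\<in>U. {u, v} \<in> E}) \<le> card {u\<in>U. {u, v} \<in> E}"
    using U by (intro card_image_le) auto
  finally show ?thesis by simp
qed

text \<open>Vertices of low degree are removed one by one. A vertex removed while k others remain
  has degree at most k as well as t; keeping the minimum is what yields the second-order term t(t +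
  1)/2.\<close>

lemma card_induced_edges_degenerate:
  assumes sg: "sgraph V E"
    and low: "\<And>U. U \<subseteq> V \<Longrightarrow> U \<noteq> {} \<Longrightarrow> \<exists>v\<in>U. card {u\<in>U. {u, v} \<in> E} \<le> t"
    and U: "U \<subseteq> V"
  shows "card {e\<in>E. e \<subseteq> U} \<le> (\<Sum>k<card U. min t k)"
  using U
proof (induction "card U" arbitrary: U)
  case 0
  then have "U = {}" using sg finite_subset[of U V] unfolding sgraph_def by auto
  have "{} \<notin> E" using card_edge_eq_2[OF sg, of "{}"] by auto
  then have "{e\<in>E. e \<subseteq> U} = {}" using \<open>U = {}\<close> by auto
  then have "card {e\<in>E. e \<subseteq> U} = 0" by (simp only: card.empty)
  then show ?case by simp
next
  case (Suc m)
  have fU: "finite U" using Suc.prems sg finite_subset[of U V] unfolding sgraph_def by auto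
  have "U \<noteq> {}" using Suc by auto
  then obtain v where v: "v \<in> U" "card {u\<in>U. {u, v} \<in> E} \<le> t" using low Suc by blast
  have cU: "card (U - {v}) = m" using Suc.hyps(2) v fU by simp
  have "{v, v} \<notin> E" using card_edge_eq_2[OF sg, of "{v, v}"] by auto
  then have "card {u\<in>U. {u, v} \<in> E} \<le> card (U - {v})" using fU by (intro card_mono) auto
  then have "card {u\<in>U. {u, v} \<in> E} \<le> min t m" using v cU by simp
  moreover have "card {e\<in>E. e \<subseteq> U - {v}} \<le> (\<Sum>k<m. min t k)"
    using Suc.hyps(1)[of "U - {v}"] cU Suc.prems by auto
  moreover have "(\<Sum>k<card U. min t k) = (\<Sum>k<m. min t k) + min t m"
    unfolding Suc.hyps(2)[symmetric] by simp
  ultimately show ?case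
    using card_induced_edges_remove[OF sg fU v(1)] by linarith
qed

lemma card_induced_edges_choose_2:
  assumes sg: "sgraph V E" and U: "finite U"
  shows "2 * card {e\<in>E. e \<subseteq> U} \<le> card U * (card U - 1)"
proof -
  have "{e\<in>E. e \<subseteq> U} \<subseteq> {e. e \<subseteq> U \<and> card e = 2}" using card_edge_eq_2[OF sg] by auto
  then have "card {e\<in>E. e \<subseteq> U} \<le> card {e. e \<subseteq> U \<and> card e = 2}"
    using U by (intro card_mono) auto
  also have "\<dots> = card U choose 2" by (rule n_subsets[OF U])
  finally show ?thesis by (simp add: choose_two)
qed

lemma sgraph_edgeD:
  assumes "sgraph V E" "{u, v} \<in> E"
  shows "u \<in> V \<and> v \<in> V \<and> u \<noteq> v"
  using assms unfolding sgraph_def by (cases "u = v") auto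

lemma max_degree_less:
  assumes "E \<in> graphs \<Delta> n"
  shows "\<Delta> < n"
proof -
  have sg: "sgraph {1..n} E" and n: "1 \<le> n" and \<Delta>: "max_degree {1..n} E = \<Delta>"
    using assms unfolding graphs_def by auto
  have "Max (degree E ` {1..n}) \<in> degree E ` {1..n}" using n by (intro Max_in) auto
  then have "\<Delta> \<in> degree E ` {1..n}" using \<Delta> unfolding max_degree_def by simp
  then obtain v where v: "v \<in> {1..n}" "degree E v = \<Delta>" by auto
  have "neighbours E v \<subseteq> {1..n} - {v}"
  proof
    fix u assume "u \<in> neighbours E v"
    then have "{u, v} \<in> E" unfolding neighbours_def by simp
    then show "u \<in> {1..n} - {v}" using sgraph_edgeD[OF sg] by simp
  qed
  then have "card (neighbours E v) \<le> card ({1..n} - {v})" by (intro card_mono) auto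
  then show ?thesis using v n unfolding degree_def by auto
qed

text \<open>For m \<ge> t + 1 vertices the sum of minima is t m - t(t + 1)/2, and spreading the
  deficit over m \<le> n vertices lowers the density by at least t(t + 1)/(2n). Smaller sets have
  density at most t/2, which suffices because t < n, a consequence of 2t \<le> \<Delta> < n.\<close>

lemma treewidth_density:
  assumes E: "E \<in> graphs \<Delta> n" and tw: "treewidth {1..n} E = t" and t: "2 * t \<le> \<Delta>" and U: "U \<subseteq> {1..n}"
  shows "real (card {e\<in>E. e \<subseteq> U}) \<le> (real t - real t * (real t + 1) / (2 * real n)) * card U"
proof -
  have sg: "sgraph {1..n} E" using E unfolding graphs_def by simp
  define m where "m = card U"
  have mn: "m \<le> n" using card_mono[OF _ U] unfolding m_def by simp
  have tn: "t + 1 \<le> n" using max_degree_less[OF E] t by simp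
  have "card {e\<in>E. e \<subseteq> U} \<le> (\<Sum>k<m. min t k)"
    unfolding m_def
    by (rule card_induced_edges_degenerate[OF sg _ U]) (use treewidth_low_degree[OF sg] tw in auto)
  then have 1: "real (card {e\<in>E. e \<subseteq> U}) \<le> real (\<Sum>k<m. min t k)"
    by (simp only: of_nat_le_iff)
  have small: "2 * (\<Sum>k<m. min t k) = m * (m - 1)" if "m \<le> t + 1" for m
    using that
  proof (induction m)
    case (Suc m)
    then have "2 * (\<Sum>k<Suc m. min t k) = m * (m - 1) + 2 * m" by simp
    also have "\<dots> = Suc m * (Suc m - 1)" by (cases m) (simp_all add: algebra_simps)
    finally show ?case .
  qed simp
  have large: "real (\<Sum>k<m. min t k) = t * m - t * (t + 1) / 2" if "t + 1 \<le> m" for m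
    using that
  proof (induction m rule: dec_induct)
    case base
    have "2 * real (\<Sum>k<t + 1. min t k) = real (2 * (\<Sum>k<t + 1. min t k))" by simp
    also have "\<dots> = real (t + 1) * real t" unfolding small[OF order_refl] by (simp add: algebra_simps)
    finally have half: "real (\<Sum>k<t + 1. min t k) = real (t + 1) * real t / 2" by linarith
    show ?case unfolding half by (simp add: field_simps)
  next
    case (step m)
    then show ?case by (simp add: algebra_simps)
  qed
  have n0: "0 < real n" using tn by simp
  consider "m \<le> t + 1" | "t + 1 \<le> m" by linarith
  then have "real (\<Sum>k<m. min t k) \<le> (real t - real t * (real t + 1) / (2 * real n)) * m"
  proof cases
    case 1
    have "real t * (real t + 1) / (2 * real n) \<le> real t / 2"
      using tn n0 by (simp add: divide_le_eq mult_left_mono)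
    then have half: "real t / 2 \<le> real t - real t * (real t + 1) / (2 * real n)" by simp
    have "2 * real (\<Sum>k<m. min t k) = real (m * (m - 1))"
      unfolding small[OF 1, symmetric] by simp
    also have "\<dots> \<le> real m * t" using 1 by (simp add: mult_left_mono)
    finally have "real (\<Sum>k<m. min t k) \<le> real t / 2 * m" by (simp add: mult.commute del: of_nat_sum)
    also have "\<dots> \<le> (real t - real t * (real t + 1) / (2 * real n)) * m"
      using half by (intro mult_right_mono) auto
    finally show ?thesis .
  next
    case 2
    have "real t * (real t + 1) / (2 * real n) * m \<le> real t * (real t + 1) / (2 * real n) * n"
      using mn by (intro mult_left_mono) auto
    also have "\<dots> = t * (t + 1) / 2" using n0 by (simp add: field_simps)
    finally show ?thesis unfolding large[OF 2] by (simp add: left_diff_distrib)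
  qed
  then show ?thesis using 1 unfolding m_def by linarith
qed

section \<open>Euler's inequality for tile complexes\<close>

text \<open>The classes are built as the components of the graph with vertex set \<open>PP\<close>
  and edges \<open>S\<close>: starting from singletons, the classes of the two ends of every edge
  are merged, and each merge loses at most one class.\<close>

lemma partition_by_edges:
  assumes PP: "finite PP" and S: "finite S" and pt: "\<And>s. s \<in> S \<Longrightarrow> \<exists>p p'. pt s = {p, p'} \<and> {p, p'} \<subseteq> PP"
  shows "\<exists>\<C>. \<Union>\<C> = PP \<and> {} \<notin> \<C> \<and> disjoint \<C> \<and> (\<forall>f\<in>\<C>. \<forall>s\<in>S. pt s \<inter> f \<noteq> {} \<longrightarrow> pt s \<subseteq> f)
    \<and> card PP \<le> card \<C> + card S"
  using S pt
proof (induction S rule: finite_induct)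
  case empty
  have "card ((\<lambda>p. {p}) ` PP) = card PP" by (intro card_image) (auto simp: inj_on_def)
  then show ?case
    by (intro exI[of _ "(\<lambda>p. {p}) ` PP"]) (auto simp: disjoint_def)
next
  case (insert s S)
  then obtain \<C> where C: "\<Union>\<C> = PP" "{} \<notin> \<C>" "disjoint \<C>"
    "\<forall>f\<in>\<C>. \<forall>s\<in>S. pt s \<inter> f \<noteq> {} \<longrightarrow> pt s \<subseteq> f" "card PP \<le> card \<C> + card S" by auto
  have fC: "finite \<C>" using C(1) PP finite_UnionD by metis
  obtain p p' where p: "pt s = {p, p'}" "p \<in> PP" "p' \<in> PP" using insert.prems[of s] by auto
  obtain f where f: "f \<in> \<C>" "p \<in> f" using p C(1) by auto
  obtain f' where f': "f' \<in> \<C>" "p' \<in> f'" using p C(1) by auto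
  have uniq: "h = h'" if "h \<in> \<C>" "h' \<in> \<C>" "x \<in> h" "x \<in> h'" for h h' x
    using C(3) that unfolding disjoint_def by (metis IntI empty_iff)
  define \<D> where "\<D> = insert (f \<union> f') (\<C> - {f, f'})"
  have "card \<C> \<le> card \<D> + 1"
  proof -
    have "f \<union> f' \<notin> \<C> - {f, f'}"
    proof
      assume "f \<union> f' \<in> \<C> - {f, f'}"
      then show False using uniq[of "f \<union> f'" f p] f by auto
    qed
    then have 1: "card \<D> = card (\<C> - {f, f'}) + 1" unfolding \<D>_def using fC by simp
    have "card \<C> - card {f, f'} \<le> card (\<C> - {f, f'})" by (rule diff_card_le_card_Diff) simp
    moreover have "card {f, f'} \<le> 2" by (simp add: card_insert_if)
    ultimately show ?thesis using 1 by linarith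
  qed
  then have card: "card PP \<le> card \<D> + card (insert s S)"
    using C(5) insert.hyps by simp
  have U: "\<Union>\<D> = PP" unfolding \<D>_def using C(1) f(1) f'(1) by auto
  have ne: "{} \<notin> \<D>" unfolding \<D>_def using C(2) f by auto
  have dis: "disjoint \<D>"
    unfolding disjoint_def
  proof (intro ballI impI)
    fix a b assume ab: "a \<in> \<D>" "b \<in> \<D>" "a \<noteq> b"
    have *: "h \<inter> (f \<union> f') = {}" if "h \<in> \<C> - {f, f'}" for h
      using uniq[of h f] uniq[of h f'] that f f' by auto
    have **: "a \<inter> b = {}" if "a \<in> \<C>" "b \<in> \<C>"
      using uniq[of a b] that ab(3) by auto
    show "a \<inter> b = {}"
      using ab * ** unfolding \<D>_def by auto
  qed
  have closed: "\<forall>h\<in>\<D>. \<forall>s'\<in>insert s S. pt s' \<inter> h \<noteq> {} \<longrightarrow> pt s' \<subseteq> h"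
  proof (intro ballI impI)
    fix h s' assume h: "h \<in> \<D>" "s' \<in> insert s S" "pt s' \<inter> h \<noteq> {}"
    show "pt s' \<subseteq> h"
    proof (cases "h = f \<union> f'")
      case True
      then show ?thesis using h p f f' C(4) by (cases "s' = s") (auto simp: Int_Un_distrib)
    next
      case False
      then have hC: "h \<in> \<C>" "h \<noteq> f" "h \<noteq> f'" using h(1) unfolding \<D>_def by auto
      then have "s' \<noteq> s" using h(3) p uniq[of h f p] uniq[of h f' p'] f f' by auto
      then show ?thesis using hC(1) h C(4) by auto
    qed
  qed
  show ?case using U ne dis closed card by blast
qed

text \<open>An abstract cell decomposition of a closed surface. A side lies between two tiles and
  joins two points, so it is an edge of the dual graph on the tiles as well as of the graph on the
  points. \<open>even_boundary\<close> is the statement modulo 2 that the boundary of a tile is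
  closed: on the way round it, membership in \<open>f\<close> changes an even number of times. The
  genus enters only through the lower bound 2 - 2g for the Euler characteristic.\<close>

locale tile_complex =
  fixes TT :: "'t set" and SS :: "'s set" and PP :: "'p set"
    and tl :: "'s \<Rightarrow> 't set" and pt :: "'s \<Rightarrow> 'p set" and g :: nat
  assumes finite: "finite TT" "finite SS" "finite PP"
    and tl: "s \<in> SS \<Longrightarrow> tl s \<subseteq> TT \<and> card (tl s) = 2"
    and pt: "s \<in> SS \<Longrightarrow> pt s \<subseteq> PP \<and> card (pt s) = 2"
    and even_boundary: "x \<in> TT \<Longrightarrow> f \<subseteq> PP \<Longrightarrow> even (card {s\<in>SS. x \<in> tl s \<and> card (pt s \<inter> f) = 1})"
    and points_connected: "f \<subseteq> PP \<Longrightarrow> f \<noteq> {} \<Longrightarrow> f \<noteq> PP \<Longrightarrow> \<exists>s\<in>SS. card (pt s \<inter> f) = 1"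
    and tiles_connected: "D \<subseteq> TT \<Longrightarrow> D \<noteq> {} \<Longrightarrow> D \<noteq> TT \<Longrightarrow> \<exists>s\<in>SS. \<exists>x\<in>D. \<exists>y\<in>TT - D. tl s = {x, y}"
    and euler: "card SS + 2 \<le> card TT + card PP + 2 * g"
begin

text \<open>Connectedness in the dual graph in terms of cuts, the form in which it is used: a
  labelled part of \<open>Z\<close> that is not yet everything has a side leaving it inside
  \<open>Z\<close>.\<close>

definition tile_connected :: "'t set \<Rightarrow> bool" where
  "tile_connected Z \<longleftrightarrow> (\<forall>D\<subseteq>Z. D \<noteq> {} \<longrightarrow> D \<noteq> Z \<longrightarrow> (\<exists>s\<in>SS. \<exists>x\<in>D. \<exists>y\<in>Z - D. tl s = {x, y}))"

text \<open>Acyclicity modulo 2: no nonempty subset of \<open>T\<close> is an even subgraph of the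
  dual graph. It can be played off against \<open>even_boundary\<close> directly, without extracting
  a cycle.\<close>

definition side_forest :: "'s set \<Rightarrow> bool" where
  "side_forest T \<longleftrightarrow> (\<forall>K\<subseteq>T. K \<noteq> {} \<longrightarrow> (\<exists>x. odd (card {s\<in>K. x \<in> tl s})))"

text \<open>A partial colouring of the tiles by vertices with a forest of sides inside the colour
  classes. The cardinality condition says that the forest has as many components as there are
  vertices in \<open>V\<close>.\<close>

definition labelling :: "'v set \<Rightarrow> ('t \<Rightarrow> 'v \<Rightarrow> bool) \<Rightarrow> 't set \<Rightarrow> ('t \<Rightarrow> 'v) \<Rightarrow> 's set \<Rightarrow> bool" where
  "labelling V allowed D l T \<longleftrightarrow> D \<subseteq> TT \<and> T \<subseteq> SS \<and> side_forest T \<and> card T + card V = card D \<and>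
     (\<forall>s\<in>T. \<exists>x\<in>D. \<exists>y\<in>D. tl s = {x, y} \<and> l x = l y) \<and> (\<forall>x\<in>D. l x \<in> V \<and> allowed x (l x))"

text \<open>The added tile is a leaf: \<open>s\<close> is the only side of the new forest at
  \<open>y\<close>, so any set of forest sides containing \<open>s\<close> has degree 1 at
  \<open>y\<close>.\<close>

lemma labelling_extend:
  assumes L: "labelling V allowed D l T"
    and x: "x \<in> D" and y: "y \<in> TT - D" and s: "s \<in> SS" "tl s = {x, y}" and ok: "allowed y (l x)"
  shows "labelling V allowed (insert y D) (l(y := l x)) (insert s T)"
proof -
  have D: "D \<subseteq> TT" "finite D" and T: "T \<subseteq> SS" "finite T"
    using L finite finite_subset unfolding labelling_def by blast+
  have T_in: "tl s' \<subseteq> D" if "s' \<in> T" for s' using L that unfolding labelling_def by fastforce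
  have sT: "s \<notin> T" using T_in[of s] s y by auto
  have "side_forest (insert s T)"
    unfolding side_forest_def
  proof (intro allI impI)
    fix K assume K: "K \<subseteq> insert s T" "K \<noteq> {}"
    show "\<exists>x. odd (card {s\<in>K. x \<in> tl s})"
    proof (cases "s \<in> K")
      case True
      have "{s'\<in>K. y \<in> tl s'} = {s}" using True K(1) T_in s y by auto
      then have "card {s'\<in>K. y \<in> tl s'} = 1" by simp
      then show ?thesis by (intro exI[of _ y]) simp
    next
      case False
      then have "K \<subseteq> T" using K by auto
      then show ?thesis using L K(2) unfolding labelling_def side_forest_def by blast
    qed
  qed
  moreover have "\<forall>s'\<in>insert s T. \<exists>a\<in>insert y D. \<exists>b\<in>insert y D. tl s' = {a, b} \<and> (l(y := l x)) a = (l(y := l x)) b"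
  proof
    fix s' assume "s' \<in> insert s T"
    then consider "s' = s" | "s' \<in> T" by auto
    then show "\<exists>a\<in>insert y D. \<exists>b\<in>insert y D. tl s' = {a, b} \<and> (l(y := l x)) a = (l(y := l x)) b"
    proof cases
      case 1
      then show ?thesis using x y s by (intro bexI[of _ x] bexI[of _ y]) auto
    next
      case 2
      then obtain a b where ab: "a \<in> D" "b \<in> D" "tl s' = {a, b}" "l a = l b"
        using L unfolding labelling_def by blast
      then have "a \<noteq> y" "b \<noteq> y" using y by auto
      then show ?thesis using ab by (intro bexI[of _ a] bexI[of _ b]) auto
    qed
  qed
  moreover have "\<forall>z\<in>insert y D. (l(y := l x)) z \<in> V \<and> allowed z ((l(y := l x)) z)"
    using L x y ok unfolding labelling_def by auto
  moreover have "card (insert s T) + card V = card (insert y D)"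
    using L sT y D T unfolding labelling_def by simp
  ultimately show ?thesis using D T s y unfolding labelling_def by auto
qed

text \<open>A labelling of largest domain among those containing the representatives
  \<open>r v\<close>; these alone, as one-tile trees, form the initial labelling.\<close>

lemma saturated_labelling:
  assumes V: "finite V" and r: "inj_on r V" "r ` V \<subseteq> TT" and ok: "\<And>v. v \<in> V \<Longrightarrow> allowed (r v) v"
  obtains D l T where "labelling V allowed D l T" "r ` V \<subseteq> D"
    "\<And>x y s. x \<in> D \<Longrightarrow> y \<in> TT - D \<Longrightarrow> s \<in> SS \<Longrightarrow> tl s = {x, y} \<Longrightarrow> \<not> allowed y (l x)"
proof -
  have init: "labelling V allowed (r ` V) (the_inv_into V r) {}"
    using r ok the_inv_into_f_f[OF r(1)] unfolding labelling_def side_forest_def by (auto simp: card_image)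
  define Q where "Q m \<longleftrightarrow> (\<exists>D l T. labelling V allowed D l T \<and> r ` V \<subseteq> D \<and> card D = m)" for m
  have "Q (card (r ` V))" unfolding Q_def using init by blast
  moreover have "\<forall>m. Q m \<longrightarrow> m \<le> card TT"
    unfolding Q_def labelling_def using finite(1) card_mono by blast
  ultimately have "\<exists>m. Q m \<and> (\<forall>m'. Q m' \<longrightarrow> m' \<le> m)" by (rule Nat.ex_has_greatest_nat)
  then obtain m where "Q m" and max: "\<And>m'. Q m' \<Longrightarrow> m' \<le> m" by blast
  then obtain D l T where L: "labelling V allowed D l T" "r ` V \<subseteq> D" "card D = m" unfolding Q_def by blast
  show thesis
  proof (rule that[OF L(1,2)])
    fix x y s assume xy: "x \<in> D" "y \<in> TT - D" "s \<in> SS" "tl s = {x, y}"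
    show "\<not> allowed y (l x)"
    proof
      assume "allowed y (l x)"
      from labelling_extend[OF L(1) xy this] have "Q (card (insert y D))"
        unfolding Q_def using L(2) by (intro exI conjI) auto
      moreover have "finite D" using L(1) finite(1) finite_subset unfolding labelling_def by blast
      ultimately show False using max[of "card (insert y D)"] L(3) xy(2) by simp
    qed
  qed
qed

end

lemma card_ge_3I:
  assumes "finite J" "a \<in> J" "b \<in> J" "c \<in> J" "a \<noteq> b" "a \<noteq> c" "b \<noteq> c"
  shows "3 \<le> card J"
proof -
  have "card {a, b, c} \<le> card J" using assms by (intro card_mono) auto
  then show ?thesis using assms by simp
qed

text \<open>A nonempty even subgraph of a simple graph contains a cycle, hence three edges.\<close>

lemma even_subgraph_card_ge_3:
  assumes fin: "finite J" and two: "\<And>e. e \<in> J \<Longrightarrow> card e = 2" and ne: "J \<noteq> {}"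
    and even: "\<And>v. even (card {e\<in>J. v \<in> e})"
  shows "3 \<le> card J"
proof -
  obtain e where e: "e \<in> J" using ne by auto
  obtain u v where uv: "e = {u, v}" "u \<noteq> v" using two[OF e] by (auto simp: card_2_iff)
  have other: "\<exists>e'\<in>J. e' \<noteq> e \<and> w \<in> e'" if "w \<in> e" for w
  proof (rule ccontr)
    assume "\<not> ?thesis"
    then have "{e\<in>J. w \<in> e} = {e}" using e that by auto
    then have "card {e\<in>J. w \<in> e} = 1" by simp
    then show False using even[of w] by simp
  qed
  obtain e1 where e1: "e1 \<in> J" "e1 \<noteq> e" "u \<in> e1" using other[of u] uv by auto
  obtain e2 where e2: "e2 \<in> J" "e2 \<noteq> e" "v \<in> e2" using other[of v] uv by auto
  have "e1 \<noteq> e2"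
  proof
    assume "e1 = e2"
    then have "{u, v} \<subseteq> e1" using e1 e2 by auto
    moreover have "finite e1" "card e1 = 2" using two[OF e1(1)] card.infinite by fastforce+
    ultimately have "{u, v} = e1" using card_subset_eq[of e1 "{u, v}"] uv(2) by auto
    then show False using e1 uv by auto
  qed
  then show ?thesis using card_ge_3I[OF fin e e1(1) e2(1)] e1 e2 by auto
qed

context tile_complex
begin

text \<open>The tile set is coloured by the vertices, with a spanning tree inside every colour class;
  contracting the trees leaves the graph. The faces are the components of the point set after
  removing the tree sides and one side per edge.\<close>

lemma euler_bound_of_labelling:
  assumes G: "sgraph V G" and L: "labelling V allowed TT l T"
    and eps: "\<And>e. e \<in> G \<Longrightarrow> eps e \<in> SS \<and> l ` tl (eps e) = e" and V3: "3 \<le> card V"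
  shows "card G + 6 \<le> 3 * card V + 6 * g"
proof -
  have fG: "finite G" by (rule finite_edges[OF G])
  have two: "card e = 2" if "e \<in> G" for e using card_edge_eq_2[OF G that] .
  have T: "T \<subseteq> SS" "side_forest T" "card T + card V = card TT"
    and mono: "\<And>s. s \<in> T \<Longrightarrow> \<exists>x\<in>TT. \<exists>y\<in>TT. tl s = {x, y} \<and> l x = l y"
    using L unfolding labelling_def by blast+
  have fT: "finite T" using T(1) finite(2) finite_subset by blast
  have card_tl: "card (tl s) = 2" "tl s \<subseteq> TT" if "s \<in> SS" for s using tl[OF that] by auto
  have inj: "inj_on eps G" using eps by (metis inj_onI)
  have T_not_eps: "T \<inter> eps ` G = {}"
  proof -
    have False if e: "e \<in> G" "eps e \<in> T" for e
    proof -
      obtain x y where "tl (eps e) = {x, y}" "l x = l y" using mono[OF e(2)] by blast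
      then have "e = {l x}" using eps[OF e(1)] by auto
      then show False using two[OF e(1)] by simp
    qed
    then show ?thesis by auto
  qed
  define H where "H = T \<union> eps ` G"
  have H: "H \<subseteq> SS" unfolding H_def using T(1) eps by auto
  have cardH: "card H = card T + card G"
    unfolding H_def using card_Un_disjoint[OF fT _ T_not_eps] fG card_image[OF inj] by simp
  have "\<exists>\<C>. \<Union>\<C> = PP \<and> {} \<notin> \<C> \<and> disjoint \<C> \<and> (\<forall>f\<in>\<C>. \<forall>s\<in>SS - H. pt s \<inter> f \<noteq> {} \<longrightarrow> pt s \<subseteq> f)
      \<and> card PP \<le> card \<C> + card (SS - H)"
  proof (rule partition_by_edges)
    fix s assume "s \<in> SS - H"
    then have "pt s \<subseteq> PP" "card (pt s) = 2" using pt by auto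
    then show "\<exists>p p'. pt s = {p, p'} \<and> {p, p'} \<subseteq> PP" unfolding card_2_iff by auto
  qed (use finite in auto)
  then obtain \<C> where C: "\<Union>\<C> = PP" "{} \<notin> \<C>" "disjoint \<C>"
    and closed: "\<And>f s. f \<in> \<C> \<Longrightarrow> s \<in> SS - H \<Longrightarrow> pt s \<inter> f \<noteq> {} \<Longrightarrow> pt s \<subseteq> f"
    and cardC: "card PP \<le> card \<C> + card (SS - H)" by metis
  have fC: "finite \<C>" using C(1) finite(3) finite_UnionD by metis
  have cardSH: "card (SS - H) + card H = card SS"
    using card_Diff_subset[OF finite_subset[OF H finite(2)] H] card_mono[OF finite(2) H] by simp
  \<comment> \<open>As card T = card TT - card V, the tiles cancel, and what remains is the Euler
    inequality of the contracted graph with the faces \<C>.\<close>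
  have euler': "2 + card G \<le> card \<C> + card V + 2 * g"
    using cardC cardSH cardH T(3) euler by linarith
  show ?thesis
  proof (cases "2 \<le> card \<C>")
    \<comment> \<open>With at most one face there are at most card V + 2g - 1 edges, and card V
      \<ge> 3 suffices.\<close>
    case False
    then show ?thesis using euler' V3 by linarith
  next
    case True
    \<comment> \<open>The boundary of a face; \<open>J f\<close> collects the graph edges whose
      chosen side lies on it.\<close>
    define bd where "bd f = {s\<in>SS. card (pt s \<inter> f) = 1}" for f
    define J where "J f = {e\<in>G. eps e \<in> bd f}" for f
    have fd: "finite (bd f)" for f unfolding bd_def using finite(2) by simp
    have fsub: "f \<subseteq> PP" if "f \<in> \<C>" for f using that C(1) by auto
    have d_sub: "bd f \<subseteq> H" if f: "f \<in> \<C>" for f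
    proof
      fix s assume s: "s \<in> bd f"
      show "s \<in> H"
      proof (rule ccontr)
        assume "s \<notin> H"
        then have sS: "s \<in> SS - H" using s unfolding bd_def by auto
        have c1: "card (pt s \<inter> f) = 1" using s unfolding bd_def by auto
        then have "pt s \<inter> f \<noteq> {}" by auto
        then have sub: "pt s \<subseteq> f" by (rule closed[OF f sS])
        have "pt s \<inter> f = pt s" using sub by auto
        then show False using c1 pt[of s] sS by simp
      qed
    qed
    have J3: "3 \<le> card (J f)" if f: "f \<in> \<C>" for f
    proof (rule even_subgraph_card_ge_3)
      show "finite (J f)" unfolding J_def using fG by simp
      show "card e = 2" if "e \<in> J f" for e using that two unfolding J_def by simp
      have ev: "even (card {s\<in>bd f. x \<in> tl s})" for x
      proof (cases "x \<in> TT")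
        case True
        have "{s\<in>bd f. x \<in> tl s} = {s\<in>SS. x \<in> tl s \<and> card (pt s \<inter> f) = 1}" unfolding bd_def by auto
        then show ?thesis using even_boundary[OF True fsub[OF f]] by simp
      next
        case False
        then have "{s\<in>bd f. x \<in> tl s} = {}" using tl unfolding bd_def by blast
        then have "card {s\<in>bd f. x \<in> tl s} = 0" by (simp only: card.empty)
        then show ?thesis by simp
      qed
      \<comment> \<open>If no graph edge bounded \<open>f\<close>, the boundary of \<open>f\<close>
        would be an even subset of the forest \<open>T\<close>, hence empty, against the
        connectedness of the points.\<close>
      show "J f \<noteq> {}"
      proof
        assume "J f = {}"
        then have "bd f \<subseteq> T" using d_sub[OF f] unfolding H_def J_def by auto
        moreover have "bd f \<noteq> {}"
        proof -
          have "f \<noteq> {}" using f C(2) by auto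
          moreover have "f \<noteq> PP"
          proof
            assume "f = PP"
            have "\<C> \<subseteq> {f}"
            proof
              fix h assume h: "h \<in> \<C>"
              show "h \<in> {f}"
              proof (rule ccontr)
                assume "h \<notin> {f}"
                then have "h \<inter> f = {}" using C(3) h f unfolding disjoint_def by auto
                moreover have "h \<subseteq> f" using fsub[OF h] \<open>f = PP\<close> by simp
                ultimately have "h = {}" by auto
                then show False using h C(2) by simp
              qed
            qed
            then have "card \<C> \<le> card {f}" by (intro card_mono) auto
            then show False using \<open>2 \<le> card \<C>\<close> by simp
          qed
          ultimately show ?thesis using points_connected[OF fsub[OF f]] unfolding bd_def by blast
        qed
        ultimately obtain x where "odd (card {s\<in>bd f. x \<in> tl s})"
          using T(2) unfolding side_forest_def by blast
        then show False using ev by simp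
      qed
      \<comment> \<open>The degrees in \<open>bd f\<close> are summed over the tiles of colour
        \<open>v\<close>: a tree side contributes 0 or 2, the side of a graph edge contributes 1
        exactly if \<open>v\<close> is one of its ends. So the parity at the tiles descends to the
        vertices.\<close>
      show "even (card {e\<in>J f. v \<in> e})" for v
      proof -
        define X where "X = {x\<in>TT. l x = v}"
        have fX: "finite X" unfolding X_def using finite(1) by simp
        have "even (\<Sum>x\<in>X. card {s\<in>bd f. x \<in> tl s})" using ev by (intro dvd_sum) auto
        also have "(\<Sum>x\<in>X. card {s\<in>bd f. x \<in> tl s}) = (\<Sum>s\<in>bd f. card {x\<in>X. x \<in> tl s})"
          by (rule sum_multicount_gen) (use fX fd in auto)
        also have "\<dots> = (\<Sum>s\<in>bd f \<inter> T. card {x\<in>X. x \<in> tl s}) + (\<Sum>s\<in>bd f - T. card {x\<in>X. x \<in> tl s})"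
          using sum.Int_Diff[OF fd] by blast
        finally have e1: "even ((\<Sum>s\<in>bd f \<inter> T. card {x\<in>X. x \<in> tl s}) + (\<Sum>s\<in>bd f - T. card {x\<in>X. x \<in> tl s}))" .
        have "even (\<Sum>s\<in>bd f \<inter> T. card {x\<in>X. x \<in> tl s})"
        proof (intro dvd_sum)
          fix s assume "s \<in> bd f \<inter> T"
          then have sT: "s \<in> T" by simp
          obtain x y where xy: "x \<in> TT" "y \<in> TT" "tl s = {x, y}" "l x = l y" using mono[OF sT] by blast
          have c2: "card (tl s) = 2" using card_tl(1) T(1) sT by blast
          have "{x\<in>X. x \<in> tl s} = (if l x = v then tl s else {})" unfolding X_def using xy by auto
          then show "even (card {x\<in>X. x \<in> tl s})" using c2 by simp
        qed
        then have e2: "even (\<Sum>s\<in>bd f - T. card {x\<in>X. x \<in> tl s})" using e1 by simp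
        have im: "bd f - T = eps ` J f"
        proof
          show "bd f - T \<subseteq> eps ` J f" using d_sub[OF f] unfolding H_def J_def by blast
          show "eps ` J f \<subseteq> bd f - T" using T_not_eps unfolding J_def by blast
        qed
        have injJ: "inj_on eps (J f)" by (rule inj_on_subset[OF inj]) (auto simp: J_def)
        have "(\<Sum>s\<in>bd f - T. card {x\<in>X. x \<in> tl s}) = (\<Sum>e\<in>J f. card {x\<in>X. x \<in> tl (eps e)})"
          unfolding im using sum.reindex[OF injJ] by simp
        also have "\<dots> = (\<Sum>e\<in>J f. if v \<in> e then 1 else 0)"
        proof (rule sum.cong[OF refl])
          fix e assume "e \<in> J f"
          then have e: "e \<in> G" unfolding J_def by simp
          have s: "eps e \<in> SS" "l ` tl (eps e) = e" using eps[OF e] by auto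
          obtain x y where xy: "tl (eps e) = {x, y}" "x \<noteq> y" using card_tl(1)[OF s(1)] unfolding card_2_iff by blast
          have TTxy: "x \<in> TT" "y \<in> TT" using card_tl(2)[OF s(1)] xy by auto
          have ee: "e = {l x, l y}" using s(2) xy by auto
          have ne: "l x \<noteq> l y" using two[OF e] ee by auto
          have "{z\<in>X. z \<in> tl (eps e)} = (if l x = v then {x} else if l y = v then {y} else {})"
            unfolding X_def xy(1) using TTxy ne by auto
          then show "card {z\<in>X. z \<in> tl (eps e)} = (if v \<in> e then 1 else 0)" unfolding ee by auto
        qed
        also have "\<dots> = card {e\<in>J f. v \<in> e}"
          using fG by (simp add: sum.inter_filter[symmetric] J_def)
        finally show ?thesis using e2 by simp
      qed
    qed
    \<comment> \<open>Double counting of incident faces and edges: a side has only two end points,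
      so its edge bounds at most two faces.\<close>
    have "3 * card \<C> = (\<Sum>f\<in>\<C>. 3)" by simp
    also have "\<dots> \<le> (\<Sum>f\<in>\<C>. card (J f))" by (intro sum_mono J3)
    also have "\<dots> = (\<Sum>e\<in>G. card {f\<in>\<C>. eps e \<in> bd f})"
      unfolding J_def by (rule sum_multicount_gen[symmetric]) (use fG fC in auto)
    also have "\<dots> \<le> (\<Sum>e\<in>G. 2)"
    proof (rule sum_mono)
      fix e assume e: "e \<in> G"
      have pt2: "card (pt (eps e)) = 2" "pt (eps e) \<subseteq> PP" using pt eps[OF e] by auto
      have fin: "finite (pt (eps e))" using pt2(2) finite(3) finite_subset by blast
      define h where "h p = (SOME f. f \<in> \<C> \<and> p \<in> f)" for p
      have uniq: "h p = f" if "f \<in> \<C>" "p \<in> f" for f p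
      proof -
        have "h p \<in> \<C> \<and> p \<in> h p" unfolding h_def by (rule someI[of _ f]) (use that in auto)
        then show ?thesis using C(3) that unfolding disjoint_def by (metis IntI empty_iff)
      qed
      have "{f\<in>\<C>. eps e \<in> bd f} \<subseteq> h ` pt (eps e)"
      proof
        fix f assume f: "f \<in> {f\<in>\<C>. eps e \<in> bd f}"
        then have "card (pt (eps e) \<inter> f) = 1" unfolding bd_def by simp
        then have "pt (eps e) \<inter> f \<noteq> {}" by auto
        then obtain p where "p \<in> pt (eps e)" "p \<in> f" by auto
        then show "f \<in> h ` pt (eps e)" using uniq[of f p] f by auto
      qed
      then have "card {f\<in>\<C>. eps e \<in> bd f} \<le> card (h ` pt (eps e))" using fin by (intro card_mono) auto
      also have "\<dots> \<le> 2" using card_image_le[OF fin, of h] pt2 by simp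
      finally show "card {f\<in>\<C>. eps e \<in> bd f} \<le> 2" .
    qed
    finally have "3 * card \<C> \<le> 2 * card G" by simp
    then show ?thesis using euler' by linarith
  qed
qed

text \<open>The combinatorial shadow of an embedding: vertices become disjoint connected regions,
  and the region of an edge touches exactly those of its ends. A maximal labelling compatible with
  the regions fills the \<open>Y v\<close>, then the \<open>M e\<close>, then everything. Inside
  \<open>M e\<close> exactly the two ends of \<open>e\<close> occur as labels, so a side there
  separates them and can represent \<open>e\<close>.\<close>

lemma euler_bound_of_tile_model:
  assumes G: "sgraph V G" and V3: "3 \<le> card V"
    and Y: "\<And>v. v \<in> V \<Longrightarrow> Y v \<subseteq> TT" "\<And>v. v \<in> V \<Longrightarrow> Y v \<noteq> {}" "\<And>v. v \<in> V \<Longrightarrow> tile_connected (Y v)"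
      "\<And>u v. u \<in> V \<Longrightarrow> v \<in> V \<Longrightarrow> u \<noteq> v \<Longrightarrow> Y u \<inter> Y v = {}"
    and M: "\<And>e. e \<in> G \<Longrightarrow> M e \<subseteq> TT" "\<And>e. e \<in> G \<Longrightarrow> tile_connected (M e)"
      "\<And>e e'. e \<in> G \<Longrightarrow> e' \<in> G \<Longrightarrow> e \<noteq> e' \<Longrightarrow> M e \<inter> M e' = {}"
      "\<And>e v. e \<in> G \<Longrightarrow> v \<in> V \<Longrightarrow> M e \<inter> Y v \<noteq> {} \<longleftrightarrow> v \<in> e"
  shows "card G + 6 \<le> 3 * card V + 6 * g"
proof -
  have fV: "finite V" using G unfolding sgraph_def by simp
  have inV: "e \<subseteq> V" if "e \<in> G" for e using G that unfolding sgraph_def by simp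
  define allowed where "allowed x v \<longleftrightarrow> (\<forall>w\<in>V. x \<in> Y w \<longrightarrow> w = v) \<and> (\<forall>e\<in>G. x \<in> M e \<longrightarrow> v \<in> e)" for x v
  define r where "r v = (SOME x. x \<in> Y v)" for v
  have r: "r v \<in> Y v" if "v \<in> V" for v unfolding r_def using Y(2)[OF that] by (simp add: some_in_eq)
  have inj: "inj_on r V"
  proof (rule inj_onI)
    fix u v assume uv: "u \<in> V" "v \<in> V" "r u = r v"
    then show "u = v" using Y(4)[of u v] r[of u] r[of v] by auto
  qed
  have rTT: "r ` V \<subseteq> TT" using r Y(1) by auto
  have Y_allowed: "allowed x v" if "v \<in> V" "x \<in> Y v" for x v
    unfolding allowed_def
  proof (intro conjI ballI impI)
    show "w = v" if "w \<in> V" "x \<in> Y w" for w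
    proof (rule ccontr)
      assume "w \<noteq> v"
      then show False using Y(4)[of w v] that \<open>v \<in> V\<close> \<open>x \<in> Y v\<close> by auto
    qed
    show "v \<in> e" if "e \<in> G" "x \<in> M e" for e
    proof -
      have "M e \<inter> Y v \<noteq> {}" using that \<open>x \<in> Y v\<close> by auto
      then show ?thesis using M(4)[OF that(1) \<open>v \<in> V\<close>] by simp
    qed
  qed
  have r_allowed: "allowed (r v) v" if "v \<in> V" for v by (rule Y_allowed[OF that r[OF that]])
  obtain D l T where L: "labelling V allowed D l T" and rD: "r ` V \<subseteq> D"
    and sat: "\<And>x y s. x \<in> D \<Longrightarrow> y \<in> TT - D \<Longrightarrow> s \<in> SS \<Longrightarrow> tl s = {x, y} \<Longrightarrow> \<not> allowed y (l x)"
    by (rule saturated_labelling[of V r allowed, OF fV inj rTT r_allowed]) (assumption, rule that)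
  have D: "D \<subseteq> TT" "l x \<in> V \<and> allowed x (l x)" if "x \<in> D" for x
    using L that unfolding labelling_def by simp_all
  have D_TT: "D \<subseteq> TT" using L unfolding labelling_def by simp
  have lab_Y: "l x = v" if "x \<in> D" "v \<in> V" "x \<in> Y v" for x v
    using D(2)[OF that(1)] that unfolding allowed_def by blast
  have lab_M: "l x \<in> e" if "x \<in> D" "e \<in> G" "x \<in> M e" for x e
    using D(2)[OF that(1)] that unfolding allowed_def by blast
  \<comment> \<open>A connected set touched by the labelled part is swallowed by it as soon as
    labels may spread inside the set, since a side across the border would allow a larger
    labelling.\<close>
  have fill: "Z \<subseteq> D" if Z: "tile_connected Z" "Z \<subseteq> TT" "Z \<inter> D \<noteq> {}"
    and ok: "\<And>x y. x \<in> D \<inter> Z \<Longrightarrow> y \<in> Z - D \<Longrightarrow> allowed y (l x)" for Z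
  proof (rule ccontr)
    assume "\<not> Z \<subseteq> D"
    then have "Z \<inter> D \<subseteq> Z" "Z \<inter> D \<noteq> Z" by auto
    then obtain s x y where "s \<in> SS" "x \<in> Z \<inter> D" "y \<in> Z - (Z \<inter> D)" "tl s = {x, y}"
      using Z(1,3) unfolding tile_connected_def by metis
    then show False using sat[of x y s] ok[of x y] Z(2) by auto
  qed
  have YD: "Y v \<subseteq> D" if v: "v \<in> V" for v
  proof (rule fill[OF Y(3)[OF v] Y(1)[OF v]])
    show "Y v \<inter> D \<noteq> {}" using r[OF v] rD v by auto
    show "allowed y (l x)" if "x \<in> D \<inter> Y v" "y \<in> Y v - D" for x y
      using Y_allowed[OF v, of y] lab_Y[of x v] that v by simp
  qed
  have M_meets: "\<exists>x\<in>M e \<inter> Y v. l x = v \<and> x \<in> D" if "e \<in> G" "v \<in> e" for e v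
  proof -
    have v: "v \<in> V" using inV that by auto
    have "M e \<inter> Y v \<noteq> {}" using M(4)[OF that(1) v] that(2) by simp
    then obtain x where "x \<in> M e \<inter> Y v" by auto
    then show ?thesis using lab_Y[of x v] YD[OF v] v by auto
  qed
  have MD: "M e \<subseteq> D" if e: "e \<in> G" for e
  proof (rule fill[OF M(2)[OF e] M(1)[OF e]])
    obtain v where "v \<in> e" using card_edge_eq_2[OF G e] by fastforce
    then show "M e \<inter> D \<noteq> {}" using M_meets[OF e] by blast
    show "allowed y (l x)" if xy: "x \<in> D \<inter> M e" "y \<in> M e - D" for x y
      unfolding allowed_def
    proof (intro conjI ballI impI)
      show "w = l x" if "w \<in> V" "y \<in> Y w" for w using YD[OF that(1)] that(2) xy(2) by blast
      show "l x \<in> e'" if "e' \<in> G" "y \<in> M e'" for e'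
      proof -
        have "e' = e" using M(3)[OF e that(1)] that(2) xy(2) by blast
        then show ?thesis using lab_M[of x e] xy(1) e by simp
      qed
    qed
  qed
  \<comment> \<open>Tiles outside all regions accept every label, so connectedness of the whole
    complex carries the labelling to them.\<close>
  have "TT \<subseteq> D"
  proof (rule fill)
    show "tile_connected TT" unfolding tile_connected_def by (intro allI impI tiles_connected)
    have "V \<noteq> {}" using V3 by auto
    then obtain v where "v \<in> V" by blast
    then have "r v \<in> TT \<inter> D" using rD rTT by auto
    then show "TT \<inter> D \<noteq> {}" by auto
    show "allowed y (l x)" if "y \<in> TT - D" for x y
    proof -
      have "y \<notin> Y w" if "w \<in> V" for w using YD[OF that] \<open>y \<in> TT - D\<close> by auto
      moreover have "y \<notin> M e" if "e \<in> G" for e using MD[OF that] \<open>y \<in> TT - D\<close> by auto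
      ultimately show ?thesis unfolding allowed_def by simp
    qed
  qed simp
  then have DT: "D = TT" using D_TT by blast
  have "\<exists>s\<in>SS. l ` tl s = e" if e: "e \<in> G" for e
  proof -
    obtain u v where uv: "e = {u, v}" "u \<noteq> v" using card_edge_eq_2[OF G e] unfolding card_2_iff by blast
    define A where "A = {x\<in>M e. l x = u}"
    have "A \<subseteq> M e" unfolding A_def by auto
    moreover have "A \<noteq> {}" using M_meets[OF e, of u] uv unfolding A_def by auto
    moreover have "A \<noteq> M e" using M_meets[OF e, of v] uv unfolding A_def by auto
    ultimately obtain s x y where s: "s \<in> SS" "x \<in> A" "y \<in> M e - A" "tl s = {x, y}"
      using M(2)[OF e] unfolding tile_connected_def by metis
    have "l y \<in> e" using lab_M[of y e] MD[OF e] s(3) e by auto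
    then have "l x = u" "l y = v" using s(2,3) uv unfolding A_def by auto
    then show ?thesis using s uv by (intro bexI[of _ s]) auto
  qed
  then obtain eps where "\<And>e. e \<in> G \<Longrightarrow> eps e \<in> SS \<and> l ` tl (eps e) = e" by metis
  then show ?thesis by (rule euler_bound_of_labelling[OF G L[unfolded DT] _ V3])
qed

end

section \<open>Fine tilings\<close>

text \<open>Disjoint compact sets have positive distance, and there are only finitely many
  pairs.\<close>

lemma uniform_separation:
  fixes \<Z> :: "'b::heine_borel set set"
  assumes fin: "finite \<Z>" and compact: "\<And>Z. Z \<in> \<Z> \<Longrightarrow> compact Z"
  obtains \<delta> where "0 < \<delta>"
    "\<And>Z Z' x y. Z \<in> \<Z> \<Longrightarrow> Z' \<in> \<Z> \<Longrightarrow> Z \<inter> Z' = {} \<Longrightarrow> x \<in> Z \<Longrightarrow> y \<in> Z' \<Longrightarrow> \<delta> \<le> dist x y"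
proof -
  have "\<exists>d>0. Z \<inter> Z' = {} \<longrightarrow> (\<forall>x\<in>Z. \<forall>y\<in>Z'. d \<le> dist x y)" if "Z \<in> \<Z>" "Z' \<in> \<Z>" for Z Z'
  proof (cases "Z \<inter> Z' = {}")
    case True
    then show ?thesis
      using separate_compact_closed[OF compact[OF that(1)] compact_imp_closed[OF compact[OF that(2)]] True] by metis
  next
    case False
    then show ?thesis by (intro exI[of _ 1]) simp
  qed
  then obtain d where d: "\<And>Z Z'. Z \<in> \<Z> \<Longrightarrow> Z' \<in> \<Z> \<Longrightarrow> 0 < d Z Z'"
    "\<And>Z Z' x y. Z \<in> \<Z> \<Longrightarrow> Z' \<in> \<Z> \<Longrightarrow> Z \<inter> Z' = {} \<Longrightarrow> x \<in> Z \<Longrightarrow> y \<in> Z' \<Longrightarrow> d Z Z' \<le> dist x y"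
    by metis
  \<comment> \<open>The 1 keeps the minimum defined if there are no pairs.\<close>
  define \<delta> where "\<delta> = Min (insert 1 ((\<lambda>(Z, Z'). d Z Z') ` (\<Z> \<times> \<Z>)))"
  have fin': "finite (insert 1 ((\<lambda>(Z, Z'). d Z Z') ` (\<Z> \<times> \<Z>)))" using fin by simp
  show thesis
  proof (rule that[of \<delta>])
    show "0 < \<delta>" unfolding \<delta>_def using fin' d(1) by (subst Min_gr_iff) auto
    fix Z Z' x y assume z: "Z \<in> \<Z>" "Z' \<in> \<Z>" "Z \<inter> Z' = {}" "x \<in> Z" "y \<in> Z'"
    have "\<delta> \<le> d Z Z'" unfolding \<delta>_def using fin' z by (intro Min_le) auto
    then show "\<delta> \<le> dist x y" using d(2)[OF z] by linarith
  qed
qed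

text \<open>Compact pieces whose incidences survive a fine tiling. Whole edges would meet at common
  ends, so only middle parts represent edges, and the parts near the ends belong to the stars
  \<open>Y v\<close>.\<close>

definition star_pieces :: "'a set \<Rightarrow> 'a set set \<Rightarrow> 'b::topological_space set \<Rightarrow> ('a \<Rightarrow> 'b set) \<Rightarrow> ('a set \<Rightarrow> 'b set) \<Rightarrow> bool" where
  "star_pieces V G S Y M \<longleftrightarrow>
     (\<forall>v\<in>V. compact (Y v) \<and> connected (Y v) \<and> Y v \<noteq> {} \<and> Y v \<subseteq> S) \<and>
     (\<forall>e\<in>G. compact (M e) \<and> connected (M e) \<and> M e \<subseteq> S) \<and>
     (\<forall>u\<in>V. \<forall>v\<in>V. u \<noteq> v \<longrightarrow> Y u \<inter> Y v = {}) \<and>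
     (\<forall>e\<in>G. \<forall>e'\<in>G. e \<noteq> e' \<longrightarrow> M e \<inter> M e' = {}) \<and>
     (\<forall>e\<in>G. \<forall>v\<in>V. M e \<inter> Y v \<noteq> {} \<longleftrightarrow> v \<in> e)"

text \<open>Each edge is cut at the parameters 1/3 and 2/3. The star of \<open>v\<close> consists of
  \<open>v\<close> and the outer thirds at \<open>v\<close>; a middle third meets the stars of its
  ends in the cutting points. Distinct edges meet only in vertices, and these are reached only at
  the parameters 0 and 1.\<close>

lemma graph_embedding_star_pieces:
  fixes S :: "'b::t2_space set"
  assumes G: "sgraph V G" and emb: "graph_embedding V G S p \<gamma>"
  shows "\<exists>Y M. star_pieces V G S Y M"
proof -
  have inj: "inj_on p V" and pS: "p ` V \<subseteq> S"
    using emb unfolding graph_embedding_def by auto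
  have \<gamma>: "arc (\<gamma> e)" "path_image (\<gamma> e) \<subseteq> S" "{\<gamma> e 0, \<gamma> e 1} = p ` e" "path_image (\<gamma> e) \<inter> p ` V = p ` e"
    if "e \<in> G" for e
    using emb that unfolding graph_embedding_def pathstart_def pathfinish_def by auto
  have cross: "path_image (\<gamma> e) \<inter> path_image (\<gamma> e') \<subseteq> p ` V" if "e \<in> G" "e' \<in> G" "e \<noteq> e'" for e e'
  proof -
    have "path_image (\<gamma> e) \<inter> path_image (\<gamma> e') = p ` (e \<inter> e')"
      using emb that unfolding graph_embedding_def by blast
    moreover have "e \<inter> e' \<subseteq> V" using G that unfolding sgraph_def by auto
    ultimately show ?thesis by auto
  qed
  have eV: "e \<subseteq> V" if "e \<in> G" for e using G that unfolding sgraph_def by auto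
  have \<gamma>inj: "s = t" if "e \<in> G" "s \<in> {0..1}" "t \<in> {0..1}" "\<gamma> e s = \<gamma> e t" for e s t
    using \<gamma>(1)[OF that(1)] that unfolding arc_def inj_on_def by blast
  have cont: "continuous_on {0..1} (\<gamma> e)" if "e \<in> G" for e
    using \<gamma>(1)[OF that] unfolding arc_def path_def by simp
  \<comment> \<open>The outer third at the end \<open>v\<close>; for \<open>v\<close> in
    \<open>e\<close>, exactly one of the parameters 0 and 1 is mapped to \<open>p v\<close>.\<close>
  define I where "I e v = (if \<gamma> e 0 = p v then {0..1/3} else {2/3..1 :: real})" for e v
  define seg where "seg e v = \<gamma> e ` I e v" for e v
  define M where "M e = \<gamma> e ` {1/3..2/3}" for e
  define Y where "Y v = insert (p v) (\<Union>e\<in>{e\<in>G. v \<in> e}. seg e v)" for v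
  have I01: "I e v \<subseteq> {0..1}" for e v unfolding I_def by auto
  have fG: "finite G" by (rule finite_edges[OF G])
  have seg_sub: "seg e v \<subseteq> path_image (\<gamma> e)" for e v
    unfolding seg_def path_image_def using I01 by auto
  have M_sub: "M e \<subseteq> path_image (\<gamma> e)" for e unfolding M_def path_image_def by auto
  have seg_top: "compact (seg e v)" "connected (seg e v)" if "e \<in> G" for e v
  proof -
    have "continuous_on (I e v) (\<gamma> e)" using continuous_on_subset[OF cont[OF that] I01] .
    then show "compact (seg e v)" "connected (seg e v)" unfolding seg_def
      by (auto intro!: compact_continuous_image connected_continuous_image simp: I_def)
  qed
  have M_top: "compact (M e)" "connected (M e)" if "e \<in> G" for e
  proof -
    have "continuous_on {1/3..2/3} (\<gamma> e)" by (rule continuous_on_subset[OF cont[OF that]]) auto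
    then show "compact (M e)" "connected (M e)" unfolding M_def
      by (auto intro!: compact_continuous_image connected_continuous_image)
  qed
  have ends: "t = 0 \<or> t = 1" if "e \<in> G" "t \<in> {0..1}" "\<gamma> e t \<in> p ` V" for e t
  proof -
    have "\<gamma> e t \<in> {\<gamma> e 0, \<gamma> e 1}"
      using \<gamma>(3,4)[OF that(1)] that unfolding path_image_def by blast
    then show ?thesis using \<gamma>inj[OF that(1,2), of 0] \<gamma>inj[OF that(1,2), of 1] by auto
  qed
  have M_V: "M e \<inter> p ` V = {}" if "e \<in> G" for e
  proof -
    have *: False if "t \<in> {1/3..2/3}" "\<gamma> e t \<in> p ` V" for t
      using ends[OF \<open>e \<in> G\<close>, of t] that by auto
    show ?thesis
    proof (rule equals0I)
      fix x assume "x \<in> M e \<inter> p ` V"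
      then obtain t where "t \<in> {1/3..2/3}" "x = \<gamma> e t" "x \<in> p ` V" unfolding M_def by blast
      then show False using *[of t] by simp
    qed
  qed
  have end_v: "\<gamma> e 0 = p v \<or> \<gamma> e 1 = p v" if "e \<in> G" "v \<in> e" for e v
    using \<gamma>(3)[OF that(1)] that(2) by (metis imageI insertE singletonD)
  have p_seg: "p v \<in> seg e v" if "e \<in> G" "v \<in> e" for e v
  proof (cases "\<gamma> e 0 = p v")
    case True
    then show ?thesis unfolding seg_def I_def by (intro image_eqI[of _ _ 0]) auto
  next
    case False
    then show ?thesis unfolding seg_def I_def using end_v[OF that] by (intro image_eqI[of _ _ 1]) auto
  qed
  have seg_V: "x = p v" if "e \<in> G" "v \<in> e" "x \<in> seg e v" "x \<in> p ` V" for x e v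
  proof -
    from that(3) obtain t where t: "t \<in> I e v" "x = \<gamma> e t" unfolding seg_def by auto
    then have "t \<in> {0..1}" using I01 by blast
    moreover have "\<gamma> e t \<in> p ` V" using that(4) t(2) by simp
    ultimately have "t = 0 \<or> t = 1" by (rule ends[OF that(1)])
    then show ?thesis using t end_v[OF that(1,2)] unfolding I_def by (auto split: if_splits)
  qed
  have seg_seg: "seg e v \<inter> seg e w = {}" if "e \<in> G" "v \<in> e" "w \<in> e" "v \<noteq> w" for e v w
  proof -
    have pne: "p v \<noteq> p w" using inj eV[OF that(1)] that unfolding inj_on_def by blast
    have "(\<gamma> e 0 = p v) \<noteq> (\<gamma> e 0 = p w)"
      using end_v[OF that(1,2)] end_v[OF that(1,3)] pne by metis
    then have d: "I e v \<inter> I e w = {}" unfolding I_def by auto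
    show ?thesis
    proof (rule ccontr)
      assume "seg e v \<inter> seg e w \<noteq> {}"
      then obtain s t where st: "s \<in> I e v" "t \<in> I e w" "\<gamma> e s = \<gamma> e t" unfolding seg_def by auto
      then have "s = t" using \<gamma>inj[OF that(1), of s t] I01 by blast
      then show False using st d by auto
    qed
  qed
  have "compact (Y v)" for v
    unfolding Y_def using fG seg_top(1) by (intro compact_insert compact_UN) auto
  moreover have "connected (Y v)" for v
  proof -
    have "connected (\<Union>(insert {p v} ((\<lambda>e. seg e v) ` {e\<in>G. v \<in> e})))"
      by (rule connected_Union) (use seg_top(2) p_seg in auto)
    moreover have "\<Union>(insert {p v} ((\<lambda>e. seg e v) ` {e\<in>G. v \<in> e})) = Y v" unfolding Y_def by auto
    ultimately show ?thesis by simp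
  qed
  moreover have "Y v \<noteq> {}" for v unfolding Y_def by simp
  moreover have "Y v \<subseteq> S" if "v \<in> V" for v
    unfolding Y_def using seg_sub \<gamma>(2) pS that by blast
  moreover have "M e \<subseteq> S" if "e \<in> G" for e using M_sub \<gamma>(2)[OF that] by blast
  moreover have "Y u \<inter> Y v = {}" if uv: "u \<in> V" "v \<in> V" "u \<noteq> v" for u v
  proof -
    have pne: "p u \<noteq> p v" using inj uv unfolding inj_on_def by blast
    have 1: "p a \<notin> seg e b" if "e \<in> G" "b \<in> e" "a \<in> V" "p a \<noteq> p b" for a b e
      using seg_V[OF that(1,2), of "p a"] that by auto
    have 2: "seg e u \<inter> seg e' v = {}" if "e \<in> G" "u \<in> e" "e' \<in> G" "v \<in> e'" for e e'
    proof (cases "e = e'")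
      case True
      then show ?thesis using seg_seg[OF that(1,2)] that uv(3) by simp
    next
      case False
      show ?thesis
      proof (rule ccontr)
        assume "seg e u \<inter> seg e' v \<noteq> {}"
        then obtain x where x: "x \<in> seg e u" "x \<in> seg e' v" by auto
        then have "x \<in> p ` V" using cross[OF that(1,3) False] seg_sub by blast
        then have "x = p u" "x = p v" using seg_V that x by blast+
        then show False using pne by simp
      qed
    qed
    show ?thesis
    proof (rule ccontr)
      assume "Y u \<inter> Y v \<noteq> {}"
      then obtain x where x: "x \<in> Y u" "x \<in> Y v" by auto
      consider "x = p u" "x = p v" | e where "x = p u" "e \<in> G" "v \<in> e" "x \<in> seg e v"
        | e where "x = p v" "e \<in> G" "u \<in> e" "x \<in> seg e u"
        | e e' where "e \<in> G" "u \<in> e" "x \<in> seg e u" "e' \<in> G" "v \<in> e'" "x \<in> seg e' v"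
        using x unfolding Y_def by auto
      then show False
      proof cases
        case 1
        then show ?thesis using pne by simp
      next
        case (2 e)
        then show ?thesis using 1[of e v u] uv pne by simp
      next
        case (3 e)
        then show ?thesis using 1[of e u v] uv pne by simp
      next
        case (4 e e')
        then show ?thesis using 2[of e e'] by auto
      qed
    qed
  qed
  moreover have "M e \<inter> M e' = {}" if "e \<in> G" "e' \<in> G" "e \<noteq> e'" for e e'
    using cross[OF that] M_sub[of e] M_sub[of e'] M_V[OF that(1)] by blast
  moreover have "M e \<inter> Y v \<noteq> {} \<longleftrightarrow> v \<in> e" if ev: "e \<in> G" "v \<in> V" for e v
  proof
    assume "v \<in> e"
    have "\<gamma> e (1/3) \<in> M e" "\<gamma> e (2/3) \<in> M e" unfolding M_def by auto
    moreover have "\<gamma> e (1/3) \<in> seg e v \<or> \<gamma> e (2/3) \<in> seg e v" unfolding seg_def I_def by auto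
    ultimately show "M e \<inter> Y v \<noteq> {}" using ev(1) \<open>v \<in> e\<close> unfolding Y_def by blast
  next
    assume "M e \<inter> Y v \<noteq> {}"
    then obtain x where x: "x \<in> M e" "x \<in> Y v" by auto
    have "x \<notin> p ` V" using M_V[OF ev(1)] x(1) by auto
    then obtain e' where e': "e' \<in> G" "v \<in> e'" "x \<in> seg e' v" using x(2) ev(2) unfolding Y_def by auto
    have "e' = e"
    proof (rule ccontr)
      assume "e' \<noteq> e"
      then have "x \<in> p ` V" using cross[OF e'(1) ev(1)] seg_sub M_sub e'(3) x(1) by blast
      then show False using \<open>x \<notin> p ` V\<close> by simp
    qed
    then show "v \<in> e" using e' by simp
  qed
  ultimately have "star_pieces V G S Y M" unfolding star_pieces_def using M_top by auto
  then show ?thesis by blast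
qed

context tile_complex
begin

lemma tile_connectedD:
  "tile_connected Z \<Longrightarrow> D \<subseteq> Z \<Longrightarrow> D \<noteq> {} \<Longrightarrow> D \<noteq> Z \<Longrightarrow> \<exists>s\<in>SS. \<exists>x\<in>D. \<exists>y\<in>Z - D. tl s = {x, y}"
  unfolding tile_connected_def by simp

text \<open>For a cut of the tiles meeting \<open>Z\<close>, the unions of the tiles on both sides
  are closed and cover the connected \<open>Z\<close>, so they share a point z of \<open>Z\<close>.
  The tiles at z are connected among themselves, and a side between two of them crosses the
  cut.\<close>

lemma tile_connected_meeting:
  fixes A :: "'t \<Rightarrow> 'b::topological_space set"
  assumes closed: "\<And>x. x \<in> TT \<Longrightarrow> closed (A x)"
    and point: "\<And>p. p \<in> Z \<Longrightarrow> tile_connected {x\<in>TT. p \<in> A x}"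
    and cover: "Z \<subseteq> (\<Union>x\<in>TT. A x)" and Z: "connected Z"
  shows "tile_connected {x\<in>TT. A x \<inter> Z \<noteq> {}}"
  unfolding tile_connected_def
proof (intro allI impI)
  let ?X = "{x\<in>TT. A x \<inter> Z \<noteq> {}}"
  fix D assume D: "D \<subseteq> ?X" "D \<noteq> {}" "D \<noteq> ?X"
  define P where "P = (\<Union>x\<in>D. A x)"
  define Q where "Q = (\<Union>x\<in>?X - D. A x)"
  have fin: "finite D" "finite (?X - D)" using D(1) finite(1) finite_subset[of D TT] by auto
  have closedPQ: "closed P" "closed Q"
    unfolding P_def Q_def using fin closed D(1) by (auto intro!: closed_UN)
  have "Z \<subseteq> P \<union> Q"
  proof
    fix z assume z: "z \<in> Z"
    then obtain x where "x \<in> TT" "z \<in> A x" using cover by auto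
    then show "z \<in> P \<union> Q" unfolding P_def Q_def using z by (cases "x \<in> D") auto
  qed
  moreover have "P \<inter> Z \<noteq> {}" unfolding P_def using D(1,2) by auto
  moreover have "Q \<inter> Z \<noteq> {}" unfolding Q_def using D(1,3) by auto
  ultimately have "P \<inter> Q \<inter> Z \<noteq> {}" using Z closedPQ unfolding connected_closed by blast
  then obtain z where z: "z \<in> P" "z \<in> Q" "z \<in> Z" by auto
  let ?R = "{x\<in>TT. z \<in> A x}"
  have R: "tile_connected ?R" by (rule point[OF z(3)])
  have "D \<inter> ?R \<subseteq> ?R" by simp
  moreover have "D \<inter> ?R \<noteq> {}" using z(1) D(1) unfolding P_def by auto
  moreover have "D \<inter> ?R \<noteq> ?R" using z(2) unfolding Q_def by auto
  ultimately have "\<exists>s\<in>SS. \<exists>x\<in>D \<inter> ?R. \<exists>y\<in>?R - D \<inter> ?R. tl s = {x, y}"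
    by (rule tile_connectedD[OF R])
  then obtain s x y where s: "s \<in> SS" "x \<in> D \<inter> ?R" "y \<in> ?R - D \<inter> ?R" "tl s = {x, y}"
    by (elim bexE) (rule that)
  have "x \<in> D" using s(2) by simp
  moreover have "y \<in> ?X - D" using s(3) z(3) by auto
  ultimately show "\<exists>s\<in>SS. \<exists>x\<in>D. \<exists>y\<in>?X - D. tl s = {x, y}"
    using s(1,4) by (intro bexI)
qed

text \<open>A tile of diameter below \<delta> cannot meet two disjoint pieces, while two pieces with
  a common point share a tile containing it. So replacing every piece by the tiles that meet it
  preserves all incidences.\<close>

lemma euler_bound_of_fine_tiling:
  fixes A :: "'t \<Rightarrow> 'b::metric_space set"
  assumes G: "sgraph V G" and V3: "3 \<le> card V"
    and pieces: "star_pieces V G S Y M"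
    and \<delta>: "\<And>Z Z' x y. Z \<in> Y ` V \<union> M ` G \<Longrightarrow> Z' \<in> Y ` V \<union> M ` G \<Longrightarrow> Z \<inter> Z' = {} \<Longrightarrow>
        x \<in> Z \<Longrightarrow> y \<in> Z' \<Longrightarrow> \<delta> \<le> dist x y"
    and closed: "\<And>x. x \<in> TT \<Longrightarrow> closed (A x)"
    and point: "\<And>p. p \<in> S \<Longrightarrow> tile_connected {x\<in>TT. p \<in> A x}"
    and cover: "S \<subseteq> (\<Union>x\<in>TT. A x)"
    and mesh: "\<And>x a b. x \<in> TT \<Longrightarrow> a \<in> A x \<Longrightarrow> b \<in> A x \<Longrightarrow> dist a b < \<delta>"
  shows "card G + 6 \<le> 3 * card V + 6 * g"
proof -
  define tiles where "tiles Z = {x\<in>TT. A x \<inter> Z \<noteq> {}}" for Z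
  have conn: "tile_connected (tiles Z)" if "connected Z" "Z \<subseteq> S" for Z
    unfolding tiles_def
    by (rule tile_connected_meeting) (use closed point cover that in auto)
  have disj: "tiles Z \<inter> tiles Z' = {}"
    if "Z \<in> Y ` V \<union> M ` G" "Z' \<in> Y ` V \<union> M ` G" "Z \<inter> Z' = {}" for Z Z'
  proof -
    have False if x: "x \<in> TT" "A x \<inter> Z \<noteq> {}" "A x \<inter> Z' \<noteq> {}" for x
    proof -
      obtain a where a: "a \<in> A x" "a \<in> Z" using x(2) by auto
      obtain b where b: "b \<in> A x" "b \<in> Z'" using x(3) by auto
      show False using mesh[OF x(1) a(1) b(1)] \<delta>[OF \<open>Z \<in> _\<close> \<open>Z' \<in> _\<close> \<open>Z \<inter> Z' = {}\<close> a(2) b(2)] by linarith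
    qed
    then show ?thesis unfolding tiles_def by auto
  qed
  have meet: "tiles Z \<inter> tiles Z' \<noteq> {}" if "Z \<inter> Z' \<noteq> {}" "Z \<subseteq> S" for Z Z'
  proof -
    from that obtain z where "z \<in> Z" "z \<in> Z'" "z \<in> S" by auto
    moreover from this(3) obtain x where "x \<in> TT" "z \<in> A x" using cover by auto
    ultimately have "x \<in> tiles Z \<inter> tiles Z'" unfolding tiles_def by auto
    then show ?thesis by auto
  qed
  note P = pieces[unfolded star_pieces_def]
  show ?thesis
  proof (rule euler_bound_of_tile_model[OF G V3, where Y = "\<lambda>v. tiles (Y v)" and M = "\<lambda>e. tiles (M e)"])
    show "tiles (Y v) \<subseteq> TT" "tiles (M e) \<subseteq> TT" for v e unfolding tiles_def by auto
    show "tiles (Y v) \<noteq> {}" if "v \<in> V" for v using meet[of "Y v" "Y v"] P that by auto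
    show "tile_connected (tiles (Y v))" if "v \<in> V" for v using conn P that by auto
    show "tile_connected (tiles (M e))" if "e \<in> G" for e using conn P that by auto
    show "tiles (Y u) \<inter> tiles (Y v) = {}" if "u \<in> V" "v \<in> V" "u \<noteq> v" for u v
      using disj[of "Y u" "Y v"] P that by auto
    show "tiles (M e) \<inter> tiles (M e') = {}" if "e \<in> G" "e' \<in> G" "e \<noteq> e'" for e e'
      using disj[of "M e" "M e'"] P that by auto
    show "tiles (M e) \<inter> tiles (Y v) \<noteq> {} \<longleftrightarrow> v \<in> e" if "e \<in> G" "v \<in> V" for e v
    proof (cases "v \<in> e")
      case True
      then have "M e \<inter> Y v \<noteq> {}" "M e \<subseteq> S" using P that by auto
      then show ?thesis using meet True by simp
    next
      case False
      have "(M e \<inter> Y v \<noteq> {}) = (v \<in> e)" using P that by simp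
      then have "M e \<inter> Y v = {}" using False by simp
      then show ?thesis using disj[of "M e" "Y v"] that False by simp
    qed
  qed
qed

end

section \<open>A grid on the genus surface\<close>

text \<open>The double of a disc with holes, cut into four half-sheets along the real axis. A half-sheet
  is given by two signs and is divided into \<open>M\<close> columns and \<open>N\<close> rows. The outer boundary (row \<open>N\<close>)
  glues the two sheets; the bottom (row \<open>0\<close>) glues the sheets at the holes and the half-planes
  elsewhere. The left and the right ends are single points.\<close>

type_synonym cell = "bool \<times> bool \<times> nat \<times> nat"

text \<open>Each of the g holes is an interval of columns with two ends; \<open>hole_ends\<close>
  counts these ends.\<close>

locale column_grid =
  fixes M N :: nat and hole :: "nat \<Rightarrow> bool" and g :: nat
  assumes M: "2 \<le> M" and N: "1 \<le> N" and hole_0: "\<not> hole 0"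
    and hole_ends: "card {i. 1 \<le> i \<and> i < M \<and> hole (i - 1) \<noteq> hole i} \<le> 2 * g"
begin

text \<open>The canonical name of a grid point: a sign becomes True where gluing makes it
  irrelevant. A bottom point sees the columns on both sides, so at the end of a hole both signs are
  dropped and four corners become one point. On the two extreme column lines all rows collapse as
  well.\<close>

fun point :: "cell \<Rightarrow> cell" where
  "point (\<sigma>, \<tau>, i, j) = (if i = 0 \<or> i = M then (True, True, i, 0)
     else (if j = N \<or> j = 0 \<and> (hole (i - 1) \<or> hole i) then True else \<sigma>,
           if j = 0 \<and> (\<not> hole (i - 1) \<or> \<not> hole i) then True else \<tau>, i, j))"

text \<open>The same for horizontal sides; a bottom side belongs to one column, so exactly one of
  its signs is dropped.\<close>

fun floor_side :: "cell \<Rightarrow> cell" where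
  "floor_side (\<sigma>, \<tau>, i, j) = (if j = N \<or> j = 0 \<and> hole i then True else \<sigma>,
     if j = 0 \<and> \<not> hole i then True else \<tau>, i, j)"

definition cells :: "cell set" where
  "cells = UNIV \<times> UNIV \<times> {..<M} \<times> {..<N}"

text \<open>The left summand holds the vertical sides, between the columns i - 1 and i. There are
  none at the two ends, where the column line is a single point.\<close>

definition sides :: "(cell + cell) set" where
  "sides = Inl ` (UNIV \<times> UNIV \<times> {1..<M} \<times> {..<N}) \<union> Inr ` floor_side ` (UNIV \<times> UNIV \<times> {..<M} \<times> {..N})"

definition points :: "cell set" where
  "points = point ` (UNIV \<times> UNIV \<times> {..M} \<times> {..N})"

fun side_cells :: "cell + cell \<Rightarrow> cell set" where
  "side_cells (Inl (\<sigma>, \<tau>, i, j)) = {(\<sigma>, \<tau>, i - 1, j), (\<sigma>, \<tau>, i, j)}"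
| "side_cells (Inr (\<sigma>, \<tau>, i, j)) =
     (if j = N then {(True, \<tau>, i, N - 1), (False, \<tau>, i, N - 1)}
      else if 0 < j then {(\<sigma>, \<tau>, i, j - 1), (\<sigma>, \<tau>, i, j)}
      else if hole i then {(True, \<tau>, i, 0), (False, \<tau>, i, 0)}
      else {(\<sigma>, True, i, 0), (\<sigma>, False, i, 0)})"

fun side_points :: "cell + cell \<Rightarrow> cell set" where
  "side_points (Inl (\<sigma>, \<tau>, i, j)) = {point (\<sigma>, \<tau>, i, j), point (\<sigma>, \<tau>, i, Suc j)}"
| "side_points (Inr (\<sigma>, \<tau>, i, j)) = {point (\<sigma>, \<tau>, i, j), point (\<sigma>, \<tau>, Suc i, j)}"

text \<open>Normalizing the name of a side does not change its end points, so computations may use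
  any of its names.\<close>

lemma side_points_floor:
  "side_points (Inr (floor_side (\<sigma>, \<tau>, i, j))) = {point (\<sigma>, \<tau>, i, j), point (\<sigma>, \<tau>, Suc i, j)}"
proof -
  obtain \<sigma>' \<tau>' where f: "floor_side (\<sigma>, \<tau>, i, j) = (\<sigma>', \<tau>', i, j)" by simp
  have "point (\<sigma>', \<tau>', i, j) = point (\<sigma>, \<tau>, i, j)"
    using f N by (cases "j = N"; cases "j = 0"; cases "hole i") simp_all
  moreover have "point (\<sigma>', \<tau>', Suc i, j) = point (\<sigma>, \<tau>, Suc i, j)"
    using f N by (cases "j = N"; cases "j = 0"; cases "hole i") simp_all
  ultimately show ?thesis unfolding f by (simp only: side_points.simps)
qed

lemma sides_InlI: "1 \<le> i \<Longrightarrow> i < M \<Longrightarrow> j < N \<Longrightarrow> Inl (\<sigma>, \<tau>, i, j) \<in> sides"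
  unfolding sides_def by (intro UnI1 imageI) auto

lemma sides_InrI: "i < M \<Longrightarrow> j \<le> N \<Longrightarrow> Inr (floor_side (\<sigma>, \<tau>, i, j)) \<in> sides"
  unfolding sides_def by (intro UnI2 imageI) auto

lemma sides_cases [consumes 1]:
  assumes "s \<in> sides"
  obtains (vertical) \<sigma> \<tau> i j where "s = Inl (\<sigma>, \<tau>, i, j)" "1 \<le> i" "i < M" "j < N"
  | (horizontal) \<sigma> \<tau> i j where "s = Inr (floor_side (\<sigma>, \<tau>, i, j))" "i < M" "j \<le> N"
proof -
  have "s \<in> Inl ` (UNIV \<times> UNIV \<times> {1..<M} \<times> {..<N}) \<or> s \<in> Inr ` floor_side ` (UNIV \<times> UNIV \<times> {..<M} \<times> {..N})"
    using assms unfolding sides_def by (simp only: Un_iff)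
  then show thesis
  proof
    assume "s \<in> Inl ` (UNIV \<times> UNIV \<times> {1..<M} \<times> {..<N})"
    then show thesis using vertical by auto
  next
    assume "s \<in> Inr ` floor_side ` (UNIV \<times> UNIV \<times> {..<M} \<times> {..N})"
    then obtain y where y: "y \<in> UNIV \<times> UNIV \<times> {..<M} \<times> {..N}" "s = Inr (floor_side y)" by (elim imageE) simp
    obtain \<sigma> \<tau> i j where "y = (\<sigma>, \<tau>, i, j)" by (rule prod_cases4)
    then show thesis using y by (intro horizontal[of \<sigma> \<tau> i j]) simp_all
  qed
qed

lemma side_cells_card:
  assumes "s \<in> sides"
  shows "side_cells s \<subseteq> cells \<and> card (side_cells s) = 2"
  using assms
proof (cases rule: sides_cases)
  case (vertical \<sigma> \<tau> i j)
  then show ?thesis unfolding cells_def by simp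
next
  case (horizontal \<sigma> \<tau> i j)
  then show ?thesis using N unfolding cells_def
    by (cases "j = N"; cases "j = 0"; cases "hole i") simp_all
qed

lemma point_in_points: "i \<le> M \<Longrightarrow> j \<le> N \<Longrightarrow> point (\<sigma>, \<tau>, i, j) \<in> points"
  unfolding points_def by (rule imageI) simp

lemma side_points_card:
  assumes "s \<in> sides"
  shows "side_points s \<subseteq> points \<and> card (side_points s) = 2"
  using assms
proof (cases rule: sides_cases)
  case (vertical \<sigma> \<tau> i j)
  have "point (\<sigma>, \<tau>, i, j) \<in> points" "point (\<sigma>, \<tau>, i, Suc j) \<in> points"
    using vertical by (auto intro!: point_in_points simp del: point.simps)
  moreover have "point (\<sigma>, \<tau>, i, j) \<noteq> point (\<sigma>, \<tau>, i, Suc j)" using vertical by simp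
  ultimately show ?thesis unfolding vertical(1) by (simp del: point.simps)
next
  case (horizontal \<sigma> \<tau> i j)
  have "point (\<sigma>, \<tau>, i, j) \<in> points" "point (\<sigma>, \<tau>, Suc i, j) \<in> points"
    using horizontal by (auto intro!: point_in_points simp del: point.simps)
  moreover have "point (\<sigma>, \<tau>, i, j) \<noteq> point (\<sigma>, \<tau>, Suc i, j)" using M by auto
  ultimately show ?thesis unfolding horizontal(1) side_points_floor by (simp del: point.simps)
qed

text \<open>A cell in the first or the last column is a triangle, as the vertical side at the
  collapsed end is missing.\<close>

lemma sides_of_cell:
  assumes "i < M" "j < N"
  shows "s \<in> sides \<and> (\<sigma>, \<tau>, i, j) \<in> side_cells s \<longleftrightarrow>
    (1 \<le> i \<and> s = Inl (\<sigma>, \<tau>, i, j)) \<or> (Suc i < M \<and> s = Inl (\<sigma>, \<tau>, Suc i, j)) \<or>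
    s = Inr (floor_side (\<sigma>, \<tau>, i, j)) \<or> s = Inr (floor_side (\<sigma>, \<tau>, i, Suc j))" (is "?L \<longleftrightarrow> ?R")
proof
  assume L: ?L
  then have "s \<in> sides" by simp
  then show ?R
  proof (cases rule: sides_cases)
    case (vertical \<sigma>' \<tau>' i' j')
    then show ?thesis using L by auto
  next
    case (horizontal \<sigma>' \<tau>' i' j')
    then show ?thesis using L assms N
      by (cases "j' = N"; cases "j' = 0"; cases "hole i'") auto
  qed
next
  assume ?R
  then show ?L
  proof (elim disjE conjE)
    assume "s = Inr (floor_side (\<sigma>, \<tau>, i, j))"
    then show ?L using assms sides_InrI[of i j \<sigma> \<tau>] by auto
  next
    assume "s = Inr (floor_side (\<sigma>, \<tau>, i, Suc j))"
    then show ?L using assms sides_InrI[of i "Suc j" \<sigma> \<tau>] by auto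
  qed (use assms sides_InlI in auto)
qed

lemma card_Int_eq_1:
  assumes "a \<noteq> b"
  shows "card ({a, b} \<inter> f) = 1 \<longleftrightarrow> (a \<in> f) \<noteq> (b \<in> f)"
  using assms by (cases "a \<in> f"; cases "b \<in> f") auto

text \<open>On the way round the four corners of a cell, membership in \<open>f\<close> changes an
  even number of times. Where a vertical side is missing the two corners coincide, and there is no
  change to account for.\<close>

lemma boundary_even:
  assumes x: "x \<in> cells"
  shows "even (card {s \<in> sides. x \<in> side_cells s \<and> card (side_points s \<inter> f) = 1})"
proof -
  obtain \<sigma> \<tau> i j where xx: "x = (\<sigma>, \<tau>, i, j)" "i < M" "j < N" using x unfolding cells_def by auto
  define LB LT RB RT where "LB \<longleftrightarrow> point (\<sigma>, \<tau>, i, j) \<in> f" and "LT \<longleftrightarrow> point (\<sigma>, \<tau>, i, Suc j) \<in> f"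
    and "RB \<longleftrightarrow> point (\<sigma>, \<tau>, Suc i, j) \<in> f" and "RT \<longleftrightarrow> point (\<sigma>, \<tau>, Suc i, Suc j) \<in> f"
  let ?Q = "\<lambda>s. card (side_points s \<inter> f) = 1"
  define l r b t :: "cell + cell" where "l = Inl (\<sigma>, \<tau>, i, j)" and "r = Inl (\<sigma>, \<tau>, Suc i, j)"
    and "b = Inr (floor_side (\<sigma>, \<tau>, i, j))" and "t = Inr (floor_side (\<sigma>, \<tau>, i, Suc j))"
  have incident: "s \<in> sides \<and> x \<in> side_cells s \<longleftrightarrow> (1 \<le> i \<and> s = l) \<or> (Suc i < M \<and> s = r) \<or> s = b \<or> s = t" for s
    unfolding l_def r_def b_def t_def xx(1) by (rule sides_of_cell[OF xx(2,3)])
  have dist: "l \<noteq> r" "l \<noteq> b" "l \<noteq> t" "r \<noteq> b" "r \<noteq> t" "b \<noteq> t"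
    unfolding l_def r_def b_def t_def by auto
  have ne: "point (\<sigma>, \<tau>, i, k) \<noteq> point (\<sigma>, \<tau>, Suc i, k)" for k using M by auto
  have ne': "point (\<sigma>, \<tau>, k, j) \<noteq> point (\<sigma>, \<tau>, k, Suc j)" if "1 \<le> k" "k < M" for k using that by simp
  have Ql: "1 \<le> i \<and> ?Q l \<longleftrightarrow> LB \<noteq> LT"
  proof (cases "1 \<le> i")
    case True
    show ?thesis using True card_Int_eq_1[OF ne'[OF True xx(2)]] unfolding LB_def LT_def l_def
      by (simp only: side_points.simps simp_thms)
  next
    case False
    then show ?thesis unfolding LB_def LT_def by simp
  qed
  have Qr: "Suc i < M \<and> ?Q r \<longleftrightarrow> RB \<noteq> RT"
  proof (cases "Suc i < M")
    case True
    have "1 \<le> Suc i" by simp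
    show ?thesis using True card_Int_eq_1[OF ne'[OF \<open>1 \<le> Suc i\<close> True]] unfolding RB_def RT_def r_def
      by (simp only: side_points.simps simp_thms)
  next
    case False
    then have "Suc i = M" using xx(2) by simp
    then show ?thesis unfolding RB_def RT_def by simp
  qed
  have Qb: "?Q b \<longleftrightarrow> LB \<noteq> RB" and Qt: "?Q t \<longleftrightarrow> LT \<noteq> RT"
    unfolding b_def t_def side_points_floor card_Int_eq_1[OF ne] LB_def RB_def LT_def RT_def by (rule refl)+
  have "{s \<in> sides. x \<in> side_cells s \<and> ?Q s}
      = {s. (1 \<le> i \<and> s = l \<or> Suc i < M \<and> s = r \<or> s = b \<or> s = t) \<and> ?Q s}"
    using incident by blast
  also have "\<dots> = (if LB \<noteq> LT then {l} else {}) \<union> (if RB \<noteq> RT then {r} else {}) \<union>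
      (if LB \<noteq> RB then {b} else {}) \<union> (if LT \<noteq> RT then {t} else {})"
    unfolding Ql[symmetric] Qr[symmetric] Qb[symmetric] Qt[symmetric] by auto
  also have "even (card \<dots>)"
    using dist by (cases LB; cases LT; cases RB; cases RT) simp_all
  finally show ?thesis .
qed

text \<open>Every row leads along horizontal sides to the left end, a single point, so a set of
  points without boundary is empty or everything.\<close>

lemma points_cut:
  assumes f: "f \<subseteq> points" "f \<noteq> {}" "f \<noteq> points"
  shows "\<exists>s\<in>sides. card (side_points s \<inter> f) = 1"
proof (rule ccontr)
  assume no: "\<not> ?thesis"
  have step: "point (\<sigma>, \<tau>, i, j) \<in> f \<longleftrightarrow> point (\<sigma>, \<tau>, Suc i, j) \<in> f" if "i < M" "j \<le> N" for \<sigma> \<tau> i j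
  proof -
    have ne: "point (\<sigma>, \<tau>, i, j) \<noteq> point (\<sigma>, \<tau>, Suc i, j)" using M by auto
    have "card (side_points (Inr (floor_side (\<sigma>, \<tau>, i, j))) \<inter> f) \<noteq> 1"
      using no sides_InrI[OF that, of \<sigma> \<tau>] by (simp del: floor_side.simps side_points.simps)
    then show ?thesis unfolding side_points_floor card_Int_eq_1[OF ne] by simp
  qed
  have "point (\<sigma>, \<tau>, i, j) \<in> f \<longleftrightarrow> (True, True, 0, 0) \<in> f" if "i \<le> M" "j \<le> N" for \<sigma> \<tau> i j
    using that
  proof (induction i)
    case 0
    then show ?case by simp
  next
    case (Suc i)
    then show ?case using step[of i j \<sigma> \<tau>] by (simp del: point.simps)
  qed
  then have "\<forall>p\<in>points. p \<in> f \<longleftrightarrow> (True, True, 0, 0) \<in> f"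
    unfolding points_def by (auto simp del: point.simps)
  then show False using f by auto
qed

definition adjacent_in :: "cell set \<Rightarrow> cell \<Rightarrow> cell \<Rightarrow> bool" where
  "adjacent_in Z x y \<longleftrightarrow> x \<in> Z \<and> y \<in> Z \<and> (\<exists>s\<in>sides. side_cells s = {x, y})"

lemma adjacent_in_sym: "adjacent_in Z x y \<Longrightarrow> adjacent_in Z y x"
  unfolding adjacent_in_def by (auto simp: insert_commute)

lemma adjacent_column: "Suc i < M \<Longrightarrow> j < N \<Longrightarrow> (\<sigma>, \<tau>, i, j) \<in> Z \<Longrightarrow> (\<sigma>, \<tau>, Suc i, j) \<in> Z \<Longrightarrow>
    adjacent_in Z (\<sigma>, \<tau>, i, j) (\<sigma>, \<tau>, Suc i, j)"
  unfolding adjacent_in_def using sides_InlI[of "Suc i" j \<sigma> \<tau>]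
  by (auto intro!: bexI[of _ "Inl (\<sigma>, \<tau>, Suc i, j)"])

lemma adjacent_row: "i < M \<Longrightarrow> Suc j < N \<Longrightarrow> (\<sigma>, \<tau>, i, j) \<in> Z \<Longrightarrow> (\<sigma>, \<tau>, i, Suc j) \<in> Z \<Longrightarrow>
    adjacent_in Z (\<sigma>, \<tau>, i, j) (\<sigma>, \<tau>, i, Suc j)"
  unfolding adjacent_in_def using sides_InrI[of i "Suc j" \<sigma> \<tau>]
  by (auto intro!: bexI[of _ "Inr (floor_side (\<sigma>, \<tau>, i, Suc j))"])

lemma adjacent_top: "i < M \<Longrightarrow> (True, \<tau>, i, N - 1) \<in> Z \<Longrightarrow> (False, \<tau>, i, N - 1) \<in> Z \<Longrightarrow>
    adjacent_in Z (True, \<tau>, i, N - 1) (False, \<tau>, i, N - 1)"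
  unfolding adjacent_in_def using sides_InrI[of i N True \<tau>] N
  by (auto intro!: bexI[of _ "Inr (floor_side (True, \<tau>, i, N))"])

lemma adjacent_hole: "i < M \<Longrightarrow> hole i \<Longrightarrow> (True, \<tau>, i, 0) \<in> Z \<Longrightarrow> (False, \<tau>, i, 0) \<in> Z \<Longrightarrow>
    adjacent_in Z (True, \<tau>, i, 0) (False, \<tau>, i, 0)"
  unfolding adjacent_in_def using sides_InrI[of i 0 True \<tau>] N
  by (auto intro!: bexI[of _ "Inr (floor_side (True, \<tau>, i, 0))"])

lemma adjacent_axis: "i < M \<Longrightarrow> \<not> hole i \<Longrightarrow> (\<sigma>, True, i, 0) \<in> Z \<Longrightarrow> (\<sigma>, False, i, 0) \<in> Z \<Longrightarrow>
    adjacent_in Z (\<sigma>, True, i, 0) (\<sigma>, False, i, 0)"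
  unfolding adjacent_in_def using sides_InrI[of i 0 \<sigma> True] N
  by (auto intro!: bexI[of _ "Inr (floor_side (\<sigma>, True, i, 0))"])

lemma reachable_cut:
  assumes reach: "\<And>x. x \<in> Z \<Longrightarrow> (adjacent_in Z)\<^sup>*\<^sup>* x x0" and D: "D \<subseteq> Z" "D \<noteq> {}" "D \<noteq> Z"
  shows "\<exists>s\<in>sides. \<exists>x\<in>D. \<exists>y\<in>Z - D. side_cells s = {x, y}"
proof (rule ccontr)
  assume no: "\<not> ?thesis"
  have step: "x \<in> D \<longleftrightarrow> y \<in> D" if "adjacent_in Z x y" for x y
  proof -
    from that obtain s where s: "s \<in> sides" "side_cells s = {x, y}" "x \<in> Z" "y \<in> Z"
      unfolding adjacent_in_def by auto
    have s': "side_cells s = {y, x}" using s(2) by auto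
    show ?thesis using no s s' by blast
  qed
  have "x \<in> D \<longleftrightarrow> y \<in> D" if "(adjacent_in Z)\<^sup>*\<^sup>* x y" for x y
    using that by (induction rule: rtranclp_induct) (use step in auto)
  then have "x \<in> D \<longleftrightarrow> x0 \<in> D" if "x \<in> Z" for x using reach[OF that] by blast
  then show False using D by blast
qed

lemma reach_column:
  assumes j: "j < N" and ik: "i \<le> k" "k < M" and Z: "\<And>l. i \<le> l \<Longrightarrow> l \<le> k \<Longrightarrow> (\<sigma>, \<tau>, l, j) \<in> Z"
  shows "(adjacent_in Z)\<^sup>*\<^sup>* (\<sigma>, \<tau>, i, j) (\<sigma>, \<tau>, k, j)"
  using ik Z
proof (induction k rule: dec_induct)
  case (step k)
  then have "(adjacent_in Z)\<^sup>*\<^sup>* (\<sigma>, \<tau>, i, j) (\<sigma>, \<tau>, k, j)" by simp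
  moreover have "adjacent_in Z (\<sigma>, \<tau>, k, j) (\<sigma>, \<tau>, Suc k, j)"
    using step by (intro adjacent_column[OF _ j]) auto
  ultimately show ?case by (rule rtranclp.rtrancl_into_rtrancl)
qed simp

lemma reach_row:
  assumes i: "i < M" and jk: "j \<le> k" "k < N" and Z: "\<And>l. j \<le> l \<Longrightarrow> l \<le> k \<Longrightarrow> (\<sigma>, \<tau>, i, l) \<in> Z"
  shows "(adjacent_in Z)\<^sup>*\<^sup>* (\<sigma>, \<tau>, i, j) (\<sigma>, \<tau>, i, k)"
  using jk Z
proof (induction k rule: dec_induct)
  case (step k)
  then have "(adjacent_in Z)\<^sup>*\<^sup>* (\<sigma>, \<tau>, i, j) (\<sigma>, \<tau>, i, k)" by simp
  moreover have "adjacent_in Z (\<sigma>, \<tau>, i, k) (\<sigma>, \<tau>, i, Suc k)"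
    using step by (intro adjacent_row[OF i]) auto
  ultimately show ?case by (rule rtranclp.rtrancl_into_rtrancl)
qed simp

lemma adjacent_rtranclp_sym: "(adjacent_in Z)\<^sup>*\<^sup>* x y \<Longrightarrow> (adjacent_in Z)\<^sup>*\<^sup>* y x"
proof (induction rule: rtranclp_induct)
  case (step y z)
  show ?case by (rule converse_rtranclp_into_rtranclp[OF adjacent_in_sym[OF step.hyps(2)] step.IH])
qed simp

text \<open>All cells reach the bottom left cell with both signs True: along the row to column 0, up
  to the outer boundary to change the sheet, down again, and across the axis to change the
  half-plane. The last step is possible because column 0 is not in a hole.\<close>

lemma cells_cut:
  assumes D: "D \<subseteq> cells" "D \<noteq> {}" "D \<noteq> cells"
  shows "\<exists>s\<in>sides. \<exists>x\<in>D. \<exists>y\<in>cells - D. side_cells s = {x, y}"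
proof (rule reachable_cut[OF _ D, of "(True, True, 0, 0)"])
  fix x assume "x \<in> cells"
  then obtain \<sigma> \<tau> i j where x: "x = (\<sigma>, \<tau>, i, j)" "i < M" "j < N" unfolding cells_def by auto
  note [trans] = rtranclp_trans
  have in_cells: "(\<sigma>', \<tau>', k, l) \<in> cells" if "k < M" "l < N" for \<sigma>' \<tau>' k l
    using that unfolding cells_def by simp
  have "(adjacent_in cells)\<^sup>*\<^sup>* x (\<sigma>, \<tau>, 0, j)"
    unfolding x(1) by (rule adjacent_rtranclp_sym, rule reach_column) (use x in_cells in auto)
  also have "(adjacent_in cells)\<^sup>*\<^sup>* (\<sigma>, \<tau>, 0, j) (\<sigma>, \<tau>, 0, N - 1)"
    by (rule reach_row) (use M x in_cells in auto)
  also have "(adjacent_in cells)\<^sup>*\<^sup>* (\<sigma>, \<tau>, 0, N - 1) (True, \<tau>, 0, N - 1)"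
  proof (cases \<sigma>)
    case False
    then show ?thesis
      using adjacent_in_sym[OF adjacent_top[of 0 \<tau> cells]] in_cells M N by (intro r_into_rtranclp) auto
  qed simp
  also have "(adjacent_in cells)\<^sup>*\<^sup>* (True, \<tau>, 0, N - 1) (True, \<tau>, 0, 0)"
    by (rule adjacent_rtranclp_sym, rule reach_row) (use M N in_cells in auto)
  also have "(adjacent_in cells)\<^sup>*\<^sup>* (True, \<tau>, 0, 0) (True, True, 0, 0)"
  proof (cases \<tau>)
    case False
    then show ?thesis
      using adjacent_in_sym[OF adjacent_axis[of 0 True cells]] in_cells M N hole_0
      by (intro r_into_rtranclp) auto
  qed simp
  finally show "(adjacent_in cells)\<^sup>*\<^sup>* x (True, True, 0, 0)" .
qed

text \<open>On the top and the bottom row, gluing halves the number of horizontal sides. The Euler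
  inequality needs only an upper bound here.\<close>

lemma card_sides: "card sides \<le> 4 * ((M - 1) * N) + 4 * (M * (N - 1)) + 2 * M + 2 * M"
proof -
  let ?bot = "\<lambda>(b, i). if hole i then (True, b, i, 0) else (b, True, i, 0 :: nat)"
  have "floor_side ` (UNIV \<times> UNIV \<times> {..<M} \<times> {..N})
      \<subseteq> (UNIV \<times> UNIV \<times> {..<M} \<times> {1..<N}) \<union> ({True} \<times> UNIV \<times> {..<M} \<times> {N}) \<union> ?bot ` (UNIV \<times> {..<M})"
    (is "_ \<subseteq> ?A \<union> ?B \<union> ?C")
  proof
    fix x assume "x \<in> floor_side ` (UNIV \<times> UNIV \<times> {..<M} \<times> {..N})"
    then obtain \<sigma> \<tau> i j where x: "x = floor_side (\<sigma>, \<tau>, i, j)" "i < M" "j \<le> N" by auto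
    consider "j = N" | "j = 0" "hole i" | "j = 0" "\<not> hole i" | "1 \<le> j" "j < N" using x(3) by linarith
    then show "x \<in> ?A \<union> ?B \<union> ?C"
    proof cases
      case 2
      then have "x = ?bot (\<tau>, i)" using x(1) N by simp
      then have "x \<in> ?C" by (rule image_eqI) (use x in simp)
      then show ?thesis by (rule UnI2)
    next
      case 3
      then have "x = ?bot (\<sigma>, i)" using x(1) N by simp
      then have "x \<in> ?C" by (rule image_eqI) (use x in simp)
      then show ?thesis by (rule UnI2)
    qed (use x N in auto)
  qed
  then have "card (floor_side ` (UNIV \<times> UNIV \<times> {..<M} \<times> {..N})) \<le> card (?A \<union> ?B \<union> ?C)"
    by (intro card_mono) auto
  also have "\<dots> \<le> card ?A + card ?B + card ?C"
    using card_Un_le[of "?A \<union> ?B" ?C] card_Un_le[of ?A ?B] by linarith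
  also have "card ?C \<le> card (UNIV \<times> {..<M} :: (bool \<times> nat) set)" by (intro card_image_le) auto
  finally have "card (floor_side ` (UNIV \<times> UNIV \<times> {..<M} \<times> {..N})) \<le> 4 * (M * (N - 1)) + 2 * M + 2 * M"
    by (simp add: card_cartesian_product card_UNIV_bool)
  moreover have "card (Inl ` (UNIV \<times> UNIV \<times> {1..<M} \<times> {..<N}) :: (cell + cell) set) = 4 * ((M - 1) * N)"
    by (subst card_image) (auto simp: card_cartesian_product card_UNIV_bool)
  moreover have "card (Inr ` floor_side ` (UNIV \<times> UNIV \<times> {..<M} \<times> {..N}) :: (cell + cell) set)
      = card (floor_side ` (UNIV \<times> UNIV \<times> {..<M} \<times> {..N}))"
    by (rule card_image) simp
  ultimately show ?thesis
    unfolding sides_def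
    using card_Un_le[of "Inl ` (UNIV \<times> UNIV \<times> {1..<M} \<times> {..<N}) :: (cell + cell) set"
        "Inr ` floor_side ` (UNIV \<times> UNIV \<times> {..<M} \<times> {..N})"] by linarith
qed

text \<open>On the bottom row an inner column line carries two points if the columns beside it are
  of the same type, and one point at the end of a hole. The at most 2g missing points are the whole
  contribution of the holes to the Euler characteristic.\<close>

lemma card_points: "4 * ((M - 1) * (N - 1)) + 4 * (M - 1) + 2 \<le> card points + 2 * g"
proof -
  let ?A = "UNIV \<times> UNIV \<times> {1..<M} \<times> {1..<N} :: cell set"
  let ?B = "{True} \<times> UNIV \<times> {1..<M} \<times> {N} :: cell set"
  let ?C = "{True} \<times> {True} \<times> {1..<M} \<times> {0} :: cell set"
  let ?I = "{i\<in>{1..<M}. hole (i - 1) = hole i}"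
  \<comment> \<open>The second bottom point on a column line, besides the one with both signs True
    in \<open>?C\<close>.\<close>
  let ?h = "\<lambda>i. if hole i then (True, False, i, 0) else (False, True, i, 0 :: nat)"
  let ?D = "?h ` ?I"
  let ?E = "{(True, True, 0, 0), (True, True, M, 0)} :: cell set"
  have "?A \<union> ?B \<union> ?C \<union> ?D \<union> ?E \<subseteq> points"
  proof
    fix x assume "x \<in> ?A \<union> ?B \<union> ?C \<union> ?D \<union> ?E"
    then have "point x = x \<and> x \<in> UNIV \<times> UNIV \<times> {..M} \<times> {..N}" using N M by (auto split: if_splits)
    then show "x \<in> points" unfolding points_def by (metis imageI)
  qed
  then have "card (?A \<union> ?B \<union> ?C \<union> ?D \<union> ?E) \<le> card points"
    unfolding points_def by (intro card_mono) auto
  also have "card (?A \<union> ?B \<union> ?C \<union> ?D \<union> ?E) = card ?A + card ?B + card ?C + card ?D + card ?E"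
    using N M by (subst card_Un_disjoint, simp, simp, force)+ simp
  also have "card ?A = 4 * ((M - 1) * (N - 1))" by (simp add: card_cartesian_product card_UNIV_bool)
  also have "card ?B = 2 * (M - 1)" by (simp add: card_cartesian_product card_UNIV_bool)
  also have "card ?C = M - 1" by (simp add: card_cartesian_product)
  also have "card ?E = 2" using M by simp
  also have "card ?D = card ?I" by (rule card_image) (auto simp: inj_on_def split: if_splits)
  finally have 1: "4 * ((M - 1) * (N - 1)) + 2 * (M - 1) + (M - 1) + card ?I + 2 \<le> card points" .
  have "{1..<M} = ?I \<union> {i\<in>{1..<M}. hole (i - 1) \<noteq> hole i}" by blast
  then have "card {1..<M} = card (?I \<union> {i\<in>{1..<M}. hole (i - 1) \<noteq> hole i})" by (rule arg_cong)
  also have "\<dots> = card ?I + card {i\<in>{1..<M}. hole (i - 1) \<noteq> hole i}"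
    by (rule card_Un_disjoint) auto
  finally have "card {1..<M} = card ?I + card {i\<in>{1..<M}. hole (i - 1) \<noteq> hole i}" .
  moreover have "{i\<in>{1..<M}. hole (i - 1) \<noteq> hole i} = {i. 1 \<le> i \<and> i < M \<and> hole (i - 1) \<noteq> hole i}" by auto
  ultimately have "M - 1 \<le> card ?I + 2 * g" using hole_ends by simp
  then show ?thesis using 1 by linarith
qed

lemma tile_complex: "tile_complex cells sides points side_cells side_points g"
proof
  show "finite cells" "finite sides" "finite points" unfolding cells_def sides_def points_def by auto
  have "card cells = 4 * (M * N)" unfolding cells_def by (simp add: card_cartesian_product card_UNIV_bool)
  moreover obtain m where m: "M = Suc m" using M by (cases M) auto
  moreover obtain k where k: "N = Suc k" using N by (cases N) auto
  ultimately show "card sides + 2 \<le> card cells + card points + 2 * g"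
    using card_sides card_points by (simp add: algebra_simps)
qed (use side_cells_card side_points_card boundary_even points_cut cells_cut in auto)

sublocale tile_complex cells sides points side_cells side_points g
  by (rule tile_complex)

text \<open>The cells containing a given point of the surface form such a product set.\<close>

lemma product_connected:
  assumes I: "I \<subseteq> {..<M}" "\<And>i k l. i \<in> I \<Longrightarrow> k \<in> I \<Longrightarrow> i \<le> l \<Longrightarrow> l \<le> k \<Longrightarrow> l \<in> I"
    and J: "J \<subseteq> {..<N}" "\<And>i k l. i \<in> J \<Longrightarrow> k \<in> J \<Longrightarrow> i \<le> l \<Longrightarrow> l \<le> k \<Longrightarrow> l \<in> J"
    and sheets: "True \<in> \<Sigma> \<Longrightarrow> False \<in> \<Sigma> \<Longrightarrow> N - 1 \<in> J \<or> 0 \<in> J \<and> (\<exists>i\<in>I. hole i)"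
    and halves: "True \<in> \<Theta> \<Longrightarrow> False \<in> \<Theta> \<Longrightarrow> 0 \<in> J \<and> (\<exists>i\<in>I. \<not> hole i)"
  shows "tile_connected (\<Sigma> \<times> \<Theta> \<times> I \<times> J)" (is "tile_connected ?Z")
proof -
  have reach: "(adjacent_in ?Z)\<^sup>*\<^sup>* x y" if xZ: "x \<in> ?Z" and yZ: "y \<in> ?Z" for x y
  proof -
    obtain \<sigma> \<tau> i j where x: "x = (\<sigma>, \<tau>, i, j)" "\<sigma> \<in> \<Sigma>" "\<tau> \<in> \<Theta>" "i \<in> I" "j \<in> J" using xZ by auto
    obtain \<sigma>' \<tau>' i' j' where y: "y = (\<sigma>', \<tau>', i', j')" "\<sigma>' \<in> \<Sigma>" "\<tau>' \<in> \<Theta>" "i' \<in> I" "j' \<in> J" using yZ by auto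
    note [trans] = rtranclp_trans
    have col: "(adjacent_in ?Z)\<^sup>*\<^sup>* (\<sigma>, \<tau>, a, j) (\<sigma>, \<tau>, b, j)"
      if "a \<in> I" "b \<in> I" "j \<in> J" "\<sigma> \<in> \<Sigma>" "\<tau> \<in> \<Theta>" for a b j \<sigma> \<tau>
    proof -
      have "(adjacent_in ?Z)\<^sup>*\<^sup>* (\<sigma>, \<tau>, a, j) (\<sigma>, \<tau>, b, j)" if ab: "a \<in> I" "b \<in> I" "a \<le> b" for a b
      proof (rule reach_column)
        show "j < N" "b < M" using J(1) I(1) \<open>j \<in> J\<close> ab(2) by auto
        fix l assume "a \<le> l" "l \<le> b"
        then have "l \<in> I" by (rule I(2)[OF ab(1,2)])
        then show "(\<sigma>, \<tau>, l, j) \<in> ?Z" using \<open>j \<in> J\<close> \<open>\<sigma> \<in> \<Sigma>\<close> \<open>\<tau> \<in> \<Theta>\<close> by simp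
      qed (rule ab(3))
      note this[OF that(1,2)] adjacent_rtranclp_sym[OF this[OF that(2,1)]]
      then show ?thesis by (cases "a \<le> b") simp_all
    qed
    have row: "(adjacent_in ?Z)\<^sup>*\<^sup>* (\<sigma>, \<tau>, i, a) (\<sigma>, \<tau>, i, b)"
      if "a \<in> J" "b \<in> J" "i \<in> I" "\<sigma> \<in> \<Sigma>" "\<tau> \<in> \<Theta>" for a b i \<sigma> \<tau>
    proof -
      have "(adjacent_in ?Z)\<^sup>*\<^sup>* (\<sigma>, \<tau>, i, a) (\<sigma>, \<tau>, i, b)" if ab: "a \<in> J" "b \<in> J" "a \<le> b" for a b
      proof (rule reach_row)
        show "i < M" "b < N" using J(1) I(1) \<open>i \<in> I\<close> ab(2) by auto
        fix l assume "a \<le> l" "l \<le> b"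
        then have "l \<in> J" by (rule J(2)[OF ab(1,2)])
        then show "(\<sigma>, \<tau>, i, l) \<in> ?Z" using \<open>i \<in> I\<close> \<open>\<sigma> \<in> \<Sigma>\<close> \<open>\<tau> \<in> \<Theta>\<close> by simp
      qed (rule ab(3))
      note this[OF that(1,2)] adjacent_rtranclp_sym[OF this[OF that(2,1)]]
      then show ?thesis by (cases "a \<le> b") simp_all
    qed
    have move: "(adjacent_in ?Z)\<^sup>*\<^sup>* (\<sigma>, \<tau>, a, b) (\<sigma>, \<tau>, c, d)"
      if "a \<in> I" "b \<in> J" "c \<in> I" "d \<in> J" "\<sigma> \<in> \<Sigma>" "\<tau> \<in> \<Theta>" for a b c d \<sigma> \<tau>
      by (rule rtranclp_trans[OF col[of a c b \<sigma> \<tau>] row[of b d c \<sigma> \<tau>]]) (rule that)+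
    \<comment> \<open>The signs are changed one at a time, each at a place where the gluing allows
      it.\<close>
    have sheet: "\<exists>a\<in>I. \<exists>b\<in>J. (adjacent_in ?Z)\<^sup>*\<^sup>* (\<sigma>, \<tau>, a, b) (\<sigma>', \<tau>, a, b)"
    proof (cases "\<sigma> = \<sigma>'")
      case True
      then show ?thesis using x by blast
    next
      case False
      then have "\<exists>a\<in>I. \<exists>b\<in>J. adjacent_in ?Z (True, \<tau>, a, b) (False, \<tau>, a, b)"
      proof -
        have s: "True \<in> \<Sigma>" "False \<in> \<Sigma>" using False x(2) y(2) by (cases \<sigma>; cases \<sigma>'; simp)+
        from sheets[OF s] show ?thesis
        proof
          assume "N - 1 \<in> J"
          then have "adjacent_in ?Z (True, \<tau>, i, N - 1) (False, \<tau>, i, N - 1)"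
            using x I(1) s by (intro adjacent_top) auto
          then show ?thesis using x(4) \<open>N - 1 \<in> J\<close> by blast
        next
          assume "0 \<in> J \<and> (\<exists>i\<in>I. hole i)"
          then obtain a where a: "a \<in> I" "hole a" "0 \<in> J" by blast
          then have "adjacent_in ?Z (True, \<tau>, a, 0) (False, \<tau>, a, 0)"
            using x I(1) s by (intro adjacent_hole) auto
          then show ?thesis using a by blast
        qed
      qed
      then obtain a b where ab: "a \<in> I" "b \<in> J" "adjacent_in ?Z (True, \<tau>, a, b) (False, \<tau>, a, b)" by blast
      have "adjacent_in ?Z (\<sigma>, \<tau>, a, b) (\<sigma>', \<tau>, a, b)"
        using ab(3) adjacent_in_sym[OF ab(3)] False by (cases \<sigma>; cases \<sigma>') auto
      then show ?thesis using ab(1,2) by blast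
    qed
    have half: "\<exists>a\<in>I. \<exists>b\<in>J. (adjacent_in ?Z)\<^sup>*\<^sup>* (\<sigma>', \<tau>, a, b) (\<sigma>', \<tau>', a, b)"
    proof (cases "\<tau> = \<tau>'")
      case True
      then show ?thesis using x by blast
    next
      case False
      have s: "True \<in> \<Theta>" "False \<in> \<Theta>" using False x(3) y(3) by (cases \<tau>; cases \<tau>'; simp)+
      obtain a where a: "a \<in> I" "\<not> hole a" "0 \<in> J" using halves[OF s] by blast
      then have ab: "adjacent_in ?Z (\<sigma>', True, a, 0) (\<sigma>', False, a, 0)"
        using y I(1) s by (intro adjacent_axis) auto
      have "adjacent_in ?Z (\<sigma>', \<tau>, a, 0) (\<sigma>', \<tau>', a, 0)"
        using ab adjacent_in_sym[OF ab] False by (cases \<tau>; cases \<tau>') auto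
      then show ?thesis using a by blast
    qed
    obtain a b where ab: "a \<in> I" "b \<in> J" "(adjacent_in ?Z)\<^sup>*\<^sup>* (\<sigma>, \<tau>, a, b) (\<sigma>', \<tau>, a, b)" using sheet by blast
    obtain c d where cd: "c \<in> I" "d \<in> J" "(adjacent_in ?Z)\<^sup>*\<^sup>* (\<sigma>', \<tau>, c, d) (\<sigma>', \<tau>', c, d)" using half by blast
    have "(adjacent_in ?Z)\<^sup>*\<^sup>* x (\<sigma>, \<tau>, a, b)" unfolding x(1) by (rule move) (use x ab in auto)
    also note ab(3)
    also have "(adjacent_in ?Z)\<^sup>*\<^sup>* (\<sigma>', \<tau>, a, b) (\<sigma>', \<tau>, c, d)" by (rule move) (use x y ab cd in auto)
    also note cd(3)
    also have "(adjacent_in ?Z)\<^sup>*\<^sup>* (\<sigma>', \<tau>', c, d) y" unfolding y(1) by (rule move) (use y cd in auto)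
    finally show ?thesis .
  qed
  show ?thesis
    unfolding tile_connected_def
  proof (intro allI impI)
    fix D assume D: "D \<subseteq> ?Z" "D \<noteq> {}" "D \<noteq> ?Z"
    then obtain x0 where "x0 \<in> ?Z" by blast
    then show "\<exists>s\<in>sides. \<exists>x\<in>D. \<exists>y\<in>?Z - D. side_cells s = {x, y}"
      using reach by (intro reachable_cut[OF _ D, of x0]) auto
  qed
qed

end

section \<open>The model surface as four half-sheets over the real axis\<close>

definition surface_poly :: "nat \<Rightarrow> complex \<Rightarrow> real" where
  "surface_poly g w = ((4 * real g + 1)\<^sup>2 - (cmod w)\<^sup>2) * (\<Prod>i<g. (cmod (w - of_nat (4 * i)))\<^sup>2 - 1)"

text \<open>The height over x of the circle bounding a hole, and 0 between the holes. The centres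
  are 4 apart and the radii are 1, so at most one summand is positive; as a sum of maxima the
  function is visibly continuous.\<close>

definition hole_arc :: "nat \<Rightarrow> real \<Rightarrow> real" where
  "hole_arc g x = sqrt (\<Sum>k<g. max 0 (1 - (x - 4 * real k)\<^sup>2))"

definition outer_arc :: "nat \<Rightarrow> real \<Rightarrow> real" where
  "outer_arc g x = sqrt (max 0 ((4 * real g + 1)\<^sup>2 - x\<^sup>2))"

lemma mem_genus_surface: "(w, z) \<in> genus_surface g \<longleftrightarrow> z\<^sup>2 = surface_poly g w"
  unfolding genus_surface_def surface_poly_def by simp

lemma cmod_hole: "(cmod (w - of_nat (4 * k)))\<^sup>2 = (Re w - 4 * real k)\<^sup>2 + (Im w)\<^sup>2"
  by (simp add: cmod_power2)

text \<open>A point outside the outer circle is outside all holes, and a point of a hole is inside the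
  outer circle and outside the other holes; in both cases exactly one factor is negative.\<close>

lemma surface_poly_nonneg:
  assumes F: "0 \<le> surface_poly g w"
  shows "cmod w \<le> 4 * real g + 1" and "\<And>k. k < g \<Longrightarrow> 1 \<le> cmod (w - of_nat (4 * k))"
proof -
  have norm_k: "cmod (of_nat (4 * k)) = 4 * real k" for k unfolding norm_of_nat by simp
  show out: "cmod w \<le> 4 * real g + 1"
  proof (rule ccontr)
    assume "\<not> ?thesis"
    then have big: "4 * real g + 1 < cmod w" by simp
    have pos: "0 < (cmod (w - of_nat (4 * k)))\<^sup>2 - 1" if "k < g" for k
    proof -
      have "cmod w - cmod (of_nat (4 * k)) \<le> cmod (w - of_nat (4 * k))" by (rule norm_triangle_ineq2)
      moreover have "4 * real k + 4 \<le> 4 * real g" using that by simp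
      ultimately have "1 < cmod (w - of_nat (4 * k))" using big unfolding norm_k by linarith
      then show ?thesis using one_less_power[of "cmod (w - of_nat (4 * k))" 2] by simp
    qed
    have "0 < (\<Prod>k<g. (cmod (w - of_nat (4 * k)))\<^sup>2 - 1)" using pos by (intro prod_pos) auto
    moreover have "(4 * real g + 1)\<^sup>2 < (cmod w)\<^sup>2" using big by (intro power_strict_mono) auto
    ultimately have "surface_poly g w < 0" unfolding surface_poly_def by (intro mult_neg_pos) auto
    then show False using F by simp
  qed
  show "1 \<le> cmod (w - of_nat (4 * k))" if k: "k < g" for k
  proof (rule ccontr)
    assume "\<not> ?thesis"
    then have small: "cmod (w - of_nat (4 * k)) < 1" by simp
    have pos: "0 < (cmod (w - of_nat (4 * l)))\<^sup>2 - 1" if l: "l \<noteq> k" for l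
    proof -
      have "cmod (of_nat (4 * k) - of_nat (4 * l)) = cmod (of_int (4 * (int k - int l)))" by simp
      also have "\<dots> = real_of_int \<bar>4 * (int k - int l)\<bar>" by (simp only: norm_of_int of_int_abs)
      finally have eq: "cmod (of_nat (4 * k) - of_nat (4 * l)) = real_of_int \<bar>4 * (int k - int l)\<bar>" .
      have "4 \<le> \<bar>4 * (int k - int l)\<bar>" using l by presburger
      then have "4 \<le> cmod (of_nat (4 * k) - of_nat (4 * l))" unfolding eq by linarith
      moreover have "of_nat (4 * k) - of_nat (4 * l) = (w - of_nat (4 * l)) - (w - of_nat (4 * k))" by simp
      ultimately have "4 \<le> cmod ((w - of_nat (4 * l)) - (w - of_nat (4 * k)))" by (simp only:)
      also have "\<dots> \<le> cmod (w - of_nat (4 * l)) + cmod (w - of_nat (4 * k))" by (rule norm_triangle_ineq4)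
      finally have "1 < cmod (w - of_nat (4 * l))" using small by linarith
      then show ?thesis using one_less_power[of "cmod (w - of_nat (4 * l))" 2] by simp
    qed
    have p1: "0 < (\<Prod>l\<in>{..<g} - {k}. (cmod (w - of_nat (4 * l)))\<^sup>2 - 1)" using pos by (intro prod_pos) auto
    have "(cmod (w - of_nat (4 * k)))\<^sup>2 < 1" using small by (simp add: abs_square_less_1)
    then have p2: "(cmod (w - of_nat (4 * k)))\<^sup>2 - 1 < 0" by linarith
    have p3: "(\<Prod>l<g. (cmod (w - of_nat (4 * l)))\<^sup>2 - 1)
        = ((cmod (w - of_nat (4 * k)))\<^sup>2 - 1) * (\<Prod>l\<in>{..<g} - {k}. (cmod (w - of_nat (4 * l)))\<^sup>2 - 1)"
      using k by (intro prod.remove) auto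
    have neg: "(\<Prod>l<g. (cmod (w - of_nat (4 * l)))\<^sup>2 - 1) < 0"
      unfolding p3 by (rule mult_neg_pos[OF p2 p1])
    have "cmod w \<le> cmod (w - of_nat (4 * k)) + cmod (of_nat (4 * k))" 
      using norm_triangle_sub[of w "of_nat (4 * k)"] by linarith
    then have "cmod w < 4 * real g + 1" using small k unfolding norm_k by linarith
    then have "(cmod w)\<^sup>2 < (4 * real g + 1)\<^sup>2" by (intro power_strict_mono) auto
    then have "surface_poly g w < 0" unfolding surface_poly_def using neg by (intro mult_pos_neg) auto
    then show False using F by simp
  qed
qed

lemma hole_arc_nonneg: "0 \<le> hole_arc g x"
  unfolding hole_arc_def by (simp add: sum_nonneg)

lemma outer_arc_nonneg: "0 \<le> outer_arc g x"
  unfolding outer_arc_def by simp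

lemma hole_arc_ge: "k < g \<Longrightarrow> 1 - (x - 4 * real k)\<^sup>2 \<le> (hole_arc g x)\<^sup>2"
proof -
  assume k: "k < g"
  have "max 0 (1 - (x - 4 * real k)\<^sup>2) \<le> (\<Sum>k<g. max 0 (1 - (x - 4 * real k)\<^sup>2))"
    using k by (intro member_le_sum) auto
  then show ?thesis unfolding hole_arc_def by (simp add: sum_nonneg)
qed

lemma hole_arc_le:
  assumes y: "\<And>k. k < g \<Longrightarrow> 1 \<le> (x - 4 * real k)\<^sup>2 + y\<^sup>2" and y0: "0 \<le> y"
  shows "hole_arc g x \<le> y"
proof -
  have "(\<Sum>k<g. max 0 (1 - (x - 4 * real k)\<^sup>2)) \<le> y\<^sup>2"
  proof (cases "\<exists>k<g. (x - 4 * real k)\<^sup>2 < 1")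
    case True
    then obtain k where k: "k < g" "(x - 4 * real k)\<^sup>2 < 1" by auto
    have zero: "max 0 (1 - (x - 4 * real l)\<^sup>2) = 0" if "l \<noteq> k" for l
    proof -
      have "\<bar>x - 4 * real k\<bar> < 1" using k(2) by (simp add: abs_square_less_1)
      moreover have "1 \<le> \<bar>real k - real l\<bar>"
      proof -
        have "k + 1 \<le> l \<or> l + 1 \<le> k" using that by linarith
        then show ?thesis by (elim disjE) linarith+
      qed
      ultimately have "1 \<le> \<bar>x - 4 * real l\<bar>" by linarith
      then have "1 \<le> (x - 4 * real l)\<^sup>2" using one_le_power[of "\<bar>x - 4 * real l\<bar>" 2] by simp
      then show ?thesis by simp
    qed
    have "(\<Sum>k<g. max 0 (1 - (x - 4 * real k)\<^sup>2)) = max 0 (1 - (x - 4 * real k)\<^sup>2)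
        + (\<Sum>l\<in>{..<g} - {k}. max 0 (1 - (x - 4 * real l)\<^sup>2))"
      using k by (intro sum.remove) auto
    also have "(\<Sum>l\<in>{..<g} - {k}. max 0 (1 - (x - 4 * real l)\<^sup>2)) = 0"
      using zero by (intro sum.neutral) auto
    finally show ?thesis using y[OF k(1)] by simp
  next
    case False
    have "max 0 (1 - (x - 4 * real k)\<^sup>2) = 0" if "k < g" for k
    proof -
      have "1 \<le> (x - 4 * real k)\<^sup>2" using False that by (meson not_less)
      then show ?thesis by simp
    qed
    then have "(\<Sum>k<g. max 0 (1 - (x - 4 * real k)\<^sup>2)) = 0" by (intro sum.neutral) auto
    then show ?thesis by simp
  qed
  then show ?thesis unfolding hole_arc_def using y0 by (simp add: real_le_lsqrt)
qed

text \<open>Over a real part x the surface lies in the strip between the two arcs. The last two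
  claims locate the seams: the sheets meet only on the boundary circles, and the half-planes only on
  the axis outside the open holes.\<close>

lemma surface_fibre:
  assumes "(w, z) \<in> genus_surface g"
  shows "\<bar>Re w\<bar> \<le> 4 * real g + 1" "hole_arc g (Re w) \<le> \<bar>Im w\<bar>" "\<bar>Im w\<bar> \<le> outer_arc g (Re w)"
    and "z = 0 \<Longrightarrow> \<bar>Im w\<bar> = outer_arc g (Re w) \<or>
      (\<exists>k<g. \<bar>Re w - 4 * real k\<bar> \<le> 1 \<and> \<bar>Im w\<bar> = hole_arc g (Re w))"
    and "Im w = 0 \<Longrightarrow> hole_arc g (Re w) = 0 \<and> (\<forall>k<g. 1 \<le> \<bar>Re w - 4 * real k\<bar>)"
proof -
  have z: "z\<^sup>2 = surface_poly g w" using assms by (simp add: mem_genus_surface)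
  have F: "0 \<le> surface_poly g w" unfolding z[symmetric] by simp
  note R = surface_poly_nonneg(1)[OF F] and H = surface_poly_nonneg(2)[OF F]
  show xR: "\<bar>Re w\<bar> \<le> 4 * real g + 1" using abs_Re_le_cmod[of w] R by linarith
  have H2: "1 \<le> (Re w - 4 * real k)\<^sup>2 + (Im w)\<^sup>2" if "k < g" for k
    using one_le_power[OF H[OF that], of 2] unfolding cmod_hole .
  show hole: "hole_arc g (Re w) \<le> \<bar>Im w\<bar>" by (rule hole_arc_le) (use H2 in auto)
  have "(cmod w)\<^sup>2 \<le> (4 * real g + 1)\<^sup>2" using R by (intro power_mono) auto
  then have R2: "(Im w)\<^sup>2 \<le> (4 * real g + 1)\<^sup>2 - (Re w)\<^sup>2" unfolding cmod_power2 by linarith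
  have "\<bar>Im w\<bar> = sqrt ((Im w)\<^sup>2)" by simp
  also have "\<dots> \<le> outer_arc g (Re w)" unfolding outer_arc_def using R2 by (intro real_sqrt_le_mono) auto
  finally show out: "\<bar>Im w\<bar> \<le> outer_arc g (Re w)" .
  show "\<bar>Im w\<bar> = outer_arc g (Re w) \<or> (\<exists>k<g. \<bar>Re w - 4 * real k\<bar> \<le> 1 \<and> \<bar>Im w\<bar> = hole_arc g (Re w))" if "z = 0"
  proof -
    have "(4 * real g + 1)\<^sup>2 - (cmod w)\<^sup>2 = 0 \<or> (\<exists>k<g. (cmod (w - of_nat (4 * k)))\<^sup>2 - 1 = 0)"
      using z that unfolding surface_poly_def by (auto simp: prod_zero_iff)
    then show ?thesis
    proof
      assume "(4 * real g + 1)\<^sup>2 - (cmod w)\<^sup>2 = 0"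
      then have "(4 * real g + 1)\<^sup>2 - (Re w)\<^sup>2 = (Im w)\<^sup>2" unfolding cmod_power2 by linarith
      then have "outer_arc g (Re w) = \<bar>Im w\<bar>" unfolding outer_arc_def by simp
      then show ?thesis by simp
    next
      assume "\<exists>k<g. (cmod (w - of_nat (4 * k)))\<^sup>2 - 1 = 0"
      then obtain k where k: "k < g" "(Re w - 4 * real k)\<^sup>2 + (Im w)\<^sup>2 = 1" unfolding cmod_hole by auto
      have "(Re w - 4 * real k)\<^sup>2 \<le> 1" using k(2) zero_le_power2[of "Im w"] by linarith
      then have "\<bar>Re w - 4 * real k\<bar> \<le> 1" by (simp add: abs_square_le_1)
      moreover have "\<bar>Im w\<bar>\<^sup>2 \<le> (hole_arc g (Re w))\<^sup>2" using hole_arc_ge[OF k(1), of "Re w"] k(2) by simp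
      then have "\<bar>Im w\<bar> \<le> hole_arc g (Re w)" by (rule power2_le_imp_le[OF _ hole_arc_nonneg])
      ultimately show ?thesis using k(1) hole by auto
    qed
  qed
  show "hole_arc g (Re w) = 0 \<and> (\<forall>k<g. 1 \<le> \<bar>Re w - 4 * real k\<bar>)" if "Im w = 0"
  proof
    show "hole_arc g (Re w) = 0" using hole hole_arc_nonneg[of g "Re w"] that by simp
    show "\<forall>k<g. 1 \<le> \<bar>Re w - 4 * real k\<bar>"
    proof (intro allI impI)
      fix k assume "k < g"
      then have "1 \<le> (Re w - 4 * real k)\<^sup>2" using H2[of k] that by simp
      then show "1 \<le> \<bar>Re w - 4 * real k\<bar>" using abs_square_less_1[of "Re w - 4 * real k"] by linarith
    qed
  qed
qed

text \<open>A rectangle is stretched over a half-sheet; the second coordinate is the fraction of the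
  way from the hole arc to the outer arc. The absolute value makes \<open>h\<close> nonnegative at
  every parameter, so that \<sigma> alone decides the sign of the last coordinate.\<close>

definition half_sheet :: "nat \<Rightarrow> bool \<Rightarrow> bool \<Rightarrow> real \<times> real \<Rightarrow> complex \<times> real" where
  "half_sheet g \<sigma> \<tau> p =
     (let x = fst p; y = hole_arc g x + (outer_arc g x - hole_arc g x) * snd p;
          w = Complex x (if \<tau> then y else - y); h = sqrt \<bar>surface_poly g w\<bar>
      in (w, if \<sigma> then h else - h))"

lemma half_sheet_continuous: "continuous_on UNIV (half_sheet g \<sigma> \<tau>)"
proof -
  have arcs: "continuous_on UNIV (hole_arc g)" "continuous_on UNIV (outer_arc g)"
    unfolding hole_arc_def[abs_def] outer_arc_def[abs_def] by (intro continuous_intros)+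
  have poly: "continuous_on UNIV (surface_poly g)"
    unfolding surface_poly_def[abs_def] by (intro continuous_intros)
  have Y: "continuous_on UNIV (\<lambda>p. hole_arc g (fst p) + (outer_arc g (fst p) - hole_arc g (fst p)) * snd p)"
    by (intro continuous_intros continuous_on_compose2[OF arcs(1)] continuous_on_compose2[OF arcs(2)]) auto
  have W: "continuous_on UNIV (\<lambda>p. Complex (fst p) (if \<tau> then f p else - f p))"
    if "continuous_on UNIV f" for f :: "real \<times> real \<Rightarrow> real"
    unfolding Complex_eq using that by (cases \<tau>) (auto intro!: continuous_intros)
  have H: "continuous_on UNIV (\<lambda>p. sqrt \<bar>surface_poly g (f p)\<bar>)"
    if "continuous_on UNIV f" for f :: "real \<times> real \<Rightarrow> complex"
    by (intro continuous_intros continuous_on_compose2[OF poly that]) auto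
  show ?thesis
    unfolding half_sheet_def Let_def
    by (cases \<sigma>) (simp_all, (intro continuous_intros W[OF Y] H[OF W[OF Y]])+)
qed

text \<open>At 0 both signs are accepted, as the points of a seam belong to both sides.\<close>

definition sign_ok :: "bool \<Rightarrow> real \<Rightarrow> bool" where
  "sign_ok \<sigma> z \<longleftrightarrow> (if \<sigma> then 0 \<le> z else z \<le> 0)"

lemma half_sheet_mem:
  assumes wz: "(w, z) \<in> genus_surface g" and \<theta>: "\<theta> \<in> {0..1}"
  shows "half_sheet g \<sigma> \<tau> (x, \<theta>) = (w, z) \<longleftrightarrow> sign_ok \<sigma> z \<and> sign_ok \<tau> (Im w) \<and> x = Re w \<and>
    hole_arc g x + (outer_arc g x - hole_arc g x) * \<theta> = \<bar>Im w\<bar>"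
proof -
  define y where "y = hole_arc g x + (outer_arc g x - hole_arc g x) * \<theta>"
  have "y = (1 - \<theta>) * hole_arc g x + \<theta> * outer_arc g x" unfolding y_def by (simp add: algebra_simps)
  moreover have "0 \<le> (1 - \<theta>) * hole_arc g x" "0 \<le> \<theta> * outer_arc g x"
    using \<theta> hole_arc_nonneg[of g x] outer_arc_nonneg[of g x] by auto
  ultimately have y0: "0 \<le> y" by linarith
  have F: "surface_poly g w = z\<^sup>2" using wz unfolding mem_genus_surface by simp
  have z: "sqrt \<bar>surface_poly g w\<bar> = \<bar>z\<bar>" unfolding F by simp
  have eq: "half_sheet g \<sigma> \<tau> (x, \<theta>) = (w, z) \<longleftrightarrow>
      Complex x (if \<tau> then y else - y) = w \<and> (if \<sigma> then \<bar>z\<bar> else - \<bar>z\<bar>) = z"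
    unfolding half_sheet_def Let_def fst_conv snd_conv y_def[symmetric] prod.inject using z by auto
  show ?thesis
    unfolding eq y_def[symmetric] sign_ok_def complex_eq_iff using y0 by (auto split: if_splits)
qed

section \<open>Columns, holes and tiles of the surface\<close>

definition hole_column :: "nat \<Rightarrow> nat \<Rightarrow> nat \<Rightarrow> bool" where
  "hole_column g m i \<longleftrightarrow> (\<exists>k<g. 4 * (g + k) * m \<le> i \<and> i < (4 * (g + k) + 2) * m)"

text \<open>The disc has diameter 8g + 2, hence (8g + 2)m columns. Their type can change only at the
  two ends of each hole.\<close>

lemma hole_column_grid:
  assumes m: "1 \<le> m"
  shows "column_grid ((8 * g + 2) * m) m (hole_column g m) g"
proof
  have "2 * 1 \<le> (8 * g + 2) * m" using m by (intro mult_mono) auto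
  then show "2 \<le> (8 * g + 2) * m" by simp
  show "1 \<le> m" by (rule m)
  show "\<not> hole_column g m 0" unfolding hole_column_def using m by auto
  let ?S = "{i. 1 \<le> i \<and> i < (8 * g + 2) * m \<and> hole_column g m (i - 1) \<noteq> hole_column g m i}"
  let ?h = "\<lambda>(b, k). (4 * (g + k) + (if b then 2 else 0)) * m"
  have "?S \<subseteq> ?h ` (UNIV \<times> {..<g})"
  proof
    fix i assume i: "i \<in> ?S"
    have "\<exists>b. \<exists>k<g. i = ?h (b, k)"
    proof (cases "hole_column g m i")
      case True
      then obtain k where k: "k < g" "4 * (g + k) * m \<le> i" "i < (4 * (g + k) + 2) * m"
        unfolding hole_column_def by blast
      have "\<not> 4 * (g + k) * m \<le> i - 1"
        using i True k unfolding hole_column_def by (metis (mono_tags, lifting) less_imp_diff_less mem_Collect_eq)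
      then have "i = ?h (False, k)" using k(2) by simp
      then show ?thesis using k(1) by blast
    next
      case False
      then have "hole_column g m (i - 1)" using i by simp
      then obtain k where k: "k < g" "4 * (g + k) * m \<le> i - 1" "i - 1 < (4 * (g + k) + 2) * m"
        unfolding hole_column_def by blast
      have "4 * (g + k) * m \<le> i" using k(2) by simp
      then have "\<not> i < (4 * (g + k) + 2) * m" using False k(1) unfolding hole_column_def by blast
      then have "i = ?h (True, k)" using k(3) i by simp
      then show ?thesis using k(1) by blast
    qed
    then obtain b k where "k < g" "i = ?h (b, k)" by blast
    then show "i \<in> ?h ` (UNIV \<times> {..<g})" by (intro image_eqI[of _ _ "(b, k)"]) simp_all
  qed
  then have "card ?S \<le> card (?h ` (UNIV \<times> {..<g}))" by (intro card_mono) auto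
  also have "\<dots> \<le> card ((UNIV :: bool set) \<times> {..<g})" by (rule card_image_le) simp
  also have "\<dots> = 2 * g" by (simp add: card_cartesian_product)
  finally show "card ?S \<le> 2 * g" .
qed

text \<open>Rounding down finds the column, except at the right end of the hole, where the column to
  the left has to be taken.\<close>

lemma column_in_hole:
  assumes m: "1 \<le> m" and k: "k < g" and t: "real (4 * (g + k) * m) \<le> t" "t \<le> real ((4 * (g + k) + 2) * m)"
  shows "\<exists>i<(8 * g + 2) * m. real i \<le> t \<and> t \<le> real i + 1 \<and> hole_column g m i"
proof -
  have ub: "(4 * (g + k) + 2) * m \<le> (8 * g + 2) * m" using k by (intro mult_right_mono) auto
  have lt: "4 * (g + k) * m < (4 * (g + k) + 2) * m" using m by simp
  show ?thesis
  proof (cases "t < (4 * (g + k) + 2) * m")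
    case True
    define i where "i = nat \<lfloor>t\<rfloor>"
    have t0: "0 \<le> t" using t(1) by (meson of_nat_0_le_iff order_trans)
    have i: "real i \<le> t" "t < real i + 1" unfolding i_def using t0 by linarith+
    have "real (4 * (g + k) * m) < real (i + 1)" using t(1) i(2) by linarith
    then have lo: "4 * (g + k) * m \<le> i" unfolding of_nat_less_iff by simp
    have "real i < real ((4 * (g + k) + 2) * m)" using i(1) True by linarith
    then have hi: "i < (4 * (g + k) + 2) * m" unfolding of_nat_less_iff .
    have "hole_column g m i" unfolding hole_column_def using lo hi k by blast
    then show ?thesis using i hi ub by (intro exI[of _ i]) linarith
  next
    case False
    define i where "i = (4 * (g + k) + 2) * m - 1"
    have Suc: "i + 1 = (4 * (g + k) + 2) * m" unfolding i_def using lt by simp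
    then have "t = real (i + 1)" using False t(2) by simp
    moreover have lo: "4 * (g + k) * m \<le> i" and hi: "i < (4 * (g + k) + 2) * m" using Suc lt by linarith+
    moreover have "hole_column g m i" unfolding hole_column_def using lo hi k by blast
    moreover have "i < (8 * g + 2) * m" using hi ub by linarith
    ultimately show ?thesis by (intro exI[of _ i]) simp
  qed
qed

text \<open>Rounding down fails at the left end of a hole and at the right end of the disc, where
  the column to the left is taken instead. It lies in no other hole because consecutive holes are 2m
  columns apart.\<close>

lemma column_off_holes:
  assumes m: "1 \<le> m" and t: "0 \<le> t" "t \<le> real ((8 * g + 2) * m)"
    and off: "\<And>k. k < g \<Longrightarrow> t \<le> real (4 * (g + k) * m) \<or> real ((4 * (g + k) + 2) * m) \<le> t"
  shows "\<exists>i<(8 * g + 2) * m. real i \<le> t \<and> t \<le> real i + 1 \<and> \<not> hole_column g m i"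
proof -
  consider k where "k < g" "t = real (4 * (g + k) * m)" | "t = real ((8 * g + 2) * m)"
    | "\<And>k. k < g \<Longrightarrow> t \<noteq> real (4 * (g + k) * m)" "t < real ((8 * g + 2) * m)"
    using t(2) by (metis order_le_imp_less_or_eq)
  then show ?thesis
  proof cases
    case (1 k)
    define i where "i = 4 * (g + k) * m - 1"
    have "1 \<le> 4 * (g + k) * m" using 1 m by (simp add: Suc_le_eq)
    then have Suc: "i + 1 = 4 * (g + k) * m" unfolding i_def by linarith
    have "4 * (g + k) * m \<le> (8 * g + 2) * m" using 1 by (intro mult_right_mono) auto
    moreover have "\<not> hole_column g m i"
    proof
      assume "hole_column g m i"
      then obtain l where l: "l < g" "4 * (g + l) * m \<le> i" "i < (4 * (g + l) + 2) * m"
        unfolding hole_column_def by blast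
      have "4 * (g + l) * m < 4 * (g + k) * m" using l(2) Suc by linarith
      then have "l < k" by simp
      then have "(4 * (g + l) + 4) * m \<le> 4 * (g + k) * m" by (intro mult_right_mono) auto
      then show False using l(3) Suc m by (simp add: algebra_simps)
    qed
    moreover have "t = real (i + 1)" unfolding Suc by (rule 1(2))
    moreover have "i < (8 * g + 2) * m" using Suc calculation(1) by linarith
    ultimately show ?thesis by (intro exI[of _ i]) simp
  next
    case 2
    define i where "i = (8 * g + 2) * m - 1"
    have "1 * 1 \<le> (8 * g + 2) * m" using m by (intro mult_mono) auto
    then have Suc: "i + 1 = (8 * g + 2) * m" unfolding i_def by linarith
    have "\<not> hole_column g m i"
    proof
      assume "hole_column g m i"
      then obtain l where l: "l < g" "i < (4 * (g + l) + 2) * m" unfolding hole_column_def by blast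
      have "(4 * (g + l) + 2) * m \<le> (8 * g) * m" using l(1) by (intro mult_right_mono) auto
      then have "(4 * (g + l) + 2) * m + 2 * m \<le> (8 * g + 2) * m" by (simp add: algebra_simps)
      then show False using l(2) Suc m by linarith
    qed
    moreover have "t = real (i + 1)" unfolding Suc by (rule 2)
    moreover have "i < (8 * g + 2) * m" using Suc by linarith
    ultimately show ?thesis by (intro exI[of _ i]) simp
  next
    case 3
    define i where "i = nat \<lfloor>t\<rfloor>"
    have i: "real i \<le> t" "t < real i + 1" unfolding i_def using t(1) by linarith+
    have "\<not> hole_column g m i"
    proof
      assume "hole_column g m i"
      then obtain l where l: "l < g" "4 * (g + l) * m \<le> i" "i < (4 * (g + l) + 2) * m"
        unfolding hole_column_def by blast
      have "real (4 * (g + l) * m) \<le> real i" using l(2) unfolding of_nat_le_iff .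
      then have "real (4 * (g + l) * m) \<le> t" using i(1) by linarith
      moreover have "real (i + 1) \<le> real ((4 * (g + l) + 2) * m)" using l(3) unfolding of_nat_le_iff by simp
      then have "t < real ((4 * (g + l) + 2) * m)" using i(2) by linarith
      ultimately show False using off[OF l(1)] 3(1)[OF l(1)] by linarith
    qed
    moreover have "real i < real ((8 * g + 2) * m)" using i(1) 3(2) by linarith
    then have "i < (8 * g + 2) * m" unfolding of_nat_less_iff .
    ultimately show ?thesis using i by (intro exI[of _ i]) auto
  qed
qed

lemma unit_row:
  assumes m: "1 \<le> m" and \<theta>: "0 \<le> \<theta>" "\<theta> \<le> (1::real)"
  shows "\<exists>j<m. \<theta> \<in> {real j / m .. (real j + 1) / m}"
proof (cases "\<theta> = 1")
  case True
  then show ?thesis using m by (intro exI[of _ "m - 1"]) (auto simp: of_nat_diff divide_le_eq)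
next
  case False
  define j where "j = nat \<lfloor>\<theta> * m\<rfloor>"
  have "0 \<le> \<theta> * m" using \<theta> by simp
  then have j: "real j \<le> \<theta> * m" "\<theta> * m < real j + 1" unfolding j_def by linarith+
  have "\<theta> * m < 1 * real m" using False \<theta> m by (intro mult_strict_right_mono) auto
  then have "j < m" using j(1) by linarith
  then show ?thesis using j m by (intro exI[of _ j]) (auto simp: divide_le_eq le_divide_eq)
qed

definition surface_tile :: "nat \<Rightarrow> nat \<Rightarrow> cell \<Rightarrow> (complex \<times> real) set" where
  "surface_tile g m = (\<lambda>(\<sigma>, \<tau>, i, j). half_sheet g \<sigma> \<tau> `
     ({real i / m - (4 * real g + 1) .. (real i + 1) / m - (4 * real g + 1)} \<times> {real j / m .. (real j + 1) / m}))"

text \<open>Each of the two signs, the column and the row is subject to a condition of its own, so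
  the cells at a given point form a product set, as \<open>product_connected\<close>
  requires.\<close>

lemma surface_tile_mem:
  assumes wz: "(w, z) \<in> genus_surface g" and m: "1 \<le> m" and j: "j < m"
  shows "(w, z) \<in> surface_tile g m (\<sigma>, \<tau>, i, j) \<longleftrightarrow> sign_ok \<sigma> z \<and> sign_ok \<tau> (Im w) \<and>
    real i \<le> (Re w + (4 * real g + 1)) * m \<and> (Re w + (4 * real g + 1)) * m \<le> real i + 1 \<and>
    (\<exists>\<theta>\<in>{real j / m .. (real j + 1) / m}. hole_arc g (Re w) + (outer_arc g (Re w) - hole_arc g (Re w)) * \<theta> = \<bar>Im w\<bar>)"
proof -
  let ?X = "{real i / m - (4 * real g + 1) .. (real i + 1) / m - (4 * real g + 1)}"
  let ?T = "{real j / m .. (real j + 1) / m}"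
  have m0: "0 < real m" using m by simp
  have T01: "?T \<subseteq> {0..1}"
  proof -
    have "0 \<le> real j / m" "(real j + 1) / m \<le> 1" using j m0 by (auto simp: divide_le_eq)
    then show ?thesis by auto
  qed
  have X: "x \<in> ?X \<longleftrightarrow> real i \<le> (x + (4 * real g + 1)) * m \<and> (x + (4 * real g + 1)) * m \<le> real i + 1" for x
    using m0 by (auto simp: divide_le_eq le_divide_eq algebra_simps diff_le_eq le_diff_eq)
  have "(w, z) \<in> surface_tile g m (\<sigma>, \<tau>, i, j) \<longleftrightarrow> (\<exists>x\<in>?X. \<exists>\<theta>\<in>?T. half_sheet g \<sigma> \<tau> (x, \<theta>) = (w, z))"
    unfolding surface_tile_def prod.case image_iff by (auto simp: eq_commute)
  also have "\<dots> \<longleftrightarrow> (\<exists>x\<in>?X. \<exists>\<theta>\<in>?T. sign_ok \<sigma> z \<and> sign_ok \<tau> (Im w) \<and> x = Re w \<and>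
      hole_arc g x + (outer_arc g x - hole_arc g x) * \<theta> = \<bar>Im w\<bar>)"
    using half_sheet_mem[OF wz] T01 by (intro bex_cong refl) blast
  also have "\<dots> \<longleftrightarrow> sign_ok \<sigma> z \<and> sign_ok \<tau> (Im w) \<and> Re w \<in> ?X \<and>
      (\<exists>\<theta>\<in>?T. hole_arc g (Re w) + (outer_arc g (Re w) - hole_arc g (Re w)) * \<theta> = \<bar>Im w\<bar>)" by auto
  finally show ?thesis unfolding X by blast
qed

lemma surface_column_range:
  assumes wz: "(w, z) \<in> genus_surface g"
  shows "0 \<le> (Re w + (4 * real g + 1)) * real m" "(Re w + (4 * real g + 1)) * real m \<le> real ((8 * g + 2) * m)"
proof -
  have r: "0 \<le> Re w + (4 * real g + 1)" "Re w + (4 * real g + 1) \<le> 8 * real g + 2"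
    using surface_fibre(1)[OF wz] by linarith+
  show "0 \<le> (Re w + (4 * real g + 1)) * real m" using r(1) by simp
  have "(Re w + (4 * real g + 1)) * real m \<le> (8 * real g + 2) * real m"
    by (rule mult_right_mono[OF r(2)]) simp
  also have "\<dots> = real ((8 * g + 2) * m)" by (simp add: algebra_simps)
  finally show "(Re w + (4 * real g + 1)) * real m \<le> real ((8 * g + 2) * m)" .
qed

lemma surface_tile_cover:
  assumes wz: "(w, z) \<in> genus_surface g" and m: "1 \<le> m"
  shows "\<exists>\<sigma> \<tau>. \<exists>i<(8 * g + 2) * m. \<exists>j<m. (w, z) \<in> surface_tile g m (\<sigma>, \<tau>, i, j)"
proof -
  note fib = surface_fibre[OF wz]
  let ?t = "(Re w + (4 * real g + 1)) * m"
  note t = surface_column_range[OF wz, of m]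
  have "\<exists>i<(8 * g + 2) * m. real i \<le> ?t \<and> ?t \<le> real i + 1"
  proof (cases "\<exists>k<g. real (4 * (g + k) * m) \<le> ?t \<and> ?t \<le> real ((4 * (g + k) + 2) * m)")
    case True
    then show ?thesis using column_in_hole[OF m] by blast
  next
    case False
    have "?t \<le> real (4 * (g + k) * m) \<or> real ((4 * (g + k) + 2) * m) \<le> ?t" if "k < g" for k
    proof -
      have "\<not> (real (4 * (g + k) * m) \<le> ?t \<and> ?t \<le> real ((4 * (g + k) + 2) * m))"
        using False that by blast
      then show ?thesis by linarith
    qed
    then have "\<exists>i<(8 * g + 2) * m. real i \<le> ?t \<and> ?t \<le> real i + 1 \<and> \<not> hole_column g m i"
      by (rule column_off_holes[OF m t])
    then show ?thesis by blast
  qed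
  then obtain i where i: "i < (8 * g + 2) * m" "real i \<le> ?t" "?t \<le> real i + 1" by blast
  define a b where "a = hole_arc g (Re w)" and "b = outer_arc g (Re w)"
  have "\<exists>\<theta>. 0 \<le> \<theta> \<and> \<theta> \<le> 1 \<and> a + (b - a) * \<theta> = \<bar>Im w\<bar>"
  proof (cases "a = b")
    case True
    \<comment> \<open>The strip has height 0 here, so any fraction will do.\<close>
    then show ?thesis using fib(2,3) unfolding a_def b_def by (intro exI[of _ 0]) auto
  next
    case False
    then show ?thesis using fib(2,3) unfolding a_def b_def
      by (intro exI[of _ "(\<bar>Im w\<bar> - hole_arc g (Re w)) / (outer_arc g (Re w) - hole_arc g (Re w))"])
        (auto simp: divide_le_eq zero_le_divide_iff)
  qed
  then obtain \<theta> where \<theta>: "0 \<le> \<theta>" "\<theta> \<le> 1" "a + (b - a) * \<theta> = \<bar>Im w\<bar>" by blast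
  obtain j where j: "j < m" "\<theta> \<in> {real j / m .. (real j + 1) / m}" using unit_row[OF m \<theta>(1,2)] by blast
  have "(w, z) \<in> surface_tile g m (0 \<le> z, 0 \<le> Im w, i, j)"
    unfolding surface_tile_mem[OF wz m j(1)] sign_ok_def
    using i j \<theta>(3) unfolding a_def b_def by auto
  then show ?thesis using i(1) j(1) by blast
qed

text \<open>If z = 0, both sheets are present, and the point lies on the outer circle, in the top
  row, or on the circle of a hole, in the bottom row of a hole column. On the axis both half-planes
  are present, and the point is in the bottom row of a column outside the holes. These are the
  gluing places that connect the product set.\<close>

lemma surface_tiles_connected:
  assumes wz: "(w, z) \<in> genus_surface g" and m: "1 \<le> m"
  shows "tile_complex.tile_connected (column_grid.sides ((8 * g + 2) * m) m (hole_column g m))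
      (column_grid.side_cells m (hole_column g m))
      {x \<in> column_grid.cells ((8 * g + 2) * m) m. (w, z) \<in> surface_tile g m x}"
proof -
  interpret column_grid "(8 * g + 2) * m" m "hole_column g m" g by (rule hole_column_grid[OF m])
  note fib = surface_fibre[OF wz]
  define t where "t = (Re w + (4 * real g + 1)) * m"
  define a b where "a = hole_arc g (Re w)" and "b = outer_arc g (Re w)"
  define \<Sigma> where "\<Sigma> = {\<sigma>. sign_ok \<sigma> z}"
  define \<Theta> where "\<Theta> = {\<tau>. sign_ok \<tau> (Im w)}"
  define I where "I = {i. i < (8 * g + 2) * m \<and> real i \<le> t \<and> t \<le> real i + 1}"
  define J where "J = {j. j < m \<and> (\<exists>\<theta>\<in>{real j / m .. (real j + 1) / m}. a + (b - a) * \<theta> = \<bar>Im w\<bar>)}"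
  have m0: "0 < real m" using m by simp
  have eq: "{x \<in> cells. (w, z) \<in> surface_tile g m x} = \<Sigma> \<times> \<Theta> \<times> I \<times> J"
  proof (rule set_eqI)
    fix x :: cell
    obtain \<sigma> \<tau> i j where x: "x = (\<sigma>, \<tau>, i, j)" by (rule prod_cases4)
    show "x \<in> {x \<in> cells. (w, z) \<in> surface_tile g m x} \<longleftrightarrow> x \<in> \<Sigma> \<times> \<Theta> \<times> I \<times> J"
    proof (cases "j < m")
      case True
      show ?thesis
        unfolding x mem_Collect_eq surface_tile_mem[OF wz m True] \<Sigma>_def \<Theta>_def I_def J_def t_def a_def b_def cells_def
        using True by simp blast
    next
      case False
      then show ?thesis unfolding x cells_def J_def by simp
    qed
  qed
  have marks: "real (4 * (g + k) * m) = 4 * (real g + real k) * real m"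
      "real ((4 * (g + k) + 2) * m) = (4 * (real g + real k) + 2) * real m" for k
    by (simp_all add: algebra_simps)
  have scale: "t \<le> real (4 * (g + k) * m) \<or> real ((4 * (g + k) + 2) * m) \<le> t"
    if k: "1 \<le> \<bar>Re w - 4 * real k\<bar>" for k
  proof -
    have "Re w + (4 * real g + 1) \<le> 4 * (real g + real k) \<or> 4 * (real g + real k) + 2 \<le> Re w + (4 * real g + 1)"
      using k by (cases "0 \<le> Re w - 4 * real k") (simp_all add: abs_if)
    then show ?thesis
      unfolding marks t_def by (elim disjE) (simp_all only: mult_right_mono of_nat_0_le_iff simp_thms)
  qed
  have t: "0 \<le> t" "t \<le> real ((8 * g + 2) * m)"
    unfolding t_def by (rule surface_column_range[OF wz])+
  have zero_J: "0 \<in> J" if "\<bar>Im w\<bar> = a" unfolding J_def using that m m0 by (auto intro!: bexI[of _ 0])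
  have "tile_connected (\<Sigma> \<times> \<Theta> \<times> I \<times> J)"
  proof (rule product_connected)
    show "I \<subseteq> {..<(8 * g + 2) * m}" "J \<subseteq> {..<m}" unfolding I_def J_def by auto
    show "l \<in> I" if "i \<in> I" "k \<in> I" "i \<le> l" "l \<le> k" for i k l
      using that unfolding I_def by auto
    show "l \<in> J" if ijk: "i \<in> J" "k \<in> J" "i \<le> l" "l \<le> k" for i k l
    proof -
      obtain \<theta> where \<theta>: "\<theta> \<in> {real i / m .. (real i + 1) / m}" "a + (b - a) * \<theta> = \<bar>Im w\<bar>" using ijk(1) unfolding J_def by blast
      obtain \<theta>' where \<theta>': "\<theta>' \<in> {real k / m .. (real k + 1) / m}" "a + (b - a) * \<theta>' = \<bar>Im w\<bar>" using ijk(2) unfolding J_def by blast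
      have lm: "l < m" using ijk unfolding J_def by auto
      have same: "(b - a) * \<theta> = (b - a) * \<theta>'" using \<theta>(2) \<theta>'(2) by linarith
      show ?thesis
      proof (cases "a = b")
        \<comment> \<open>Where the two arcs coincide every fraction represents the point, so every
          row contains it.\<close>
        case True
        have "real l / m \<in> {real l / m .. (real l + 1) / m}" using m0 by (simp add: divide_right_mono)
        moreover have "a + (b - a) * (real l / m) = \<bar>Im w\<bar>" using True \<theta>(2) by simp
        ultimately show ?thesis unfolding J_def using lm by (intro CollectI conjI bexI[of _ "real l / m"])
      next
        case False
        then have "\<theta> = \<theta>'" using same by simp
        moreover have "(real i + 1) / m \<le> (real l + 1) / m" using ijk m0 by (intro divide_right_mono) auto
        moreover have "real l / m \<le> real k / m" using ijk m0 by (intro divide_right_mono) auto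
        ultimately have "\<theta> \<in> {real l / m .. (real l + 1) / m}"
          using \<theta>(1) \<theta>'(1) unfolding atLeastAtMost_iff by linarith
        then show ?thesis unfolding J_def using lm \<theta>(2) by (intro CollectI conjI bexI[of _ \<theta>])
      qed
    qed
    show "m - 1 \<in> J \<or> 0 \<in> J \<and> (\<exists>i\<in>I. hole_column g m i)" if "True \<in> \<Sigma>" "False \<in> \<Sigma>"
    proof -
      have "z = 0" using that unfolding \<Sigma>_def sign_ok_def by auto
      from fib(4)[OF this] show ?thesis
      proof
        assume y: "\<bar>Im w\<bar> = outer_arc g (Re w)"
        have "1 \<in> {real (m - 1) / m .. (real (m - 1) + 1) / m}" using m by (auto simp: of_nat_diff divide_le_eq)
        moreover have "a + (b - a) * 1 = \<bar>Im w\<bar>" using y unfolding b_def by simp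
        ultimately have "m - 1 \<in> J" unfolding J_def using m by (intro CollectI conjI bexI[of _ 1]) auto
        then show ?thesis by simp
      next
        assume "\<exists>k<g. \<bar>Re w - 4 * real k\<bar> \<le> 1 \<and> \<bar>Im w\<bar> = hole_arc g (Re w)"
        then obtain k where k: "k < g" "\<bar>Re w - 4 * real k\<bar> \<le> 1" "\<bar>Im w\<bar> = a" unfolding a_def by blast
        have "4 * (real g + real k) \<le> Re w + (4 * real g + 1)" "Re w + (4 * real g + 1) \<le> 4 * (real g + real k) + 2"
          using k(2) by (simp_all add: abs_le_iff)
        then have "real (4 * (g + k) * m) \<le> t" "t \<le> real ((4 * (g + k) + 2) * m)"
          unfolding marks t_def by (simp_all only: mult_right_mono of_nat_0_le_iff)
        from column_in_hole[OF m k(1) this] show ?thesis using zero_J[OF k(3)] unfolding I_def by blast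
      qed
    qed
    show "0 \<in> J \<and> (\<exists>i\<in>I. \<not> hole_column g m i)" if "True \<in> \<Theta>" "False \<in> \<Theta>"
    proof -
      have im: "Im w = 0" using that unfolding \<Theta>_def sign_ok_def by auto
      note f = fib(5)[OF im]
      have "\<exists>i<(8 * g + 2) * m. real i \<le> t \<and> t \<le> real i + 1 \<and> \<not> hole_column g m i"
        by (rule column_off_holes[OF m t]) (use f scale in auto)
      then show ?thesis using zero_J f im unfolding I_def a_def by auto
    qed
  qed
  then show ?thesis unfolding eq .
qed

text \<open>The finitely many stars and middle parts have a common separation \<delta>, and uniform
  continuity of the four half-sheets on a compact rectangle provides a grid whose tiles have
  diameter below \<delta>.\<close>

theorem genus_edge_bound:
  assumes G: "sgraph V G" and genus: "has_genus g V G" and V3: "3 \<le> card V"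
  shows "card G + 6 \<le> 3 * card V + 6 * g"
proof -
  obtain p \<gamma> where "graph_embedding V G (genus_surface g) p \<gamma>"
    using genus unfolding has_genus_def embeddable_in_def by blast
  from graph_embedding_star_pieces[OF G this] obtain Y M where
    pieces: "star_pieces V G (genus_surface g) Y M" by blast
  have fin: "finite (Y ` V \<union> M ` G)" using G finite_edges[OF G] unfolding sgraph_def by simp
  have comp: "compact Z" if "Z \<in> Y ` V \<union> M ` G" for Z
    using that pieces unfolding star_pieces_def by auto
  obtain \<delta> where \<delta>: "0 < \<delta>" "\<And>Z Z' x y. Z \<in> Y ` V \<union> M ` G \<Longrightarrow> Z' \<in> Y ` V \<union> M ` G \<Longrightarrow>
      Z \<inter> Z' = {} \<Longrightarrow> x \<in> Z \<Longrightarrow> y \<in> Z' \<Longrightarrow> \<delta> \<le> dist x y"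
    using uniform_separation[OF fin comp] by metis
  define K where "K = {- (4 * real g + 1) .. 4 * real g + 1} \<times> {0 .. 1 :: real}"
  have K: "compact K" unfolding K_def by (intro compact_Times compact_Icc)
  have "\<exists>d>0. \<forall>p\<in>K. \<forall>q\<in>K. dist q p < d \<longrightarrow> dist (half_sheet g \<sigma> \<tau> q) (half_sheet g \<sigma> \<tau> p) < \<delta>" for \<sigma> \<tau>
    using compact_uniformly_continuous[OF continuous_on_subset[OF half_sheet_continuous subset_UNIV] K, of g \<sigma> \<tau>] \<delta>(1)
    unfolding uniformly_continuous_on_def by blast
  then obtain d where d: "\<And>\<sigma> \<tau>. 0 < d \<sigma> \<tau>"
    "\<And>\<sigma> \<tau> p q. p \<in> K \<Longrightarrow> q \<in> K \<Longrightarrow> dist q p < d \<sigma> \<tau> \<Longrightarrow> dist (half_sheet g \<sigma> \<tau> q) (half_sheet g \<sigma> \<tau> p) < \<delta>"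
    by metis
  define d0 where "d0 = min (min (d True True) (d True False)) (min (d False True) (d False False))"
  have d0: "0 < d0" "d0 \<le> d \<sigma> \<tau>" for \<sigma> \<tau>
    unfolding d0_def using d(1) by (cases \<sigma>; cases \<tau>; simp)+
  \<comment> \<open>A grid rectangle has both sides 1/m, hence diameter at most 2/m.\<close>
  obtain m :: nat where "2 / d0 < real m" using reals_Archimedean2 by blast
  then have m: "1 \<le> m" "2 / real m < d0"
    using d0(1) by (auto simp: divide_less_eq mult.commute Suc_le_eq intro: ccontr)
  have m0: "0 < real m" using m(1) by simp
  interpret column_grid "(8 * g + 2) * m" m "hole_column g m" g by (rule hole_column_grid[OF m(1)])
  show ?thesis
  proof (rule euler_bound_of_fine_tiling[OF G V3 pieces \<delta>(2), where A = "surface_tile g m"])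
    show "tile_connected {x \<in> cells. p \<in> surface_tile g m x}" if "p \<in> genus_surface g" for p
    proof -
      obtain w z where p: "p = (w, z)" by (cases p)
      show ?thesis unfolding p by (rule surface_tiles_connected[OF that[unfolded p] m(1)])
    qed
    show "genus_surface g \<subseteq> (\<Union>x\<in>cells. surface_tile g m x)"
    proof
      fix p assume "p \<in> genus_surface g"
      then have "(fst p, snd p) \<in> genus_surface g" by simp
      from surface_tile_cover[OF this m(1)] show "p \<in> (\<Union>x\<in>cells. surface_tile g m x)"
        unfolding cells_def by fastforce
    qed
    fix x assume "x \<in> cells"
    then obtain \<sigma> \<tau> i j where x: "x = (\<sigma>, \<tau>, i, j)" "i < (8 * g + 2) * m" "j < m"
      unfolding cells_def by auto
    let ?Q = "{real i / m - (4 * real g + 1) .. (real i + 1) / m - (4 * real g + 1)} \<times> {real j / m .. (real j + 1) / m}"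
    have tile: "surface_tile g m x = half_sheet g \<sigma> \<tau> ` ?Q" unfolding x(1) surface_tile_def by simp
    have "compact (half_sheet g \<sigma> \<tau> ` ?Q)"
      by (intro compact_continuous_image continuous_on_subset[OF half_sheet_continuous] compact_Times compact_Icc) auto
    then show "closed (surface_tile g m x)" unfolding tile by (rule compact_imp_closed)
    fix a b assume "a \<in> surface_tile g m x" "b \<in> surface_tile g m x"
    then obtain q r where qr: "q \<in> ?Q" "r \<in> ?Q" "a = half_sheet g \<sigma> \<tau> q" "b = half_sheet g \<sigma> \<tau> r"
      unfolding tile by blast
    have QK: "?Q \<subseteq> K"
    proof -
      have "real i + 1 \<le> real ((8 * g + 2) * m)" using x(2) by linarith
      then have "(real i + 1) / m - (4 * real g + 1) \<le> 4 * real g + 1" using m0 by (simp add: divide_le_eq algebra_simps)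
      moreover have "(real j + 1) / m \<le> 1" using x(3) m0 by (simp add: divide_le_eq)
      moreover have "- (4 * real g + 1) \<le> real i / m - (4 * real g + 1)" "0 \<le> real j / m" by auto
      ultimately show ?thesis unfolding K_def by (intro Sigma_mono) (simp_all only: atLeastatMost_subset_iff simp_thms)
    qed
    have "dist q r \<le> 2 / m"
    proof -
      have "dist q r \<le> dist (fst q) (fst r) + dist (snd q) (snd r)"
        unfolding dist_prod_def by (rule sqrt_sum_squares_le_sum) auto
      also have "\<dots> \<le> 1 / m + 1 / m"
        using qr(1,2) by (intro add_mono) (auto simp: dist_real_def add_divide_distrib abs_le_iff)
      finally show ?thesis by simp
    qed
    then have "dist q r < d \<sigma> \<tau>" using m(2) d0(2)[of \<sigma> \<tau>] by linarith
    from d(2)[OF subsetD[OF QK qr(2)] subsetD[OF QK qr(1)] this]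
    show "dist a b < \<delta>" unfolding qr(3,4) .
  qed
qed

section \<open>Density of planar graphs and of graphs of genus g\<close>

lemma graph_embeddingD:
  assumes "graph_embedding V E S p \<gamma>"
  shows "inj_on p V" "p ` V \<subseteq> S"
    and "\<And>e. e \<in> E \<Longrightarrow> arc (\<gamma> e)" "\<And>e. e \<in> E \<Longrightarrow> path_image (\<gamma> e) \<subseteq> S"
    and "\<And>e. e \<in> E \<Longrightarrow> {pathstart (\<gamma> e), pathfinish (\<gamma> e)} = p ` e"
    and "\<And>e. e \<in> E \<Longrightarrow> path_image (\<gamma> e) \<inter> p ` V = p ` e"
    and "\<And>e e'. e \<in> E \<Longrightarrow> e' \<in> E \<Longrightarrow> e \<noteq> e' \<Longrightarrow> path_image (\<gamma> e) \<inter> path_image (\<gamma> e') = p ` (e \<inter> e')"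
  using assms unfolding graph_embedding_def by simp_all

lemma has_genus_subgraph:
  assumes "has_genus g V E" "U \<subseteq> V"
  shows "has_genus g U {e \<in> E. e \<subseteq> U}"
proof -
  obtain p \<gamma> where emb: "graph_embedding V E (genus_surface g) p \<gamma>"
    using assms(1) unfolding has_genus_def embeddable_in_def by blast
  have "graph_embedding U {e \<in> E. e \<subseteq> U} (genus_surface g) p \<gamma>"
    unfolding graph_embedding_def
  proof (intro conjI ballI impI)
    show "inj_on p U" by (rule inj_on_subset[OF graph_embeddingD(1)[OF emb] assms(2)])
    show "p ` U \<subseteq> genus_surface g" by (rule order_trans[OF image_mono[OF assms(2)] graph_embeddingD(2)[OF emb]])
    fix e assume e: "e \<in> {e \<in> E. e \<subseteq> U}"
    then have "e \<in> E" by simp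
    note * = graph_embeddingD(3-6)[OF emb this]
    show "arc (\<gamma> e)" "path_image (\<gamma> e) \<subseteq> genus_surface g" "{pathstart (\<gamma> e), pathfinish (\<gamma> e)} = p ` e"
      by (rule *)+
    have "p ` e \<subseteq> p ` U" "p ` U \<subseteq> p ` V" using e assms(2) by auto
    then show "path_image (\<gamma> e) \<inter> p ` U = p ` e" using *(4) by blast
  next
    fix e e' assume "e \<in> {e \<in> E. e \<subseteq> U}" "e' \<in> {e \<in> E. e \<subseteq> U}" "e \<noteq> e'"
    then show "path_image (\<gamma> e) \<inter> path_image (\<gamma> e') = p ` (e \<inter> e')"
      by (intro graph_embeddingD(7)[OF emb]) simp_all
  qed
  then show ?thesis unfolding has_genus_def embeddable_in_def by blast
qed

text \<open>A bounded part of the plane embeds into the upper hemisphere.\<close>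

lemma planar_graph_has_genus_0:
  assumes G: "sgraph V E" and planar: "planar_graph V E"
  shows "has_genus 0 V E"
proof -
  obtain p \<gamma> where emb: "graph_embedding V E (UNIV :: complex set) p \<gamma>"
    using planar unfolding planar_graph_def embeddable_in_def by blast
  define X where "X = p ` V \<union> (\<Union>e\<in>E. path_image (\<gamma> e))"
  have "compact (path_image (\<gamma> e))" if "e \<in> E" for e
    by (rule compact_arc_image[OF graph_embeddingD(3)[OF emb that]])
  then have "compact (\<Union>e\<in>E. path_image (\<gamma> e))" using finite_edges[OF G] by (intro compact_UN) auto
  moreover have "finite V" using G unfolding sgraph_def by simp
  then have "compact (p ` V)" by (intro finite_imp_compact finite_imageI)
  ultimately have "compact X" unfolding X_def by (intro compact_Un)
  then have "\<exists>b>0. \<forall>w\<in>X. cmod w \<le> b" using compact_imp_bounded bounded_pos by blast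
  then obtain b where b: "0 < b" "\<And>w. w \<in> X \<Longrightarrow> cmod w \<le> b" by blast
  define f where "f w = (w / of_real b, sqrt (1 - (cmod w / b)\<^sup>2))" for w
  have inj: "inj f"
  proof (rule injI)
    fix x y assume "f x = f y"
    then have "x / of_real b = y / of_real b" unfolding f_def by (rule Pair_inject)
    then show "x = y" using b(1) by simp
  qed
  have cont: "continuous_on A f" for A unfolding f_def[abs_def] by (intro continuous_intros) (use b(1) in auto)
  have fX: "f w \<in> genus_surface 0" if "w \<in> X" for w
  proof -
    have "cmod w / b \<le> 1" using b that by (simp add: divide_le_eq)
    then have "(cmod w / b)\<^sup>2 \<le> 1" using b(1) by (simp add: power_le_one)
    then show ?thesis unfolding genus_surface_0 f_def using b(1)
      by (simp add: norm_Pair norm_divide)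
  qed
  have image_f: "f ` A \<inter> f ` B = f ` (A \<inter> B)" for A B by (rule image_Int[OF inj, symmetric])
  have "graph_embedding V E (genus_surface 0) (f \<circ> p) (\<lambda>e. f \<circ> \<gamma> e)"
    unfolding graph_embedding_def
  proof (intro conjI ballI impI)
    show "inj_on (f \<circ> p) V"
      by (rule comp_inj_on[OF graph_embeddingD(1)[OF emb] inj_on_subset[OF inj subset_UNIV]])
    show "(f \<circ> p) ` V \<subseteq> genus_surface 0" using fX unfolding X_def by auto
    fix e assume e: "e \<in> E"
    note * = graph_embeddingD(3,5,6)[OF emb e]
    have "path (f \<circ> \<gamma> e)" using path_continuous_image[OF arc_imp_path[OF *(1)] cont] .
    moreover have "inj_on (f \<circ> \<gamma> e) {0..1}"
      using *(1) unfolding arc_def by (intro comp_inj_on inj_on_subset[OF inj subset_UNIV]) simp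
    ultimately show "arc (f \<circ> \<gamma> e)" unfolding arc_def by simp
    show "path_image (f \<circ> \<gamma> e) \<subseteq> genus_surface 0"
      unfolding path_image_compose
    proof (rule image_subsetI)
      fix x assume "x \<in> path_image (\<gamma> e)"
      then have "x \<in> X" unfolding X_def using e by blast
      then show "f x \<in> genus_surface 0" by (rule fX)
    qed
    have "{pathstart (f \<circ> \<gamma> e), pathfinish (f \<circ> \<gamma> e)} = f ` {pathstart (\<gamma> e), pathfinish (\<gamma> e)}"
      by (simp add: pathstart_compose pathfinish_compose)
    then show "{pathstart (f \<circ> \<gamma> e), pathfinish (f \<circ> \<gamma> e)} = (f \<circ> p) ` e" unfolding *(2) image_comp .
    show "path_image (f \<circ> \<gamma> e) \<inter> (f \<circ> p) ` V = (f \<circ> p) ` e"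
      unfolding path_image_compose image_comp[symmetric] image_f *(3) ..
  next
    fix e e' assume e: "e \<in> E" "e' \<in> E" "e \<noteq> e'"
    then have "path_image (\<gamma> e) \<inter> path_image (\<gamma> e') = p ` (e \<inter> e')"
      by (rule graph_embeddingD(7)[OF emb])
    then show "path_image (f \<circ> \<gamma> e) \<inter> path_image (f \<circ> \<gamma> e') = (f \<circ> p) ` (e \<inter> e')"
      unfolding path_image_compose image_comp[symmetric] image_f by simp
  qed
  then show ?thesis unfolding has_genus_def embeddable_in_def by blast
qed

lemma genus_induced_edges:
  assumes E: "E \<in> graphs \<Delta> n" and genus: "has_genus g {1..n} E" and U: "U \<subseteq> {1..n}" "3 \<le> card U"
  shows "real (card {e\<in>E. e \<subseteq> U}) \<le> 3 * real (card U) + 6 * real g - 6"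
proof -
  have "sgraph {1..n} E" using E unfolding graphs_def by simp
  then have "sgraph U {e\<in>E. e \<subseteq> U}" using finite_subset[OF U(1)] unfolding sgraph_def by auto
  from genus_edge_bound[OF this has_genus_subgraph[OF genus U(1)] U(2)] show ?thesis by linarith
qed

text \<open>For at least three vertices, 3m - 6 \<le> (3 - 6/n)m because m \<le> n. Smaller sets
  span at most m/2 edges, and 3 - 6/n \<ge> 1 since n > \<Delta> \<ge> 6.\<close>

lemma planar_density:
  assumes E: "E \<in> graphs \<Delta> n" and planar: "planar_graph {1..n} E" and \<Delta>: "6 \<le> \<Delta>" and U: "U \<subseteq> {1..n}"
  shows "real (card {e\<in>E. e \<subseteq> U}) \<le> (3 - 6 / real n) * card U"
proof -
  have sg: "sgraph {1..n} E" using E unfolding graphs_def by simp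
  have n: "7 \<le> n" using max_degree_less[OF E] \<Delta> by simp
  have cU: "card U \<le> n" using card_mono[OF _ U] by simp
  show ?thesis
  proof (cases "3 \<le> card U")
    case True
    have "6 / real n * card U \<le> 6" using cU n by (simp add: divide_le_eq)
    moreover have "(3 - 6 / real n) * card U = 3 * card U - 6 / real n * card U" by (simp add: left_diff_distrib)
    ultimately show ?thesis
      using genus_induced_edges[OF E planar_graph_has_genus_0[OF sg planar] U True] by simp
  next
    case False
    then have "card U * (card U - 1) \<le> card U * 1" by (intro mult_le_mono) auto
    then have "2 * card {e\<in>E. e \<subseteq> U} \<le> card U"
      using card_induced_edges_choose_2[OF sg finite_subset[OF U finite_atLeastAtMost]] by linarith
    then have "real (card {e\<in>E. e \<subseteq> U}) \<le> 1 * real (card U)" by simp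
    also have "\<dots> \<le> (3 - 6 / real n) * card U" using n by (intro mult_right_mono) (auto simp: divide_le_eq)
    finally show ?thesis .
  qed
qed

text \<open>Two bounds on the density compete: (m - 1)/2 from the complete graph, increasing in m,
  and 3 + 6(g - 1)/m from Euler's inequality, nonincreasing in m. They agree for m^2 - 7m - 12(g -
  1) = 0, whose larger root is \<open>k_genus g\<close>; the maximum in \<open>kappa_genus\<close>
  takes the first at the floor and the second at the ceiling of this root.\<close>

lemma genus_density:
  assumes E: "E \<in> graphs \<Delta> n" and genus: "has_genus g {1..n} E" and g: "0 < g" and U: "U \<subseteq> {1..n}"
  shows "real (card {e\<in>E. e \<subseteq> U}) \<le> kappa_genus g * card U"
proof -
  have sg: "sgraph {1..n} E" using E unfolding graphs_def by simp
  have k: "7 \<le> k_genus g"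
  proof -
    have "7 / 2 = sqrt (49 / 4)" by (simp add: real_sqrt_divide)
    also have "\<dots> \<le> sqrt (12 * real g + 1 / 4)" using g by (intro real_sqrt_le_mono) simp
    finally show ?thesis unfolding k_genus_def by simp
  qed
  define m where "m = card U"
  show ?thesis
  proof (cases "real m \<le> k_genus g")
    case True
    then have "int m \<le> \<lfloor>k_genus g\<rfloor>" by (simp add: le_floor_iff)
    then have "(real m - 1) / 2 \<le> (of_int \<lfloor>k_genus g\<rfloor> - 1) / 2" by (simp add: divide_right_mono)
    also have "\<dots> \<le> kappa_genus g" unfolding kappa_genus_def by simp
    finally have le: "(real m - 1) / 2 \<le> kappa_genus g" .
    have "2 * card {e\<in>E. e \<subseteq> U} \<le> m * (m - 1)"
      unfolding m_def by (rule card_induced_edges_choose_2[OF sg finite_subset[OF U]]) simp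
    then have "real (2 * card {e\<in>E. e \<subseteq> U}) \<le> real (m * (m - 1))" unfolding of_nat_le_iff .
    also have "\<dots> = real m * (real m - 1)" by (cases m) (simp_all add: algebra_simps)
    finally have "real (card {e\<in>E. e \<subseteq> U}) \<le> (real m - 1) / 2 * m" by (simp add: mult.commute)
    also have "\<dots> \<le> kappa_genus g * m" by (rule mult_right_mono[OF le]) simp
    finally show ?thesis unfolding m_def .
  next
    case False
    then have "\<lceil>k_genus g\<rceil> \<le> int m" by (simp add: ceiling_le_iff)
    define C :: real where "C = of_int \<lceil>k_genus g\<rceil>"
    have cm: "C \<le> real m" unfolding C_def using \<open>\<lceil>k_genus g\<rceil> \<le> int m\<close> by linarith
    have c0: "0 < C" unfolding C_def using k by linarith
    have m3: "3 \<le> card U" using False k unfolding m_def by linarith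
    have "6 * (real g - 1) = 6 * (real g - 1) / C * C" using c0 by simp
    \<comment> \<open>The coefficient is nonnegative by g \<ge> 1, so the factor C may be replaced
      by the larger m.\<close>
    also have "\<dots> \<le> 6 * (real g - 1) / C * m" using cm c0 g by (intro mult_left_mono) auto
    finally have "3 * real m + 6 * real g - 6 \<le> (3 + 6 * (real g - 1) / C) * m"
      by (simp add: distrib_right)
    also have "\<dots> \<le> kappa_genus g * m" unfolding kappa_genus_def C_def by (intro mult_right_mono) auto
    finally show ?thesis using genus_induced_edges[OF E genus U m3] unfolding m_def by linarith
  qed
qed

lemma kappa_genus_pos: "0 < g \<Longrightarrow> 0 \<le> kappa_genus g"
proof -
  assume g: "0 < g"
  have "0 \<le> k_genus g" unfolding k_genus_def by simp
  then have "0 \<le> (of_int \<lceil>k_genus g\<rceil> :: real)" by linarith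
  then have "0 \<le> 3 + 6 * (real g - 1) / of_int \<lceil>k_genus g\<rceil>" using g by simp
  then show ?thesis unfolding kappa_genus_def by simp
qed

section \<open>Mixing time asymptotics\<close>

lemma filterlim_const_mult_power_ln:
  assumes "0 < a" "0 < \<epsilon>"
  shows "filterlim (\<lambda>n::nat. a * real n ^ k * ln (real n / \<epsilon>)) at_top sequentially"
proof (rule filterlim_at_top_mono)
  show "filterlim (\<lambda>n::nat. a * ln (real n / \<epsilon>)) at_top sequentially"
    by (rule filterlim_tendsto_pos_mult_at_top[OF tendsto_const assms(1) filterlim_ln_over[OF assms(2)]])
  have "eventually (\<lambda>n. 0 \<le> ln (real n / \<epsilon>)) sequentially"
    using filterlim_ln_over[OF assms(2)] unfolding filterlim_at_top by blast
  then show "eventually (\<lambda>n. a * ln (real n / \<epsilon>) \<le> a * real n ^ k * ln (real n / \<epsilon>)) sequentially"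
    using eventually_ge_at_top[of 1]
  proof eventually_elim
    case (elim n)
    have "1 \<le> real n ^ k" using elim(2) by simp
    then have "a * 1 \<le> a * real n ^ k" using assms(1) by (intro mult_left_mono) auto
    then show ?case using elim(1) by (intro mult_right_mono) auto
  qed
qed

text \<open>The gap 1 - \<psi>/(q - \<Delta>) does not depend on n, so the exponent is k = 0 and the
  scan time is ln(n/\<epsilon>)/\<gamma>.\<close>

lemma mixing_noncritical:
  fixes q \<Delta> :: nat and \<kappa> :: real
  assumes C: "\<And>n E. E \<in> C n \<Longrightarrow> E \<in> graphs \<Delta> n" and \<epsilon>: "0 < \<epsilon>" "\<epsilon> < 1"
    and dens: "\<And>n E U. E \<in> C n \<Longrightarrow> U \<subseteq> {1..n} \<Longrightarrow> real (card {e\<in>E. e \<subseteq> U}) \<le> \<kappa> * card U"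
    and \<kappa>: "0 \<le> \<kappa>" "2 * \<kappa> \<le> real \<Delta>" and \<psi>: "\<psi> = 2 * sqrt (\<kappa> * (real \<Delta> - \<kappa>))"
    and q: "real \<Delta> + \<psi> < real q"
  shows "random_mixing_bound C q \<epsilon>
           (\<lambda>n. (real q - real \<Delta>) / (real q - real \<Delta> - \<psi>) * real n * ln (real n / \<epsilon>))"
    and "scan_mixing_asymp_bound C q \<epsilon>
           (\<lambda>n. (real q - real \<Delta> - \<psi> / 2) / (real q - real \<Delta> - \<psi>) * ln (real n / \<epsilon>))"
proof -
  have \<psi>0: "0 \<le> \<psi>" unfolding \<psi> using \<kappa> by simp
  have q': "\<Delta> < q" using q \<psi>0 by linarith
  define Q where "Q = real q - real \<Delta>"
  have Q: "0 < Q" "\<psi> < Q" using q q' unfolding Q_def by linarith+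
  define \<mu> where "\<mu> = \<psi> / Q"
  have \<mu>: "1 - \<mu> = (Q - \<psi>) / Q" "0 < 1 - \<mu>" "\<mu> < 1" "Q * \<mu> = \<psi>"
    unfolding \<mu>_def using Q by (auto simp: diff_divide_distrib)
  have sb: "spectral_bound n E (Q * \<mu>)" if "E \<in> C n" for n E
    unfolding \<mu>(4) \<psi> by (rule spectral_bound_density[OF C[OF that] \<kappa> dens[OF that]])
  show "random_mixing_bound C q \<epsilon> (\<lambda>n. (real q - real \<Delta>) / (real q - real \<Delta> - \<psi>) * real n * ln (real n / \<epsilon>))"
  proof (rule random_mixing_boundI[OF C q' \<epsilon>(1) sb[unfolded Q_def]])
    fix n E assume "E \<in> C n"
    show "real n * ln (real n / \<epsilon>) / (1 - \<mu>)
        \<le> (real q - real \<Delta>) / (real q - real \<Delta> - \<psi>) * real n * ln (real n / \<epsilon>)"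
      unfolding Q_def[symmetric] \<mu>(1) by (simp add: mult_ac)
  qed (use \<mu>(3) in auto)
  have \<gamma>: "(1 - \<mu>) / (1 - \<mu> / 2) = (Q - \<psi>) / (Q - \<psi> / 2)"
  proof -
    have "1 - \<mu> / 2 = (Q - \<psi> / 2) / Q" unfolding \<mu>_def using Q by (simp add: field_simps)
    then show ?thesis unfolding \<mu>(1) using Q by simp
  qed
  show "scan_mixing_asymp_bound C q \<epsilon>
      (\<lambda>n. (real q - real \<Delta> - \<psi> / 2) / (real q - real \<Delta> - \<psi>) * ln (real n / \<epsilon>))"
  proof (rule scan_mixing_asymp_boundI[OF C q' \<epsilon> sb[unfolded Q_def] \<mu>(2), where k = 0])
    show "(1 - \<mu>) / real n ^ 0 \<le> 1 - \<mu>" for n :: nat by simp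
    show "filterlim (\<lambda>n. (real q - real \<Delta> - \<psi> / 2) / (real q - real \<Delta> - \<psi>) * ln (real n / \<epsilon>)) at_top sequentially"
      using filterlim_const_mult_power_ln[of "(Q - \<psi> / 2) / (Q - \<psi>)" \<epsilon> 0] Q \<psi>0 \<epsilon> unfolding Q_def by simp
    fix \<delta> :: real assume \<delta>: "0 < \<delta>"
    have "eventually (\<lambda>n. 0 \<le> ln (real n / \<epsilon>)) sequentially"
      using filterlim_ln_over[OF \<epsilon>(1)] unfolding filterlim_at_top by blast
    then show "eventually (\<lambda>n. (real 0 + 1) * ln (real n / \<epsilon>)
        \<le> (1 + \<delta>) * ((1 - \<mu>) / (1 - \<mu> / 2)) *
          ((real q - real \<Delta> - \<psi> / 2) / (real q - real \<Delta> - \<psi>) * ln (real n / \<epsilon>))) sequentially"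
    proof eventually_elim
      case (elim n)
      have "(Q - \<psi>) / (Q - \<psi> / 2) * ((Q - \<psi> / 2) / (Q - \<psi>)) = 1" using Q \<psi>0 by simp
      then have "(1 + \<delta>) * ((Q - \<psi>) / (Q - \<psi> / 2)) * ((Q - \<psi> / 2) / (Q - \<psi>) * ln (real n / \<epsilon>))
          = (1 + \<delta>) * ln (real n / \<epsilon>)" by (metis mult.assoc mult.right_neutral mult.commute)
      then show ?case unfolding Q_def[symmetric] \<gamma> using elim \<delta> by (simp add: distrib_right)
    qed
  qed
qed

text \<open>The gap is c/n^k. Random updates take n ln(n/\<epsilon>) divided by the gap. For scans
  \<gamma> is about twice the gap, and the prefactor contributes k + 1. The constants are introduced
  by equations so that they can be matched to any closed form.\<close>

lemma mixing_critical:
  fixes q \<Delta> k :: nat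
  assumes C: "\<And>n E. E \<in> C n \<Longrightarrow> E \<in> graphs \<Delta> n" and q: "\<Delta> < q" and \<epsilon>: "0 < \<epsilon>" "\<epsilon> < 1"
    and c: "0 < c" and k: "1 \<le> k"
    and sb: "\<And>n E. E \<in> C n \<Longrightarrow> spectral_bound n E ((real q - real \<Delta>) * (1 - c / real n ^ k))"
  shows "a = 1 / c \<Longrightarrow> random_mixing_bound C q \<epsilon> (\<lambda>n. a * real n ^ (k + 1) * ln (real n / \<epsilon>))"
    and "b = (real k + 1) / (2 * c) \<Longrightarrow>
      scan_mixing_asymp_bound C q \<epsilon> (\<lambda>n. b * real n ^ k * ln (real n / \<epsilon>))"
proof -
  have n_pos: "0 < real n" if "E \<in> C n" for n E using C[OF that] unfolding graphs_def by simp
  show "random_mixing_bound C q \<epsilon> (\<lambda>n. a * real n ^ (k + 1) * ln (real n / \<epsilon>))" if a: "a = 1 / c"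
  proof (rule random_mixing_boundI[OF C q \<epsilon>(1) sb])
    fix n E assume "E \<in> C n"
    then have n: "0 < real n" by (rule n_pos)
    show "1 - c / real n ^ k < 1" using c n by simp
    show "real n * ln (real n / \<epsilon>) / (1 - (1 - c / real n ^ k)) \<le> a * real n ^ (k + 1) * ln (real n / \<epsilon>)"
      unfolding a using c n by (simp add: mult_ac)
  qed
  show "scan_mixing_asymp_bound C q \<epsilon> (\<lambda>n. b * real n ^ k * ln (real n / \<epsilon>))"
    if b: "b = (real k + 1) / (2 * c)"
  proof (rule scan_mixing_asymp_boundI[OF C q \<epsilon> sb c, where k = k])
    have b0: "0 < b" unfolding b using c by simp
    show "c / real n ^ k \<le> 1 - (1 - c / real n ^ k)" for n :: nat by simp
    show "filterlim (\<lambda>n. b * real n ^ k * ln (real n / \<epsilon>)) at_top sequentially"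
      by (rule filterlim_const_mult_power_ln[OF b0 \<epsilon>(1)])
    fix \<delta> :: real assume \<delta>: "0 < \<delta>"
    have ev1: "eventually (\<lambda>n. 0 \<le> ln (real n / \<epsilon>)) sequentially"
      using filterlim_ln_over[OF \<epsilon>(1)] unfolding filterlim_at_top by blast
    \<comment> \<open>For n \<ge> c/\<delta> the factor 1 + \<delta> absorbs the difference between
      N + c and N.\<close>
    have ev2: "eventually (\<lambda>n. c / \<delta> \<le> real n) sequentially"
      using filterlim_real_sequentially unfolding filterlim_at_top by blast
    show "eventually (\<lambda>n. (real k + 1) * ln (real n / \<epsilon>)
        \<le> (1 + \<delta>) * ((1 - (1 - c / real n ^ k)) / (1 - (1 - c / real n ^ k) / 2)) *
          (b * real n ^ k * ln (real n / \<epsilon>))) sequentially"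
      using ev1 ev2 eventually_ge_at_top[of 1]
    proof eventually_elim
      case (elim n)
      define N where "N = real n ^ k"
      have n1: "1 \<le> real n" using elim(3) by simp
      have nN: "real n \<le> N" unfolding N_def using self_le_power[OF n1] k by simp
      have N0: "0 < N" using nN n1 by linarith
      have "c \<le> \<delta> * real n" using elim(2) \<delta> by (simp add: divide_le_eq mult.commute)
      also have "\<dots> \<le> \<delta> * N" using nN \<delta> by (intro mult_left_mono) auto
      finally have "N + c \<le> (1 + \<delta>) * N" by (simp add: algebra_simps)
      then have one: "1 \<le> (1 + \<delta>) * N / (N + c)" using N0 c by (simp add: le_divide_eq)
      have frac: "(1 - (1 - c / N)) / (1 - (1 - c / N) / 2) = 2 * c / (N + c)"
        using N0 c by (simp add: field_simps)
      have "(real k + 1) * ln (real n / \<epsilon>) = 1 * ((real k + 1) * ln (real n / \<epsilon>))" by simp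
      also have "\<dots> \<le> (1 + \<delta>) * N / (N + c) * ((real k + 1) * ln (real n / \<epsilon>))"
        using one elim(1) by (intro mult_right_mono) auto
      also have "\<dots> = (1 + \<delta>) * (2 * c / (N + c)) * (b * N * ln (real n / \<epsilon>))"
        unfolding b using c by simp
      finally show ?case unfolding N_def[symmetric] frac .
    qed
  qed
qed

text \<open>With \<open>h = \<delta> (\<Delta> - 2\<kappa>) + \<delta>\<^sup>2\<close> the left-hand side is \<open>sqrt (\<psi>\<^sup>2 - 4h)\<close>, which lies below its
  tangent \<open>\<psi> - 2h/\<psi>\<close>.\<close>

lemma critical_spectral_gap:
  fixes \<kappa> \<delta> D :: real
  assumes \<kappa>: "0 < \<kappa>" "2 * \<kappa> \<le> D" and \<delta>: "0 \<le> \<delta>" "\<delta> \<le> \<kappa>" and \<psi>: "\<psi> = 2 * sqrt (\<kappa> * (D - \<kappa>))"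
  shows "2 * sqrt ((\<kappa> - \<delta>) * (D - (\<kappa> - \<delta>))) \<le> \<psi> * (1 - 2 * (\<delta> * (D - 2 * \<kappa>) + \<delta>\<^sup>2) / \<psi>\<^sup>2)"
proof -
  define h where "h = \<delta> * (D - 2 * \<kappa>) + \<delta>\<^sup>2"
  have pos: "0 < \<kappa> * (D - \<kappa>)" using \<kappa> by simp
  have \<psi>0: "0 < \<psi>" unfolding \<psi> using pos by simp
  have \<psi>2: "\<psi>\<^sup>2 = 4 * (\<kappa> * (D - \<kappa>))" unfolding \<psi> power_mult_distrib using pos by simp
  have key: "4 * ((\<kappa> - \<delta>) * (D - (\<kappa> - \<delta>))) = \<psi>\<^sup>2 - 4 * h"
    unfolding \<psi>2 h_def by (simp add: algebra_simps power2_eq_square)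
  have "0 \<le> (\<kappa> - \<delta>) * (D - (\<kappa> - \<delta>))" using \<kappa> \<delta> by (intro mult_nonneg_nonneg) auto
  then have h4: "4 * h \<le> \<psi>\<^sup>2" using key by linarith
  have rhs: "\<psi> * (1 - 2 * h / \<psi>\<^sup>2) = \<psi> - 2 * h / \<psi>"
    using \<psi>0 by (simp add: field_simps power2_eq_square)
  have "0 \<le> h" unfolding h_def using \<kappa> \<delta> by simp
  have "2 * h / \<psi> \<le> \<psi>" using h4 \<open>0 \<le> h\<close> \<psi>0 by (simp add: divide_le_eq power2_eq_square)
  then have rhs0: "0 \<le> \<psi> - 2 * h / \<psi>" by simp
  have "2 * sqrt ((\<kappa> - \<delta>) * (D - (\<kappa> - \<delta>))) = sqrt (4 * ((\<kappa> - \<delta>) * (D - (\<kappa> - \<delta>))))"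
    by (simp add: real_sqrt_mult)
  also have "\<dots> \<le> sqrt ((\<psi> - 2 * h / \<psi>)\<^sup>2)"
  proof (rule real_sqrt_le_mono)
    have "(\<psi> - 2 * h / \<psi>)\<^sup>2 = \<psi>\<^sup>2 - 4 * h + (2 * h / \<psi>)\<^sup>2"
      using \<psi>0 by (simp add: power2_diff)
    then show "4 * ((\<kappa> - \<delta>) * (D - (\<kappa> - \<delta>))) \<le> (\<psi> - 2 * h / \<psi>)\<^sup>2" unfolding key by simp
  qed
  also have "\<dots> = \<psi> - 2 * h / \<psi>" using rhs0 by simp
  finally show ?thesis unfolding h_def[symmetric] rhs .
qed

lemma spectral_bound_critical:
  fixes \<kappa> \<delta> :: real
  assumes E: "E \<in> graphs \<Delta> n" and \<kappa>: "0 < \<kappa>" "2 * \<kappa> \<le> real \<Delta>" and \<delta>: "0 \<le> \<delta>" "\<delta> \<le> \<kappa>"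
    and dens: "\<And>U. U \<subseteq> {1..n} \<Longrightarrow> real (card {e\<in>E. e \<subseteq> U}) \<le> (\<kappa> - \<delta>) * card U"
    and \<psi>: "\<psi> = 2 * sqrt (\<kappa> * (real \<Delta> - \<kappa>))"
    and x: "x \<le> 2 * (\<delta> * (real \<Delta> - 2 * \<kappa>) + \<delta>\<^sup>2) / \<psi>\<^sup>2"
  shows "spectral_bound n E (\<psi> * (1 - x))"
proof (rule spectral_bound_mono)
  show "spectral_bound n E (2 * sqrt ((\<kappa> - \<delta>) * (real \<Delta> - (\<kappa> - \<delta>))))"
    by (rule spectral_bound_density[OF E _ _ dens]) (use \<kappa> \<delta> in auto)
  have "0 \<le> \<psi>" unfolding \<psi> using \<kappa> by simp
  then have "\<psi> * (1 - 2 * (\<delta> * (real \<Delta> - 2 * \<kappa>) + \<delta>\<^sup>2) / \<psi>\<^sup>2) \<le> \<psi> * (1 - x)"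
    using x by (intro mult_left_mono) auto
  then show "2 * sqrt ((\<kappa> - \<delta>) * (real \<Delta> - (\<kappa> - \<delta>))) \<le> \<psi> * (1 - x)"
    using critical_spectral_gap[OF \<kappa> \<delta> \<psi>] by linarith
qed

text \<open>A connected graph of maximum degree at most 1 is a vertex or an edge, hence regular. For
  q = 2\<Delta> this lets the relative gap 1/(\<Delta> n^2) be relaxed to 2/(\<Delta>^2
  n^2).\<close>

lemma nonregular_max_degree_ge_2:
  assumes E: "E \<in> graphs \<Delta> n" and conn: "connected_graph {1..n} E" and nreg: "\<not> regular_graph {1..n} E"
  shows "2 \<le> \<Delta>"
proof (rule ccontr)
  assume \<Delta>: "\<not> 2 \<le> \<Delta>"
  have sg: "sgraph {1..n} E" using E unfolding graphs_def by simp
  have fin: "finite (neighbours E v)" for v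
    by (rule finite_subset[of _ "{1..n}"]) (use sgraph_edgeD[OF sg] in \<open>auto simp: neighbours_def\<close>)
  have deg: "degree E v = 1" if uv: "v \<in> {1..n}" "u \<in> {1..n}" "u \<noteq> v" for u v
  proof -
    have "(v, u) \<in> {(a, b). {a, b} \<in> E}\<^sup>*" by (rule connected_graphD[OF conn uv(1,2)])
    then obtain w where "{v, w} \<in> E" using uv(3) by (cases rule: converse_rtranclE) auto
    then have "w \<in> neighbours E v" unfolding neighbours_def by (simp add: insert_commute)
    then have "0 < degree E v" unfolding degree_def using fin by (auto simp: card_gt_0_iff)
    then show ?thesis using graphs_degree_le[OF E uv(1)] \<Delta> by linarith
  qed
  have "\<exists>d. \<forall>v\<in>{1..n}. degree E v = d"
  proof (cases "n = 1")
    case True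
    then show ?thesis by simp
  next
    case False
    have "degree E v = 1" if "v \<in> {1..n}" for v
    proof (cases "v = 1")
      case True
      then show ?thesis using deg[of v 2] that False by auto
    next
      case False
      then show ?thesis using deg[of v 1] that by auto
    qed
    then show ?thesis by blast
  qed
  then show False using nreg unfolding regular_graph_def by blast
qed

theorem corollary52:
  fixes \<Delta> q t g :: nat and \<epsilon> :: real
  assumes "0 < \<epsilon>" and "\<epsilon> < 1" and "\<Delta> < q"
  shows
    "(q = 2 * \<Delta> \<longrightarrow>
       (let C = (\<lambda>n. {E \<in> graphs \<Delta> n. connected_graph {1..n} E \<and> \<not> regular_graph {1..n} E}) in
         random_mixing_bound C q \<epsilon> (\<lambda>n. 1/2 * real \<Delta>^2 * real n^3 * ln (real n / \<epsilon>)) \<and>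
         scan_mixing_asymp_bound C q \<epsilon> (\<lambda>n. 3/4 * real \<Delta>^2 * real n^2 * ln (real n / \<epsilon>))))
     \<and>
     (2 * t \<le> \<Delta> \<longrightarrow>
       (let C = (\<lambda>n. {E \<in> graphs \<Delta> n. treewidth {1..n} E = t});
            \<psi> = 2 * sqrt (real t * (real \<Delta> - real t)) in
         (real q > real \<Delta> + \<psi> \<longrightarrow>
           random_mixing_bound C q \<epsilon>
             (\<lambda>n. (real q - real \<Delta>) / (real q - real \<Delta> - \<psi>) * real n * ln (real n / \<epsilon>)) \<and>
           scan_mixing_asymp_bound C q \<epsilon>
             (\<lambda>n. (real q - real \<Delta> - \<psi>/2) / (real q - real \<Delta> - \<psi>) * ln (real n / \<epsilon>))) \<and>
         (real q = real \<Delta> + \<psi> \<and> \<Delta> > 2 * t \<longrightarrow>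
           random_mixing_bound C q \<epsilon>
             (\<lambda>n. \<psi>^2 / (real t * (real t + 1) * (real \<Delta> - 2 * real t)) * real n^2 * ln (real n / \<epsilon>)) \<and>
           scan_mixing_asymp_bound C q \<epsilon>
             (\<lambda>n. \<psi>^2 / (real t * (real t + 1) * (real \<Delta> - 2 * real t)) * real n * ln (real n / \<epsilon>))) \<and>
         (real q = real \<Delta> + \<psi> \<and> \<Delta> = 2 * t \<longrightarrow>
           random_mixing_bound C q \<epsilon> (\<lambda>n. 8 / (real t + 1)^2 * real n^3 * ln (real n / \<epsilon>)) \<and>
           scan_mixing_asymp_bound C q \<epsilon> (\<lambda>n. 12 / (real t + 1)^2 * real n^2 * ln (real n / \<epsilon>)))))
     \<and>
     (6 \<le> \<Delta> \<longrightarrow>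
       (let C = (\<lambda>n. {E \<in> graphs \<Delta> n. planar_graph {1..n} E});
            \<psi> = 2 * sqrt (3 * (real \<Delta> - 3)) in
         (real q > real \<Delta> + \<psi> \<longrightarrow>
           random_mixing_bound C q \<epsilon>
             (\<lambda>n. (real q - real \<Delta>) / (real q - real \<Delta> - \<psi>) * real n * ln (real n / \<epsilon>)) \<and>
           scan_mixing_asymp_bound C q \<epsilon>
             (\<lambda>n. (real q - real \<Delta> - \<psi>/2) / (real q - real \<Delta> - \<psi>) * ln (real n / \<epsilon>))) \<and>
         (real q = real \<Delta> + \<psi> \<and> \<Delta> > 6 \<longrightarrow>
           random_mixing_bound C q \<epsilon>
             (\<lambda>n. \<psi>^2 / (12 * (real \<Delta> - 6)) * real n^2 * ln (real n / \<epsilon>)) \<and>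
           scan_mixing_asymp_bound C q \<epsilon>
             (\<lambda>n. \<psi>^2 / (12 * (real \<Delta> - 6)) * real n * ln (real n / \<epsilon>))) \<and>
         (real q = real \<Delta> + \<psi> \<and> \<Delta> = 6 \<longrightarrow>
           random_mixing_bound C q \<epsilon> (\<lambda>n. 1/2 * real n^3 * ln (real n / \<epsilon>)) \<and>
           scan_mixing_asymp_bound C q \<epsilon> (\<lambda>n. 3/4 * real n^2 * ln (real n / \<epsilon>)))))
     \<and>
     (0 < g \<longrightarrow>
       (let C = (\<lambda>n. {E \<in> graphs \<Delta> n. has_genus g {1..n} E});
            \<psi> = 2 * sqrt (kappa_genus g * (real \<Delta> - kappa_genus g)) in
         real \<Delta> > 2 * kappa_genus g \<and> real q > real \<Delta> + \<psi> \<longrightarrow>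
           random_mixing_bound C q \<epsilon>
             (\<lambda>n. (real q - real \<Delta>) / (real q - real \<Delta> - \<psi>) * real n * ln (real n / \<epsilon>)) \<and>
           scan_mixing_asymp_bound C q \<epsilon>
             (\<lambda>n. (real q - real \<Delta> - \<psi>/2) / (real q - real \<Delta> - \<psi>) * ln (real n / \<epsilon>))))"
proof (intro conjI impI, goal_cases)
  case 1
  then have q: "q = 2 * \<Delta>" and \<Delta>0: "0 < \<Delta>" using assms(3) by auto
  let ?C = "\<lambda>n. {E \<in> graphs \<Delta> n. connected_graph {1..n} E \<and> \<not> regular_graph {1..n} E}"
  have C: "E \<in> graphs \<Delta> n" if "E \<in> ?C n" for n E using that by simp
  \<comment> \<open>With the gap constant c = 2/\<Delta>^2 and k = 2 the time constants are 1/c =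
    \<Delta>^2/2 and 3/(2c) = 3\<Delta>^2/4.\<close>
  have c: "0 < 2 / (real \<Delta>)\<^sup>2" using \<Delta>0 by simp
  have sb: "spectral_bound n E ((real q - real \<Delta>) * (1 - 2 / (real \<Delta>)\<^sup>2 / real n ^ 2))" if E: "E \<in> ?C n" for n E
  proof (rule spectral_bound_mono)
    show "spectral_bound n E (real \<Delta> - 1 / (real n)\<^sup>2)"
      using E by (intro spectral_bound_nonregular) auto
    have \<Delta>2: "2 \<le> \<Delta>" using E by (intro nonregular_max_degree_ge_2[of E \<Delta> n]) auto
    have n0: "0 < real n" using C[OF E] unfolding graphs_def by simp
    have "2 / (real \<Delta> * (real n)\<^sup>2) \<le> 2 / (2 * (real n)\<^sup>2)"
      using \<Delta>2 n0 by (intro divide_left_mono mult_right_mono) auto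
    moreover have "(real q - real \<Delta>) * (1 - 2 / (real \<Delta>)\<^sup>2 / real n ^ 2) = real \<Delta> - 2 / (real \<Delta> * (real n)\<^sup>2)"
      unfolding q using \<Delta>0 n0 by (simp add: field_simps power2_eq_square)
    ultimately show "real \<Delta> - 1 / (real n)\<^sup>2 \<le> (real q - real \<Delta>) * (1 - 2 / (real \<Delta>)\<^sup>2 / real n ^ 2)"
      by simp
  qed
  note m = mixing_critical[of ?C \<Delta> q \<epsilon> "2 / (real \<Delta>)\<^sup>2" 2, OF C assms(3,1,2) c _ sb]
  have "random_mixing_bound ?C q \<epsilon> (\<lambda>n. 1/2 * real \<Delta>^2 * real n ^ (2 + 1) * ln (real n / \<epsilon>))"
    by (rule m(1)) (simp_all add: field_simps)
  moreover have "scan_mixing_asymp_bound ?C q \<epsilon> (\<lambda>n. 3/4 * real \<Delta>^2 * real n ^ 2 * ln (real n / \<epsilon>))"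
    by (rule m(2)) (simp_all add: field_simps)
  ultimately show ?case unfolding Let_def by simp
next
  case 2
  let ?C = "\<lambda>n. {E \<in> graphs \<Delta> n. treewidth {1..n} E = t}"
  define \<psi> where "\<psi> = 2 * sqrt (real t * (real \<Delta> - real t))"
  have C: "E \<in> graphs \<Delta> n" if "E \<in> ?C n" for n E using that by simp
  have t2: "2 * real t \<le> real \<Delta>" using 2 by linarith
  have dens: "real (card {e\<in>E. e \<subseteq> U}) \<le> (real t - real t * (real t + 1) / (2 * real n)) * card U"
    if "E \<in> ?C n" "U \<subseteq> {1..n}" for n E U
    using that 2 by (intro treewidth_density) auto
  have dens0: "real (card {e\<in>E. e \<subseteq> U}) \<le> real t * card U" if "E \<in> ?C n" "U \<subseteq> {1..n}" for n E U
  proof -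
    have "(real t - real t * (real t + 1) / (2 * real n)) * card U \<le> real t * card U"
      by (intro mult_right_mono) auto
    then show ?thesis using dens[OF that] by linarith
  qed
  have crit: "spectral_bound n E ((real q - real \<Delta>) * (1 - x))"
    if E: "E \<in> ?C n" and q: "real q = real \<Delta> + \<psi>"
      and x: "x \<le> 2 * (real t * (real t + 1) / (2 * real n) * (real \<Delta> - 2 * real t)
        + (real t * (real t + 1) / (2 * real n))\<^sup>2) / \<psi>\<^sup>2" for n E x
  proof -
    \<comment> \<open>q > \<Delta> excludes \<psi> = 0 and with it t = 0.\<close>
    have "\<psi> \<noteq> 0" using q assms(3) by auto
    then have t0: "0 < real t" unfolding \<psi>_def by (cases "t = 0") auto
    have "t + 1 \<le> n" using max_degree_less[OF C[OF E]] 2 by linarith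
    then have n: "real t + 1 \<le> real n" by linarith
    have "real t * (real t + 1) \<le> real t * (2 * real n)" using n by (intro mult_left_mono) auto
    then have \<delta>: "real t * (real t + 1) / (2 * real n) \<le> real t" using n t0 by (simp add: divide_le_eq)
    have "spectral_bound n E (\<psi> * (1 - x))"
      by (rule spectral_bound_critical[OF C[OF E] t0 t2 _ \<delta> dens[OF E] \<psi>_def x]) simp
    then show ?thesis using q by simp
  qed
  show ?case
    unfolding Let_def \<psi>_def[symmetric]
  proof (intro conjI impI)
    assume q: "real \<Delta> + \<psi> < real q"
    note m = mixing_noncritical[of ?C \<Delta> \<epsilon> "real t" \<psi> q, OF C assms(1,2) dens0 _ t2 \<psi>_def q]
    show "random_mixing_bound ?C q \<epsilon> (\<lambda>n. (real q - real \<Delta>) / (real q - real \<Delta> - \<psi>) * real n * ln (real n / \<epsilon>))"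
      by (rule m(1)) simp_all
    show "scan_mixing_asymp_bound ?C q \<epsilon> (\<lambda>n. (real q - real \<Delta> - \<psi> / 2) / (real q - real \<Delta> - \<psi>) * ln (real n / \<epsilon>))"
      by (rule m(2)) simp_all
  next
    assume a: "real q = real \<Delta> + \<psi> \<and> 2 * t < \<Delta>"
    \<comment> \<open>The linear term 2 \<delta> (\<Delta> - 2t)/\<psi>^2 at \<delta> = t(t +
      1)/(2n) equals c/n.\<close>
    define c where "c = real t * (real t + 1) * (real \<Delta> - 2 * real t) / \<psi>\<^sup>2"
    have \<psi>0: "0 < \<psi>" using a assms(3) by linarith
    then have t0: "0 < real t" unfolding \<psi>_def by (cases "t = 0") auto
    have dt: "0 < real \<Delta> - 2 * real t" using a by linarith
    have c0: "0 < c" unfolding c_def using \<psi>0 t0 dt by simp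
    have sb: "spectral_bound n E ((real q - real \<Delta>) * (1 - c / real n ^ 1))" if E: "E \<in> ?C n" for n E
    proof (rule crit[OF E conjunct1[OF a]])
      have "c / real n ^ 1 = 2 * (real t * (real t + 1) / (2 * real n) * (real \<Delta> - 2 * real t)) / \<psi>\<^sup>2"
        unfolding c_def by simp
      also have "\<dots> \<le> 2 * (real t * (real t + 1) / (2 * real n) * (real \<Delta> - 2 * real t)
        + (real t * (real t + 1) / (2 * real n))\<^sup>2) / \<psi>\<^sup>2"
        by (intro divide_right_mono mult_left_mono) auto
      finally show "c / real n ^ 1 \<le> \<dots>" .
    qed
    note m = mixing_critical[of ?C \<Delta> q \<epsilon> c 1, OF C assms(3,1,2) c0 _ sb]
    have "random_mixing_bound ?C q \<epsilon> (\<lambda>n. \<psi>^2 / (real t * (real t + 1) * (real \<Delta> - 2 * real t)) * real n ^ (1 + 1) * ln (real n / \<epsilon>))"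
      by (rule m(1)) (simp_all add: c_def)
    then show "random_mixing_bound ?C q \<epsilon> (\<lambda>n. \<psi>^2 / (real t * (real t + 1) * (real \<Delta> - 2 * real t)) * real n ^ 2 * ln (real n / \<epsilon>))"
      by (simp only: one_add_one)
    have "scan_mixing_asymp_bound ?C q \<epsilon> (\<lambda>n. \<psi>^2 / (real t * (real t + 1) * (real \<Delta> - 2 * real t)) * real n ^ 1 * ln (real n / \<epsilon>))"
      by (rule m(2)) (simp_all add: c_def)
    then show "scan_mixing_asymp_bound ?C q \<epsilon> (\<lambda>n. \<psi>^2 / (real t * (real t + 1) * (real \<Delta> - 2 * real t)) * real n * ln (real n / \<epsilon>))"
      by (simp only: power_one_right)
  next
    assume a: "real q = real \<Delta> + \<psi> \<and> \<Delta> = 2 * t"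
    \<comment> \<open>The linear term vanishes. As \<psi> = 2t, the quadratic term 2
      \<delta>^2/\<psi>^2 at \<delta> = t(t + 1)/(2n) is (t + 1)^2/(8 n^2).\<close>
    define c where "c = (real t + 1)\<^sup>2 / 8"
    have \<psi>0: "0 < \<psi>" using a assms(3) by linarith
    then have t0: "0 < real t" unfolding \<psi>_def by (cases "t = 0") auto
    have \<psi>2: "\<psi>\<^sup>2 = 4 * (real t)\<^sup>2" unfolding \<psi>_def using a by (simp add: power2_eq_square)
    have c0: "0 < c" unfolding c_def by (simp add: add_pos_nonneg)
    have sb: "spectral_bound n E ((real q - real \<Delta>) * (1 - c / real n ^ 2))" if E: "E \<in> ?C n" for n E
    proof (rule crit[OF E conjunct1[OF a]])
      have "0 < real n" using C[OF E] unfolding graphs_def by simp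
      then show "c / real n ^ 2 \<le> 2 * (real t * (real t + 1) / (2 * real n) * (real \<Delta> - 2 * real t)
        + (real t * (real t + 1) / (2 * real n))\<^sup>2) / \<psi>\<^sup>2"
        unfolding c_def \<psi>2 using a t0 by (simp add: field_simps power2_eq_square)
    qed
    note m = mixing_critical[of ?C \<Delta> q \<epsilon> c 2, OF C assms(3,1,2) c0 _ sb]
    have "random_mixing_bound ?C q \<epsilon> (\<lambda>n. 8 / (real t + 1)^2 * real n ^ (2 + 1) * ln (real n / \<epsilon>))"
      by (rule m(1)) (simp_all add: c_def)
    then show "random_mixing_bound ?C q \<epsilon> (\<lambda>n. 8 / (real t + 1)^2 * real n ^ 3 * ln (real n / \<epsilon>))" by simp
    show "scan_mixing_asymp_bound ?C q \<epsilon> (\<lambda>n. 12 / (real t + 1)^2 * real n ^ 2 * ln (real n / \<epsilon>))"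
      by (rule m(2)) (simp_all add: c_def)
  qed
next
  case 3
  let ?C = "\<lambda>n. {E \<in> graphs \<Delta> n. planar_graph {1..n} E}"
  define \<psi> where "\<psi> = 2 * sqrt (3 * (real \<Delta> - 3))"
  have \<psi>0: "0 < \<psi>" and \<psi>2: "\<psi>\<^sup>2 = 12 * (real \<Delta> - 3)" unfolding \<psi>_def power_mult_distrib using 3 by auto
  have C: "E \<in> graphs \<Delta> n" if "E \<in> ?C n" for n E using that by simp
  have \<Delta>6: "2 * 3 \<le> real \<Delta>" using 3 by linarith
  have dens: "real (card {e\<in>E. e \<subseteq> U}) \<le> (3 - 6 / real n) * card U" if "E \<in> ?C n" "U \<subseteq> {1..n}" for n E U
    using that 3 by (intro planar_density) auto
  have dens0: "real (card {e\<in>E. e \<subseteq> U}) \<le> 3 * real (card U)" if "E \<in> ?C n" "U \<subseteq> {1..n}" for n E U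
  proof -
    have "(3 - 6 / real n) * card U \<le> 3 * real (card U)" by (intro mult_right_mono) auto
    then show ?thesis using dens[OF that] by linarith
  qed
  have crit: "spectral_bound n E ((real q - real \<Delta>) * (1 - x))"
    if E: "E \<in> ?C n" and q: "real q = real \<Delta> + \<psi>"
      and x: "x \<le> 2 * (6 / real n * (real \<Delta> - 2 * 3) + (6 / real n)\<^sup>2) / \<psi>\<^sup>2" for n E x
  proof -
    have "2 \<le> n" using max_degree_less[OF C[OF E]] 3 by linarith
    then have \<delta>: "6 / real n \<le> 3" by (simp add: divide_le_eq)
    have "spectral_bound n E (\<psi> * (1 - x))"
      by (rule spectral_bound_critical[OF C[OF E] _ \<Delta>6 _ \<delta> dens[OF E] \<psi>_def x]) simp_all
    then show ?thesis using q by simp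
  qed
  show ?case
    unfolding Let_def \<psi>_def[symmetric]
  proof (intro conjI impI)
    assume q: "real \<Delta> + \<psi> < real q"
    note m = mixing_noncritical[of ?C \<Delta> \<epsilon> 3 \<psi> q, OF C assms(1,2) dens0 _ \<Delta>6 \<psi>_def q]
    show "random_mixing_bound ?C q \<epsilon> (\<lambda>n. (real q - real \<Delta>) / (real q - real \<Delta> - \<psi>) * real n * ln (real n / \<epsilon>))"
      by (rule m(1)) simp_all
    show "scan_mixing_asymp_bound ?C q \<epsilon> (\<lambda>n. (real q - real \<Delta> - \<psi> / 2) / (real q - real \<Delta> - \<psi>) * ln (real n / \<epsilon>))"
      by (rule m(2)) simp_all
  next
    assume a: "real q = real \<Delta> + \<psi> \<and> 6 < \<Delta>"
    \<comment> \<open>The linear term 2 \<delta> (\<Delta> - 6)/\<psi>^2 at the planar deficit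
      \<delta> = 6/n equals c/n.\<close>
    define c where "c = 12 * (real \<Delta> - 6) / \<psi>\<^sup>2"
    have c0: "0 < c" unfolding c_def using \<psi>0 a by simp
    have sb: "spectral_bound n E ((real q - real \<Delta>) * (1 - c / real n ^ 1))" if E: "E \<in> ?C n" for n E
    proof (rule crit[OF E conjunct1[OF a]])
      have "c / real n ^ 1 = 2 * (6 / real n * (real \<Delta> - 2 * 3)) / \<psi>\<^sup>2"
        unfolding c_def by simp
      also have "\<dots> \<le> 2 * (6 / real n * (real \<Delta> - 2 * 3) + (6 / real n)\<^sup>2) / \<psi>\<^sup>2"
        by (intro divide_right_mono mult_left_mono) auto
      finally show "c / real n ^ 1 \<le> \<dots>" .
    qed
    note m = mixing_critical[of ?C \<Delta> q \<epsilon> c 1, OF C assms(3,1,2) c0 _ sb]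
    have "random_mixing_bound ?C q \<epsilon> (\<lambda>n. \<psi>^2 / (12 * (real \<Delta> - 6)) * real n ^ (1 + 1) * ln (real n / \<epsilon>))"
      by (rule m(1)) (simp_all add: c_def)
    then show "random_mixing_bound ?C q \<epsilon> (\<lambda>n. \<psi>^2 / (12 * (real \<Delta> - 6)) * real n ^ 2 * ln (real n / \<epsilon>))"
      by (simp only: one_add_one)
    have "scan_mixing_asymp_bound ?C q \<epsilon> (\<lambda>n. \<psi>^2 / (12 * (real \<Delta> - 6)) * real n ^ 1 * ln (real n / \<epsilon>))"
      by (rule m(2)) (simp_all add: c_def del: right_diff_distrib_numeral)
    then show "scan_mixing_asymp_bound ?C q \<epsilon> (\<lambda>n. \<psi>^2 / (12 * (real \<Delta> - 6)) * real n * ln (real n / \<epsilon>))"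
      by (simp only: power_one_right)
  next
    assume a: "real q = real \<Delta> + \<psi> \<and> \<Delta> = 6"
    \<comment> \<open>The quadratic term alone: \<psi>^2 = 36 and \<delta> = 6/n give 2
      \<delta>^2/\<psi>^2 = 2/n^2.\<close>
    have sb: "spectral_bound n E ((real q - real \<Delta>) * (1 - 2 / real n ^ 2))" if E: "E \<in> ?C n" for n E
    proof (rule crit[OF E conjunct1[OF a]])
      show "2 / real n ^ 2 \<le> 2 * (6 / real n * (real \<Delta> - 2 * 3) + (6 / real n)\<^sup>2) / \<psi>\<^sup>2"
        unfolding \<psi>2 using a by (simp add: power_divide)
    qed
    note m = mixing_critical[of ?C \<Delta> q \<epsilon> 2 2, OF C assms(3,1,2) _ _ sb]
    have "random_mixing_bound ?C q \<epsilon> (\<lambda>n. 1/2 * real n ^ (2 + 1) * ln (real n / \<epsilon>))"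
      by (rule m(1)) simp_all
    then show "random_mixing_bound ?C q \<epsilon> (\<lambda>n. 1/2 * real n ^ 3 * ln (real n / \<epsilon>))" by simp
    show "scan_mixing_asymp_bound ?C q \<epsilon> (\<lambda>n. 3/4 * real n ^ 2 * ln (real n / \<epsilon>))"
      by (rule m(2)) simp_all
  qed
next
  case 4
  let ?C = "\<lambda>n. {E \<in> graphs \<Delta> n. has_genus g {1..n} E}"
  define \<psi> where "\<psi> = 2 * sqrt (kappa_genus g * (real \<Delta> - kappa_genus g))"
  have C: "E \<in> graphs \<Delta> n" if "E \<in> ?C n" for n E using that by simp
  have dens: "real (card {e\<in>E. e \<subseteq> U}) \<le> kappa_genus g * card U" if "E \<in> ?C n" "U \<subseteq> {1..n}" for n E U
    using that 4 by (intro genus_density) auto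
  show ?case
    unfolding Let_def \<psi>_def[symmetric]
  proof (intro impI)
    assume a: "2 * kappa_genus g < real \<Delta> \<and> real \<Delta> + \<psi> < real q"
    then have \<kappa>2: "2 * kappa_genus g \<le> real \<Delta>" and q: "real \<Delta> + \<psi> < real q" by auto
    note m = mixing_noncritical[of ?C \<Delta> \<epsilon> "kappa_genus g" \<psi> q,
        OF C assms(1,2) dens kappa_genus_pos[OF 4] \<kappa>2 \<psi>_def q]
    show "random_mixing_bound ?C q \<epsilon> (\<lambda>n. (real q - real \<Delta>) / (real q - real \<Delta> - \<psi>) * real n * ln (real n / \<epsilon>)) \<and>
      scan_mixing_asymp_bound ?C q \<epsilon> (\<lambda>n. (real q - real \<Delta> - \<psi> / 2) / (real q - real \<Delta> - \<psi>) * ln (real n / \<epsilon>))"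
      by (intro conjI m) simp_all
  qed
qed

end
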